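(* Let $\Omega\subset\mathbb{C}$ be a planar domain and let $\mathcal{A}:\mathbb{C}\to\mathbb{C}$ be linear at $\infty$. Let $f:\Omega\to\mathbb{C}$ be a $W^{1,1}_{loc}(\Omega)$ solution to the autonomous Beltrami system $$f_{\bar z}=\mathcal{A}(f_z)\qquad\text{for almost every } z\in\Omega .$$ Then $f\in W^{1,p}_{loc}(\Omega)$ for all $p<\infty$. If in addition there is $k<1$ such that $|\mathcal{A}(\zeta)|\le k|\zeta|$ for all $\zeta\in\mathbb{C}$, then $f$ is also quasiregular.
   Context: Here $f_z=\tfrac12(f_x-if_y)$ and $f_{\bar z}=\tfrac12(f_x+if_y)$ are weak derivatives. A function $\mathcal{A}:\mathbb{C}\to\mathbb{C}$ is called linear at $\infty$ if there are constants $a,b\in\mathbb{C}$ with $|a|+|b|<1$ and $\alpha$ with $0\le\alpha<1$ such that $\mathcal{A}(\zeta)=a\zeta+b\bar\zeta+O(|\zeta|^{\alpha})$; precisely, there is a constant $C$ with $|\mathcal{A}(\zeta)-a\zeta-b\bar\zeta|\le C(1+|\zeta|^{\alpha})$ for all $\zeta\in\mathbb{C}$. No ellipticity (Lipschitz) assumption is made on $\mathcal{A}$ beyond what is stated. A mapping $f:\Omega\to\mathbb{C}$ is $K$-quasiregular, $1\le K<\infty$, if (after modification on a null set) it is continuous, $f\in W^{1,2}_{loc}(\Omega)$, and $|f_{\bar z}|\le\frac{K-1}{K+1}|f_z|$ almost everywhere in $\Omega$ (constants are allowed). It is quasiregular if it is $K$-quasiregular for some $K<\infty$. *)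

theory Defs
  imports "HOL-Analysis.Analysis"
begin

text \<open>Functions on an open set \<open>\<Omega>\<close> are total functions on the complex plane; only their values
  on \<open>\<Omega>\<close> matter, and all measure-theoretic notions refer to \<^term>\<open>lebesgue_on \<Omega>\<close>.\<close>

fun Ck :: "nat \<Rightarrow> (complex \<Rightarrow> real) \<Rightarrow> bool" where
  "Ck 0 \<phi> \<longleftrightarrow> continuous_on UNIV \<phi>"
| "Ck (Suc n) \<phi> \<longleftrightarrow> (\<forall>z. \<phi> differentiable (at z)) \<and>
     (\<forall>v. Ck n (\<lambda>z. frechet_derivative \<phi> (at z) v))"

definition test_function :: "complex set \<Rightarrow> (complex \<Rightarrow> real) \<Rightarrow> bool" where
  "test_function \<Omega> \<phi> \<longleftrightarrow> (\<forall>n. Ck n \<phi>) \<and>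
     compact (closure {z. \<phi> z \<noteq> 0}) \<and> closure {z. \<phi> z \<noteq> 0} \<subseteq> \<Omega>"

definition Lp_loc :: "real \<Rightarrow> complex set \<Rightarrow> (complex \<Rightarrow> complex) \<Rightarrow> bool" where
  "Lp_loc p \<Omega> f \<longleftrightarrow> f \<in> borel_measurable (lebesgue_on \<Omega>) \<and>
     (\<forall>K. compact K \<and> K \<subseteq> \<Omega> \<longrightarrow> integrable (lebesgue_on K) (\<lambda>z. norm (f z) powr p))"

definition has_weak_derivative ::
  "complex set \<Rightarrow> complex \<Rightarrow> (complex \<Rightarrow> complex) \<Rightarrow> (complex \<Rightarrow> complex) \<Rightarrow> bool" where
  "has_weak_derivative \<Omega> v f g \<longleftrightarrow> Lp_loc 1 \<Omega> f \<and> Lp_loc 1 \<Omega> g \<and>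
     (\<forall>\<phi>. test_function \<Omega> \<phi> \<longrightarrow>
       (LINT z|lebesgue_on \<Omega>. frechet_derivative \<phi> (at z) v *\<^sub>R f z)
         = - (LINT z|lebesgue_on \<Omega>. \<phi> z *\<^sub>R g z))"

text \<open>On an open set a weak derivative is unique up to a null set, so the choice below is
  immaterial in statements that hold almost everywhere. The directions \<open>1\<close> and \<open>\<i>\<close> give the
  partial derivatives in \<open>x\<close> and \<open>y\<close>.\<close>

definition weak_derivative ::
  "complex set \<Rightarrow> complex \<Rightarrow> (complex \<Rightarrow> complex) \<Rightarrow> complex \<Rightarrow> complex" where
  "weak_derivative \<Omega> v f = (SOME g. has_weak_derivative \<Omega> v f g)"

definition weak_dz :: "complex set \<Rightarrow> (complex \<Rightarrow> complex) \<Rightarrow> complex \<Rightarrow> complex" where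
  "weak_dz \<Omega> f z = (weak_derivative \<Omega> 1 f z - \<i> * weak_derivative \<Omega> \<i> f z) / 2"

definition weak_dzbar :: "complex set \<Rightarrow> (complex \<Rightarrow> complex) \<Rightarrow> complex \<Rightarrow> complex" where
  "weak_dzbar \<Omega> f z = (weak_derivative \<Omega> 1 f z + \<i> * weak_derivative \<Omega> \<i> f z) / 2"

definition W1p_loc :: "real \<Rightarrow> complex set \<Rightarrow> (complex \<Rightarrow> complex) \<Rightarrow> bool" where
  "W1p_loc p \<Omega> f \<longleftrightarrow> Lp_loc p \<Omega> f \<and>
     (\<forall>v\<in>{1, \<i>}. \<exists>g. has_weak_derivative \<Omega> v f g \<and> Lp_loc p \<Omega> g)"

text \<open>For \<open>\<alpha> = 0\<close> and \<open>\<zeta> = 0\<close> the library has \<open>0 powr 0 = 0\<close> rather than \<open>1\<close>; this changes the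
  admissible constant \<open>C\<close> by at most a factor of two.\<close>

definition linear_at_infinity :: "(complex \<Rightarrow> complex) \<Rightarrow> bool" where
  "linear_at_infinity A \<longleftrightarrow> (\<exists>a b. \<exists>\<alpha>::real. cmod a + cmod b < 1 \<and> 0 \<le> \<alpha> \<and> \<alpha> < 1 \<and>
     (\<exists>C. \<forall>\<zeta>. cmod (A \<zeta> - a * \<zeta> - b * cnj \<zeta>) \<le> C * (1 + cmod \<zeta> powr \<alpha>)))"

definition K_quasiregular :: "real \<Rightarrow> complex set \<Rightarrow> (complex \<Rightarrow> complex) \<Rightarrow> bool" where
  "K_quasiregular K \<Omega> f \<longleftrightarrow> 1 \<le> K \<and>
     (\<exists>g. continuous_on \<Omega> g \<and> (AE z in lebesgue_on \<Omega>. f z = g z)) \<and>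
     W1p_loc 2 \<Omega> f \<and>
     (AE z in lebesgue_on \<Omega>. cmod (weak_dzbar \<Omega> f z) \<le> (K - 1) / (K + 1) * cmod (weak_dz \<Omega> f z))"

definition quasiregular :: "complex set \<Rightarrow> (complex \<Rightarrow> complex) \<Rightarrow> bool" where
  "quasiregular \<Omega> f \<longleftrightarrow> (\<exists>K. K_quasiregular K \<Omega> f)"

end

theory Submission
  imports Defs
begin

text \<open>Subtracting the linear part at infinity turns the nonlinear system into a linear one with an
error term: \<open>h = f\<^bsub>zbar\<^esub> - a f\<^bsub>z\<^esub> - b cnj f\<^bsub>z\<^esub>\<close> satisfies \<open>|h| \<le> C (1 + |f\<^bsub>z\<^esub>| powr \<alpha>)\<close> almost
everywhere. If the gradient of \<open>f\<close> lies in \<open>L\<^sup>s\<close> locally, then \<open>h\<close> lies in \<open>L\<^sup>r\<close> with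
\<open>r = s / \<alpha> > s\<close> (take \<open>\<alpha> > 0\<close>, which is no restriction), and the \<open>L\<^sup>r\<close> theory of the constant coefficient operator on the left, which is
elliptic because \<open>|a| + |b| < 1\<close>, returns the gradient to \<open>L\<^sup>r\<close>. Starting from \<open>s = 1\<close> and
iterating, the exponent grows geometrically beyond every \<open>p\<close>. The integrability statement
uses the equation only through this bound on \<open>h\<close>.

Three ingredients carry the argument, all proved on a square \<open>Q\<close> of side \<open>l\<close>, regarded as a
period cell, for the product \<open>u\<close> of \<open>f\<close> with a smooth bump supported inside \<open>Q\<close>.

\<^item> The \<open>L\<^sup>p\<close> estimate (\<open>boxder_regularity\<close>). A real linear substitution
  \<open>u - \<beta> cnj u\<close> leads to an operator of the same kind with \<open>b = 0\<close> and another coefficient \<open>a'\<close>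
  of modulus less than one (\<open>ellipticity_diagonal\<close>). On the Fourier side
  the operator that maps \<open>u\<^bsub>zbar\<^esub> - a' u\<^bsub>z\<^esub>\<close> to \<open>u\<^bsub>z\<^esub>\<close> is the multiplier \<open>cnj n / N\<close> with
  \<open>N = n - a' cnj n\<close>, an affine function of the square of the Riesz symbol \<open>cnj N / |N|\<close>. The
  Riesz symbol is an average over directions of the signs of linear forms of \<open>n\<close>
  (\<open>riesz_symbol_integral\<close>), and the multiplier given by the sign of a linear form is controlled by the classical
  argument of M. Riesz: a trigonometric polynomial with frequencies in a half plane has powers with an
  explicit mean value (\<open>hardy_mean_powr\<close>, \<open>riesz_hardy\<close>). This gives all exponents
  \<open>1 < p \<le> 2\<close>, and duality (\<open>Lp_by_duality\<close>) gives the remaining ones. No singular integral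
  occurs. Since the pairing with trigonometric polynomials makes sense for \<open>u\<^bsub>z\<^esub>\<close> merely in
  \<open>L\<^sup>1\<close>, the duality argument starts from \<open>W\<^sup>1\<^sup>,\<^sup>1\<close>.

\<^item> The Sobolev inequality \<open>W\<^sup>1\<^sup>,\<^sup>s \<subseteq> L\<^sup>2\<^sup>s\<close> (\<open>sobolev\<close>), needed because the bump
  produces terms in \<open>f\<close> itself. Comparing Fourier coefficients shows that \<open>u\<close> is, along almost
  every line, the primitive of its weak derivative (\<open>boxder_primitive\<close>); the Gagliardo-Nirenberg
  product bound follows.

\<^item> Continuity for gradients in \<open>L\<^sup>4\<close> (\<open>morrey\<close>), needed for quasiregularity: averages over
  squares of side \<open>r\<close> change by \<open>O(sqrt r)\<close> when \<open>r\<close> is halved, so they converge uniformly.\<close>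

section \<open>Integrability of powers\<close>

lemma add_powr_le:
  fixes a b p :: real
  assumes "0 \<le> a" "0 \<le> b" "0 \<le> p"
  shows "(a + b) powr p \<le> 2 powr p * (a powr p + b powr p)"
proof -
  have "(a + b) powr p \<le> (2 * max a b) powr p"
    using assms by (intro powr_mono2) auto
  also have "\<dots> = 2 powr p * max a b powr p"
    using assms by (intro powr_mult)
  also have "\<dots> \<le> 2 powr p * (a powr p + b powr p)"
    by (intro mult_left_mono) (auto simp: max_def)
  finally show ?thesis .
qed

lemma norm_add_powr_le:
  fixes a b :: complex
  assumes "0 \<le> p"
  shows "norm (a + b) powr p \<le> 2 powr p * (norm a powr p + norm b powr p)"
proof -
  have "norm (a + b) powr p \<le> (norm a + norm b) powr p"
    using assms by (intro powr_mono2 norm_triangle_ineq) auto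
  also have "\<dots> \<le> 2 powr p * (norm a powr p + norm b powr p)"
    using assms by (intro add_powr_le) auto
  finally show ?thesis .
qed

text \<open>\<open>Lp_loc\<close> quantifies over compact sets; the estimates below concern a single measure space,
which \<open>Lp\<close> isolates. It also records measurability, so that it can be passed around as one
hypothesis.\<close>

definition Lp :: "'a measure \<Rightarrow> real \<Rightarrow> ('a \<Rightarrow> complex) \<Rightarrow> bool" where
  "Lp M p g \<longleftrightarrow> g \<in> borel_measurable M \<and> integrable M (\<lambda>x. norm (g x) powr p)"

lemma Lp_1_iff: "Lp M 1 g \<longleftrightarrow> integrable M g"
  unfolding Lp_def by (auto simp: integrable_norm_iff)

lemma Lp_dominated_by:
  assumes "integrable M h" and f: "f \<in> borel_measurable M"
    and "AE x in M. norm (f x) powr p \<le> h x"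
  shows "Lp M p f"
  unfolding Lp_def
proof
  show "integrable M (\<lambda>x. norm (f x) powr p)"
    by (rule Bochner_Integration.integrable_bound[OF assms(1)]) (use assms in auto)
qed (rule f)

lemma Lp_dominated:
  assumes "Lp M p g" "f \<in> borel_measurable M" "0 \<le> p" "0 \<le> C"
    and "AE x in M. norm (f x) \<le> C * norm (g x)"
  shows "Lp M p f"
proof (rule Lp_dominated_by)
  show "integrable M (\<lambda>x. C powr p * norm (g x) powr p)"
    using assms(1) by (simp add: Lp_def)
  show "AE x in M. norm (f x) powr p \<le> C powr p * norm (g x) powr p"
    using assms(5)
  proof eventually_elim
    case (elim x)
    then have "norm (f x) powr p \<le> (C * norm (g x)) powr p"
      using assms by (intro powr_mono2) auto
    then show ?case using assms by (simp add: powr_mult)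
  qed
qed (use assms in auto)

lemma Lp_add:
  assumes "Lp M p f" "Lp M p g" "0 \<le> p"
  shows "Lp M p (\<lambda>x. f x + g x)"
proof (rule Lp_dominated_by)
  show "integrable M (\<lambda>x. 2 powr p * (norm (f x) powr p + norm (g x) powr p))"
    using assms by (auto simp: Lp_def)
qed (use assms in \<open>auto simp: Lp_def intro!: norm_add_powr_le\<close>)

lemma Lp_bounded_mult:
  assumes "Lp M p g" "b \<in> borel_measurable M" "0 \<le> p" "AE x in M. norm (b x) \<le> C"
  shows "Lp M p (\<lambda>x. b x * g x)"
proof (rule Lp_dominated[OF assms(1), where C="\<bar>C\<bar>"])
  show "AE x in M. norm (b x * g x) \<le> \<bar>C\<bar> * norm (g x)"
    using assms(4) by eventually_elim (auto simp: norm_mult intro!: mult_right_mono)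
qed (use assms in \<open>auto simp: Lp_def\<close>)

lemma Lp_cmult: "Lp M p g \<Longrightarrow> 0 \<le> p \<Longrightarrow> Lp M p (\<lambda>x. c * g x)" for c :: complex
  by (rule Lp_bounded_mult[where C="norm c"]) auto

lemma Lp_diff:
  assumes "Lp M p f" "Lp M p g" "0 \<le> p"
  shows "Lp M p (\<lambda>x. f x - g x)"
  using Lp_add[OF assms(1) Lp_cmult[OF assms(2,3), of "-1"] assms(3)] by simp

lemma Lp_cnj: "Lp M p g \<Longrightarrow> Lp M p (\<lambda>x. cnj (g x))"
  unfolding Lp_def by (auto intro: borel_measurable_continuous_on[where f=cnj] continuous_intros)

lemma powr_le_one_add_powr:
  fixes t p q :: real
  assumes "0 \<le> t" "0 \<le> q" "q \<le> p"
  shows "t powr q \<le> 1 + t powr p"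
proof (cases "t \<le> 1")
  case True
  then have "t powr q \<le> 1" using assms by (intro powr_le1) auto
  then show ?thesis by (smt (verit) powr_ge_zero)
next
  case False
  then have "t powr q \<le> t powr p" using assms by (intro powr_mono) auto
  then show ?thesis by simp
qed

lemma Lp_mono:
  assumes "finite_measure M" "Lp M p g" "0 \<le> q" "q \<le> p"
  shows "Lp M q g"
proof (rule Lp_dominated_by)
  interpret finite_measure M by fact
  show "integrable M (\<lambda>x. 1 + norm (g x) powr p)"
    using assms by (auto simp: Lp_def)
qed (use assms in \<open>auto simp: Lp_def intro!: powr_le_one_add_powr\<close>)

lemma Lp_bounded:
  assumes "finite_measure M" "g \<in> borel_measurable M" "AE x in M. norm (g x) \<le> B" "0 \<le> p"
  shows "Lp M p g"
proof (rule Lp_dominated_by)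
  interpret finite_measure M by fact
  show "integrable M (\<lambda>x. \<bar>B\<bar> powr p)" by simp
  show "AE x in M. norm (g x) powr p \<le> \<bar>B\<bar> powr p"
    using assms(3) by eventually_elim (use assms in \<open>auto intro!: powr_mono2\<close>)
qed (use assms in auto)

text \<open>Young's inequality, applied pointwise after normalising both factors to norm one. When one norm
vanishes the normalisation is impossible, but then the product is zero almost everywhere.\<close>

lemma Hoelder:
  fixes f g :: "'a \<Rightarrow> complex"
  assumes p: "1 < p" "1 < q" "1/p + 1/q = 1" and f: "Lp M p f" and g: "Lp M q g"
  shows "integrable M (\<lambda>x. f x * g x)"
    and "(\<integral>x. norm (f x * g x) \<partial>M) \<le>
      (\<integral>x. norm (f x) powr p \<partial>M) powr (1/p) * (\<integral>x. norm (g x) powr q \<partial>M) powr (1/q)"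
proof -
  have [measurable]: "f \<in> borel_measurable M" "g \<in> borel_measurable M"
    using f g by (auto simp: Lp_def)
  have fi: "integrable M (\<lambda>x. norm (f x) powr p)" and gi: "integrable M (\<lambda>x. norm (g x) powr q)"
    using f g by (auto simp: Lp_def)
  have young: "norm (f x * g x) \<le> norm (f x) powr p / p + norm (g x) powr q / q" for x
    unfolding norm_mult using p by (intro Youngs_inequality) auto
  show int: "integrable M (\<lambda>x. f x * g x)"
    by (rule Bochner_Integration.integrable_bound[where f="\<lambda>x. norm (f x) powr p / p + norm (g x) powr q / q"])
      (use fi gi p in \<open>auto intro!: order_trans[OF young]\<close>)
  define F G where "F = (\<integral>x. norm (f x) powr p \<partial>M)" and "G = (\<integral>x. norm (g x) powr q \<partial>M)"
  have nn: "0 \<le> F" "0 \<le> G" by (auto simp: F_def G_def)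
  show "(\<integral>x. norm (f x * g x) \<partial>M) \<le> F powr (1/p) * G powr (1/q)"
  proof (cases "F = 0 \<or> G = 0")
    case True
    have "AE x in M. f x * g x = 0"
    proof (cases "F = 0")
      case True
      then have "AE x in M. norm (f x) powr p = 0"
        using fi unfolding F_def by (subst (asm) integral_nonneg_eq_0_iff_AE) auto
      then show ?thesis by eventually_elim auto
    next
      case False
      then have "AE x in M. norm (g x) powr q = 0"
        using gi True unfolding G_def by (subst (asm) integral_nonneg_eq_0_iff_AE) auto
      then show ?thesis by eventually_elim auto
    qed
    then have "(\<integral>x. norm (f x * g x) \<partial>M) = 0"
      by (intro integral_eq_zero_AE) auto
    then show ?thesis by simp
  next
    case False
    then have pos: "0 < F" "0 < G" using nn by auto
    define a b where "a = F powr (1/p)" and "b = G powr (1/q)"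
    have ab: "0 < a" "0 < b" using pos by (auto simp: a_def b_def)
    have apbq: "a powr p = F" "b powr q = G"
      using p pos by (auto simp: a_def b_def powr_powr)
    have "norm (f x * g x) / (a * b) \<le> norm (f x) powr p / (F * p) + norm (g x) powr q / (G * q)" for x
    proof -
      have "norm (f x * g x) / (a * b) = (norm (f x) / a) * (norm (g x) / b)"
        by (simp add: norm_mult)
      also have "\<dots> \<le> (norm (f x) / a) powr p / p + (norm (g x) / b) powr q / q"
        using p ab by (intro Youngs_inequality) auto
      finally show ?thesis using ab by (simp add: powr_divide apbq field_simps)
    qed
    then have "(\<integral>x. norm (f x * g x) / (a * b) \<partial>M) \<le>
        (\<integral>x. norm (f x) powr p / (F * p) + norm (g x) powr q / (G * q) \<partial>M)"
      using int fi gi by (intro integral_mono) (auto intro!: integrable_norm integrable_divide Bochner_Integration.integrable_add)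
    also have "\<dots> = F / (F * p) + G / (G * q)"
      using fi gi by (simp add: F_def G_def)
    also have "\<dots> = 1" using pos p by simp
    finally have "(\<integral>x. norm (f x * g x) \<partial>M) / (a * b) \<le> 1" by simp
    then show ?thesis using ab by (simp add: a_def b_def field_simps)
  qed
qed

text \<open>Hoelder's inequality against the constant one. For \<open>p = 1\<close> the factor is
\<open>measure M (space M) powr 0\<close>, which is one only for a measure that is not zero.\<close>

lemma Jensen_powr:
  fixes f :: "'a \<Rightarrow> complex"
  assumes fin: "finite_measure M" and pos: "0 < measure M (space M)" and p: "1 \<le> p" and f: "Lp M p f"
  shows "(\<integral>x. norm (f x) \<partial>M) powr p \<le> measure M (space M) powr (p - 1) * (\<integral>x. norm (f x) powr p \<partial>M)"
proof (cases "p = 1")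
  case True
  then show ?thesis using pos by simp
next
  case False
  then have p1: "1 < p" using p by simp
  interpret finite_measure M by fact
  define q where "q = p / (p - 1)"
  have q: "1 < q" "1/p + 1/q = 1" using p1 by (auto simp: q_def field_simps)
  have "Lp M q (\<lambda>_. 1)" by (rule Lp_bounded[where B=1]) (use fin q in auto)
  from Hoelder(2)[OF p1 q f this]
  have "(\<integral>x. norm (f x) \<partial>M) \<le> (\<integral>x. norm (f x) powr p \<partial>M) powr (1/p) * measure M (space M) powr (1/q)"
    by simp
  then have "(\<integral>x. norm (f x) \<partial>M) powr p \<le> ((\<integral>x. norm (f x) powr p \<partial>M) powr (1/p) * measure M (space M) powr (1/q)) powr p"
    using p1 by (intro powr_mono2) auto
  also have "\<dots> = (\<integral>x. norm (f x) powr p \<partial>M) * measure M (space M) powr (1/q * p)"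
    using p1 by (simp add: powr_mult powr_powr)
  also have "1/q * p = p - 1" using p1 by (simp add: q_def)
  finally show ?thesis by (simp add: mult.commute)
qed

section \<open>Squares and their characters\<close>

text \<open>The arguments in the two coordinate directions are identical, so they are carried out once for a
pair \<open>(v, w)\<close> that is \<open>(1, \<i>)\<close> or \<open>(\<i>, 1)\<close>; \<open>z \<bullet> v\<close> and \<open>z \<bullet> w\<close> are the coordinates.\<close>

definition axes :: "complex \<Rightarrow> complex \<Rightarrow> bool" where
  "axes v w \<longleftrightarrow> (v = 1 \<and> w = \<i>) \<or> (v = \<i> \<and> w = 1)"

lemma axes_decomp: "axes v w \<Longrightarrow> (z \<bullet> v) *\<^sub>R v + (z \<bullet> w) *\<^sub>R w = z"
  by (auto simp: axes_def complex_eq_iff inner_complex_def)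

lemma axes_inner:
  assumes "axes v w"
  shows "(t *\<^sub>R v + s *\<^sub>R w) \<bullet> v = t" "(t *\<^sub>R v + s *\<^sub>R w) \<bullet> w = s"
    "v \<bullet> (t *\<^sub>R v + s *\<^sub>R w) = t" "w \<bullet> (t *\<^sub>R v + s *\<^sub>R w) = s"
    "v \<bullet> v = 1" "w \<bullet> w = 1" "v \<bullet> w = 0" "w \<bullet> v = 0"
  using assms by (auto simp: axes_def inner_complex_def)

text \<open>This identifies Lebesgue measure on the plane with a product measure, so that Fubini's theorem
applies to functions of a complex variable.\<close>

lemma lborel_axes:
  assumes ax: "axes v w"
  shows "lborel = distr (lborel \<Otimes>\<^sub>M lborel) borel (\<lambda>x. fst x *\<^sub>R v + snd x *\<^sub>R w)"
proof (rule lborel_eqI)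
  fix l u :: complex
  assume le: "\<And>b. b \<in> Basis \<Longrightarrow> l \<bullet> b \<le> u \<bullet> b"
  let ?f = "\<lambda>x::real \<times> real. fst x *\<^sub>R v + snd x *\<^sub>R w"
  have [measurable]: "?f \<in> borel_measurable (lborel \<Otimes>\<^sub>M lborel)" by measurable
  have "?f -` box l u \<inter> space (lborel \<Otimes>\<^sub>M lborel) = {l \<bullet> v<..<u \<bullet> v} \<times> {l \<bullet> w<..<u \<bullet> w}"
    using ax by (auto simp: axes_def in_box_complex_iff inner_complex_def space_pair_measure)
  then have "emeasure (distr (lborel \<Otimes>\<^sub>M lborel) borel ?f) (box l u) =
      emeasure (lborel \<Otimes>\<^sub>M lborel) ({l \<bullet> v<..<u \<bullet> v} \<times> {l \<bullet> w<..<u \<bullet> w})"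
    by (subst emeasure_distr) auto
  also have "\<dots> = ennreal (u \<bullet> v - l \<bullet> v) * ennreal (u \<bullet> w - l \<bullet> w)"
    using le[of 1] le[of \<i>] ax
    by (subst lborel.emeasure_pair_measure_Times) (auto simp: axes_def Basis_complex_def)
  also have "\<dots> = (\<Prod>b\<in>Basis. (u - l) \<bullet> b)"
    using le[of 1] le[of \<i>] ax
    by (auto simp: axes_def Basis_complex_def ennreal_mult[symmetric] inner_diff_left mult.commute)
  finally show "emeasure (distr (lborel \<Otimes>\<^sub>M lborel) borel ?f) (box l u) = ennreal (\<Prod>b\<in>Basis. (u - l) \<bullet> b)"
    .
qed simp

text \<open>A square is used as a period cell, with the dual lattice of frequencies as index set for Fourier
coefficients. Its lower left corner \<open>c\<close> and side \<open>l\<close> are arbitrary, so that no change of variables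
is needed to reach small squares inside a domain.\<close>

locale square =
  fixes c :: complex and l :: real
  assumes l_pos: "0 < l"
begin

definition Q :: "complex set" where "Q = cbox c (c + Complex l l)"

abbreviation M :: "complex measure" where "M \<equiv> lebesgue_on Q"

definition \<kappa> :: real where "\<kappa> = 2 * pi / l"

text \<open>Frequencies are Gaussian integers, so that the symbols of the complex derivatives are plain complex
expressions in \<open>n\<close>: the character \<open>e n\<close> satisfies \<open>\<partial>\<^bsub>z\<^esub> e n = (\<i> \<kappa> / 2) cnj n (e n)\<close> and
\<open>\<partial>\<^bsub>zbar\<^esub> e n = (\<i> \<kappa> / 2) n (e n)\<close>.\<close>

definition freqs :: "complex set" where "freqs = {n. Re n \<in> \<int> \<and> Im n \<in> \<int>}"

definition e :: "complex \<Rightarrow> complex \<Rightarrow> complex" where "e n z = cis (\<kappa> * (n \<bullet> z))"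

definition trig :: "complex set \<Rightarrow> (complex \<Rightarrow> complex) \<Rightarrow> complex \<Rightarrow> complex" where
  "trig S a z = (\<Sum>n\<in>S. a n * e n z)"

lemma \<kappa>_pos: "0 < \<kappa>" using l_pos by (simp add: \<kappa>_def)

lemma mem_Q: "z \<in> Q \<longleftrightarrow> Re c \<le> Re z \<and> Re z \<le> Re c + l \<and> Im c \<le> Im z \<and> Im z \<le> Im c + l"
  by (auto simp: Q_def in_cbox_complex_iff)

lemma mem_Q_axes: "axes v w \<Longrightarrow> z \<in> Q \<longleftrightarrow> z \<bullet> v \<in> {c \<bullet> v .. c \<bullet> v + l} \<and> z \<bullet> w \<in> {c \<bullet> w .. c \<bullet> w + l}"
  by (auto simp: axes_def mem_Q inner_complex_def)

lemma compact_Q: "compact Q" by (simp add: Q_def)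
lemma Q_borel [measurable, simp]: "Q \<in> sets borel" by (simp add: Q_def)
lemma Q_lebesgue [simp]: "Q \<in> sets lebesgue" by (simp add: Q_def)

lemma space_M [simp]: "space M = Q" by simp

lemma finite_M: "finite_measure M"
  by (rule finite_measure_lebesgue_on) (simp add: Q_def)

sublocale M: finite_measure M by (rule finite_M)

lemma measure_M: "measure M Q = l\<^sup>2"
proof -
  have "measure M Q = measure lebesgue Q"
    by (subst measure_restrict_space) auto
  also have "\<dots> = measure lborel Q" by simp
  also have "\<dots> = l\<^sup>2"
    using l_pos unfolding Q_def
    by (subst measure_lborel_cbox) (auto simp: Basis_complex_def power2_eq_square inner_complex_def)
  finally show ?thesis .
qed

lemma integral_M_borel:
  fixes f :: "complex \<Rightarrow> 'b::{banach, second_countable_topology}"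
  assumes [measurable]: "f \<in> borel_measurable borel"
  shows "(\<integral>z. f z \<partial>M) = (\<integral>z. indicator Q z *\<^sub>R f z \<partial>lborel)"
    and "integrable M f \<longleftrightarrow> integrable lborel (\<lambda>z. indicator Q z *\<^sub>R f z)"
proof -
  have "(\<integral>z. f z \<partial>M) = (\<integral>z. indicator Q z *\<^sub>R f z \<partial>lebesgue)"
    by (subst integral_restrict_space) auto
  also have "\<dots> = (\<integral>z. indicator Q z *\<^sub>R f z \<partial>lborel)"
    by (rule integral_completion) auto
  finally show "(\<integral>z. f z \<partial>M) = (\<integral>z. indicator Q z *\<^sub>R f z \<partial>lborel)" .
  have "integrable M f \<longleftrightarrow> integrable lebesgue (\<lambda>z. indicator Q z *\<^sub>R f z)"
    by (subst integrable_restrict_space) auto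
  also have "\<dots> = integrable lborel (\<lambda>z. indicator Q z *\<^sub>R f z)"
    by (rule integrable_completion) auto
  finally show "integrable M f \<longleftrightarrow> integrable lborel (\<lambda>z. indicator Q z *\<^sub>R f z)" .
qed

lemma borel_measurable_M: "f \<in> borel_measurable borel \<Longrightarrow> f \<in> borel_measurable M"
  for f :: "complex \<Rightarrow> 'b::topological_space"
  by (intro measurable_restrict_space1 measurable_completion) simp

lemma continuous_measurable_M: "continuous_on UNIV f \<Longrightarrow> f \<in> borel_measurable M"
  for f :: "complex \<Rightarrow> 'b::topological_space"
  by (intro borel_measurable_M borel_measurable_continuous_onI)

lemma integrable_M_bounded:
  fixes f :: "complex \<Rightarrow> 'b::{banach, second_countable_topology}"
  assumes "f \<in> borel_measurable M" "\<And>z. z \<in> Q \<Longrightarrow> norm (f z) \<le> B"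
  shows "integrable M f"
  by (rule M.integrable_const_bound[where B=B]) (use assms in auto)

lemma continuous_integrable_M: "continuous_on UNIV f \<Longrightarrow> integrable M f"
  for f :: "complex \<Rightarrow> 'b::euclidean_space"
proof (rule integrable_M_bounded)
  assume f: "continuous_on UNIV f"
  then have "compact (f ` Q)"
    by (intro compact_continuous_image compact_Q) (auto intro: continuous_on_subset)
  then have bd: "bounded (f ` Q)" by (rule compact_imp_bounded)
  define B where "B = (SOME B. \<forall>y\<in>f ` Q. norm y \<le> B)"
  have "\<exists>B. \<forall>y\<in>f ` Q. norm y \<le> B" using bd by (auto simp: bounded_iff)
  then have "\<forall>y\<in>f ` Q. norm y \<le> B" unfolding B_def by (rule someI_ex)
  then show "norm (f z) \<le> (SOME B. \<forall>y\<in>f ` Q. norm y \<le> B)" if "z \<in> Q" for z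
    using that by (auto simp: B_def)
qed (rule continuous_measurable_M)

lemma e_0 [simp]: "e 0 z = 1" by (simp add: e_def)
lemma e_add: "e n z * e m z = e (n + m) z"
  by (simp add: e_def cis_mult inner_add_left distrib_left)
lemma cnj_e: "cnj (e n z) = e (- n) z" by (simp add: e_def cis_cnj)
lemma norm_e [simp]: "norm (e n z) = 1" by (simp add: e_def)
lemma continuous_e: "continuous_on UNIV (e n)"
  unfolding e_def cis_conv_exp by (intro continuous_intros)
lemma e_measurable [measurable]: "e n \<in> borel_measurable borel"
  by (rule borel_measurable_continuous_onI[OF continuous_e])
lemma continuous_trig: "continuous_on UNIV (trig S a)"
  unfolding trig_def by (intro continuous_intros continuous_e)
lemma trig_measurable [measurable]: "trig S a \<in> borel_measurable borel"
  by (rule borel_measurable_continuous_onI[OF continuous_trig])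

lemma norm_trig_le: "norm (trig S a z) \<le> (\<Sum>n\<in>S. norm (a n))"
  unfolding trig_def by (rule order_trans[OF norm_sum]) (simp add: norm_mult)

lemma freqs_0 [simp]: "0 \<in> freqs" by (simp add: freqs_def)
lemma freqs_uminus: "n \<in> freqs \<Longrightarrow> - n \<in> freqs" by (simp add: freqs_def)
lemma freqs_add: "n \<in> freqs \<Longrightarrow> m \<in> freqs \<Longrightarrow> n + m \<in> freqs" by (simp add: freqs_def)

lemma integral_cis_period:
  assumes "m \<in> \<int>" "m \<noteq> 0"
  shows "(\<integral>t. indicator {a..a+l} t *\<^sub>R cis (\<kappa> * (m * t)) \<partial>lborel) = 0"
proof -
  define F where "F t = cis (\<kappa> * (m * t)) / (\<i> * of_real (\<kappa> * m))" for t
  have nz: "\<i> * of_real (\<kappa> * m) \<noteq> 0" using assms \<kappa>_pos by simp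
  have "(F has_vector_derivative cis (\<kappa> * (m * t))) (at t within {a..a+l})" for t
  proof -
    have "((\<lambda>z. exp (\<i> * of_real (\<kappa> * m) * z) / (\<i> * of_real (\<kappa> * m))) has_field_derivative
        exp (\<i> * of_real (\<kappa> * m) * of_real t)) (at (of_real t))"
      using nz by (auto intro!: derivative_eq_intros)
    then have "((\<lambda>t. exp (\<i> * of_real (\<kappa> * m) * of_real t) / (\<i> * of_real (\<kappa> * m))) has_vector_derivative
        exp (\<i> * of_real (\<kappa> * m) * of_real t)) (at t within {a..a+l})"
      by (rule has_vector_derivative_real_field)
    then show ?thesis by (simp add: F_def[abs_def] cis_conv_exp mult_ac)
  qed
  then have "has_bochner_integral lborel (\<lambda>t. indicator {a..a+l} t *\<^sub>R cis (\<kappa> * (m * t))) (F (a + l) - F a)"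
    using l_pos by (intro has_bochner_integral_FTC_Icc)
      (auto simp: cis_conv_exp intro!: continuous_intros)
  then have "(\<integral>t. indicator {a..a+l} t *\<^sub>R cis (\<kappa> * (m * t)) \<partial>lborel) = F (a + l) - F a"
    by (rule has_bochner_integral_integral_eq)
  also have "cis (\<kappa> * (m * (a + l))) = cis (\<kappa> * (m * a)) * cis (2 * pi * m)"
    using l_pos by (simp add: cis_mult \<kappa>_def field_simps)
  then have "F (a + l) = F a"
    using assms by (simp add: F_def cis_multiple_2pi)
  finally show ?thesis by simp
qed

lemma pair_integral_prod:
  fixes f g :: "real \<Rightarrow> complex"
  assumes "integrable lborel f" "integrable lborel g"
  shows "integrable (lborel \<Otimes>\<^sub>M lborel) (\<lambda>x. f (fst x) * g (snd x))"
    and "(\<integral>x. f (fst x) * g (snd x) \<partial>(lborel \<Otimes>\<^sub>M lborel)) = (\<integral>t. f t \<partial>lborel) * (\<integral>s. g s \<partial>lborel)"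
proof -
  have [measurable]: "f \<in> borel_measurable borel" "g \<in> borel_measurable borel"
    using assms by (auto dest: borel_measurable_integrable)
  show int: "integrable (lborel \<Otimes>\<^sub>M lborel) (\<lambda>x. f (fst x) * g (snd x))"
  proof (rule lborel_pair.Fubini_integrable)
    show "integrable lborel (\<lambda>x. \<integral>y. norm (f (fst (x, y)) * g (snd (x, y))) \<partial>lborel)"
      using assms by (simp add: norm_mult)
    show "AE x in lborel. integrable lborel (\<lambda>y. f (fst (x, y)) * g (snd (x, y)))"
      using assms by simp
  qed measurable
  show "(\<integral>x. f (fst x) * g (snd x) \<partial>(lborel \<Otimes>\<^sub>M lborel)) = (\<integral>t. f t \<partial>lborel) * (\<integral>s. g s \<partial>lborel)"
    using lborel_pair.integral_fst'[OF int] assms by simp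
qed

text \<open>The integral factorises into two integrals over a period, and one of them vanishes as soon as one
coordinate of \<open>n\<close> is not zero.\<close>

lemma integral_e:
  assumes "n \<in> freqs"
  shows "(\<integral>z. e n z \<partial>M) = (if n = 0 then of_real (l\<^sup>2) else 0)"
proof (cases "n = 0")
  case True
  then show ?thesis by (simp add: measure_M scaleR_conv_of_real)
next
  case False
  obtain v w where ax: "axes v w" and nv: "n \<bullet> v \<noteq> 0"
  proof (cases "Re n = 0")
    case True
    with False show ?thesis by (intro that[of \<i> 1]) (auto simp: axes_def inner_complex_def complex_eq_iff)
  next
    case False
    then show ?thesis by (intro that[of 1 \<i>]) (auto simp: axes_def inner_complex_def)
  qed
  have nvZ: "n \<bullet> v \<in> \<int>" using assms ax by (auto simp: axes_def freqs_def inner_complex_def)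
  define f where "f t = indicator {c \<bullet> v..c \<bullet> v + l} t *\<^sub>R cis (\<kappa> * ((n \<bullet> v) * t))" for t
  define g where "g t = indicator {c \<bullet> w..c \<bullet> w + l} t *\<^sub>R cis (\<kappa> * ((n \<bullet> w) * t))" for t
  have fi: "integrable lborel f" "integrable lborel g" unfolding f_def[abs_def] g_def[abs_def]
    by (intro borel_integrable_compact; auto simp: cis_conv_exp intro!: continuous_intros)+
  have "(\<integral>z. e n z \<partial>M) = (\<integral>z. indicator Q z *\<^sub>R e n z \<partial>lborel)"
    by (rule integral_M_borel) auto
  also have "\<dots> = (\<integral>x. indicator Q (fst x *\<^sub>R v + snd x *\<^sub>R w) *\<^sub>R e n (fst x *\<^sub>R v + snd x *\<^sub>R w) \<partial>(lborel \<Otimes>\<^sub>M lborel))"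
    by (subst lborel_axes[OF ax], subst integral_distr) auto
  also have "\<dots> = (\<integral>x. f (fst x) * g (snd x) \<partial>(lborel \<Otimes>\<^sub>M lborel))"
    by (intro Bochner_Integration.integral_cong refl)
      (auto simp: f_def g_def e_def mem_Q_axes[OF ax] axes_inner[OF ax] indicator_def cis_mult inner_add_right distrib_left mult_ac)
  also have "\<dots> = 0"
  proof -
    have "(\<integral>t. f t \<partial>lborel) = 0" unfolding f_def by (rule integral_cis_period[OF nvZ nv])
    then show ?thesis by (simp only: pair_integral_prod(2)[OF fi] mult_zero_left)
  qed
  finally show ?thesis using False by simp
qed

section \<open>Trigonometric polynomials and their density\<close>

lemma trig_add: "finite S \<Longrightarrow> finite S' \<Longrightarrow>
    trig S a z + trig S' b z = trig (S \<union> S') (\<lambda>n. (if n \<in> S then a n else 0) + (if n \<in> S' then b n else 0)) z"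
proof -
  assume f: "finite S" "finite S'"
  have 1: "trig S a z = (\<Sum>n\<in>S \<union> S'. (if n \<in> S then a n else 0) * e n z)"
    unfolding trig_def using f by (intro sum.mono_neutral_cong_left) auto
  have 2: "trig S' b z = (\<Sum>n\<in>S \<union> S'. (if n \<in> S' then b n else 0) * e n z)"
    unfolding trig_def using f by (intro sum.mono_neutral_cong_left) auto
  show ?thesis unfolding 1 2 by (simp add: trig_def sum.distrib distrib_right)
qed

text \<open>Products of characters collide when the frequencies have equal sums; collecting them is the
grouping of a double sum by the value of \<open>n + m\<close>.\<close>

lemma trig_mult:
  assumes "finite S" "finite S'"
  shows "trig S a z * trig S' b z = trig ((\<lambda>(n, m). n + m) ` (S \<times> S'))
    (\<lambda>k. \<Sum>(n, m) \<in> {x \<in> S \<times> S'. (\<lambda>(n, m). n + m) x = k}. a n * b m) z"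
proof -
  have "trig S a z * trig S' b z = (\<Sum>x\<in>S \<times> S'. a (fst x) * b (snd x) * e (fst x + snd x) z)"
    by (simp add: trig_def sum_product sum.cartesian_product e_add[symmetric] mult_ac case_prod_unfold)
  also have "\<dots> = (\<Sum>k\<in>(\<lambda>(n, m). n + m) ` (S \<times> S'). \<Sum>x\<in>{x \<in> S \<times> S'. (\<lambda>(n, m). n + m) x = k}. a (fst x) * b (snd x) * e (fst x + snd x) z)"
    using assms by (intro sum.image_gen) auto
  also have "\<dots> = trig ((\<lambda>(n, m). n + m) ` (S \<times> S'))
    (\<lambda>k. \<Sum>(n, m) \<in> {x \<in> S \<times> S'. (\<lambda>(n, m). n + m) x = k}. a n * b m) z"
    unfolding trig_def sum_distrib_right by (intro sum.cong refl) (auto simp: case_prod_unfold)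
  finally show ?thesis .
qed

lemma trig_cmult: "k * trig S a z = trig S (\<lambda>n. k * a n) z"
  by (simp add: trig_def sum_distrib_left mult_ac)

text \<open>The quotient of the plane by the period lattice, realised inside \<open>\<complex> \<times> \<complex>\<close>. Trigonometric polynomials are
restrictions to \<open>torus\<close> of functions that separate its points, which is what the theorem of Stone and
Weierstrass asks for.\<close>

definition torus_pt :: "complex \<Rightarrow> complex \<times> complex" where
  "torus_pt z = (cis (\<kappa> * Re z), cis (\<kappa> * Im z))"

definition torus :: "(complex \<times> complex) set" where "torus = sphere 0 1 \<times> sphere 0 1"

definition trig_restr :: "(complex \<times> complex \<Rightarrow> real) set" where
  "trig_restr = {G. continuous_on torus G \<and> (\<exists>S a. finite S \<and> S \<subseteq> freqs \<and> (\<forall>z. of_real (G (torus_pt z)) = trig S a z))}"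

lemma torus_pt_surj: "torus = torus_pt ` UNIV"
proof -
  have "\<exists>t. cis (\<kappa> * t) = x" if "norm x = 1" for x
  proof -
    have "x \<noteq> 0" using that by auto
    then have "cis (\<kappa> * (Arg x / \<kappa>)) = x" using that \<kappa>_pos cis_Arg[of x] by (simp add: sgn_div_norm)
    then show ?thesis by blast
  qed
  note ex = this
  show ?thesis
  proof (intro set_eqI iffI)
    fix x assume "x \<in> torus"
    then have x: "norm (fst x) = 1" "norm (snd x) = 1" by (auto simp: torus_def)
    obtain t s where "cis (\<kappa> * t) = fst x" "cis (\<kappa> * s) = snd x"
      using ex[OF x(1)] ex[OF x(2)] by blast
    then have "x = torus_pt (Complex t s)" by (simp add: torus_pt_def)
    then show "x \<in> torus_pt ` UNIV" by blast
  qed (auto simp: torus_def torus_pt_def)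
qed

lemma continuous_torus_pt: "continuous_on UNIV torus_pt"
  unfolding torus_pt_def cis_conv_exp by (intro continuous_intros)

lemma trig_restr_components:
  "(\<lambda>x. Re (fst x)) \<in> trig_restr" "(\<lambda>x. Im (fst x)) \<in> trig_restr"
  "(\<lambda>x. Re (snd x)) \<in> trig_restr" "(\<lambda>x. Im (snd x)) \<in> trig_restr"
proof -
  have re: "of_real (Re (e n z)) = trig {n, - n} (\<lambda>_. 1/2) z"
    and im: "of_real (Im (e n z)) = trig {n, - n} (\<lambda>m. if m = n then 1/(2*\<i>) else - 1/(2*\<i>)) z"
    if "n \<noteq> 0" for n z
  proof -
    have "n \<noteq> - n" using that by simp
    then show "of_real (Re (e n z)) = trig {n, - n} (\<lambda>_. 1/2) z"
      "of_real (Im (e n z)) = trig {n, - n} (\<lambda>m. if m = n then 1/(2*\<i>) else - 1/(2*\<i>)) z"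
      by (auto simp: trig_def cnj_e[symmetric] complex_eq_iff)
  qed
  have torus_pt: "fst (torus_pt z) = e 1 z" "snd (torus_pt z) = e \<i> z" for z
    by (auto simp: torus_pt_def e_def inner_complex_def)
  have L: "{1, - 1} \<subseteq> freqs" "{\<i>, - \<i>} \<subseteq> freqs" by (auto simp: freqs_def)
  have c: "continuous_on torus (\<lambda>x. Re (fst x))" "continuous_on torus (\<lambda>x. Im (fst x))"
   "continuous_on torus (\<lambda>x. Re (snd x))" "continuous_on torus (\<lambda>x. Im (snd x))"
    by (intro continuous_intros)+
  show "(\<lambda>x. Re (fst x)) \<in> trig_restr" unfolding trig_restr_def
    using c(1) re[of 1] L(1) torus_pt(1) by (auto intro!: exI[of _ "{1, -1}"])
  show "(\<lambda>x. Im (fst x)) \<in> trig_restr" unfolding trig_restr_def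
    using c(2) im[of 1] L(1) torus_pt(1) by (auto intro!: exI[of _ "{1, -1}"])
  show "(\<lambda>x. Re (snd x)) \<in> trig_restr" unfolding trig_restr_def
    using c(3) re[of \<i>] L(2) torus_pt(2) by (auto intro!: exI[of _ "{\<i>, -\<i>}"])
  show "(\<lambda>x. Im (snd x)) \<in> trig_restr" unfolding trig_restr_def
    using c(4) im[of \<i>] L(2) torus_pt(2) by (auto intro!: exI[of _ "{\<i>, -\<i>}"])
qed

lemma function_ring_trig_restr: "function_ring_on trig_restr torus"
proof
  show "compact torus" unfolding torus_def by (intro compact_Times compact_sphere)
  fix f g assume f: "f \<in> trig_restr" and g: "g \<in> trig_restr"
  then show "continuous_on torus f" by (simp add: trig_restr_def)
  obtain S a S' b where fg: "finite S" "S \<subseteq> freqs" "\<forall>z. of_real (f (torus_pt z)) = trig S a z"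
    "finite S'" "S' \<subseteq> freqs" "\<forall>z. of_real (g (torus_pt z)) = trig S' b z"
    using f g by (auto simp: trig_restr_def)
  have cont: "continuous_on torus f" "continuous_on torus g" using f g by (auto simp: trig_restr_def)
  have "(\<forall>z. of_real (f (torus_pt z) + g (torus_pt z)) = trig (S \<union> S') (\<lambda>n. (if n \<in> S then a n else 0) + (if n \<in> S' then b n else 0)) z)"
    using fg by (simp add: trig_add[symmetric])
  then show "(\<lambda>x. f x + g x) \<in> trig_restr"
    using fg cont unfolding trig_restr_def by (intro CollectI conjI continuous_intros) (auto intro!: exI[of _ "S \<union> S'"])
  have "(\<forall>z. of_real (f (torus_pt z) * g (torus_pt z)) = trig ((\<lambda>(n, m). n + m) ` (S \<times> S'))
    (\<lambda>k. \<Sum>(n, m) \<in> {x \<in> S \<times> S'. (\<lambda>(n, m). n + m) x = k}. a n * b m) z)"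
    using fg by (simp add: trig_mult[symmetric])
  moreover have "(\<lambda>(n, m). n + m) ` (S \<times> S') \<subseteq> freqs" using fg by (auto intro: freqs_add)
  ultimately show "(\<lambda>x. f x * g x) \<in> trig_restr"
    using fg cont unfolding trig_restr_def
    by (intro CollectI conjI continuous_intros exI[of _ "(\<lambda>(n, m). n + m) ` (S \<times> S')"] exI) auto
next
  fix k :: real
  show "(\<lambda>_. k) \<in> trig_restr" unfolding trig_restr_def
    by (auto intro!: exI[of _ "{0}"] exI[of _ "\<lambda>_. of_real k"] simp: trig_def)
next
  fix x y :: "complex \<times> complex" assume "x \<noteq> y"
  then have "Re (fst x) \<noteq> Re (fst y) \<or> Im (fst x) \<noteq> Im (fst y) \<or> Re (snd x) \<noteq> Re (snd y) \<or> Im (snd x) \<noteq> Im (snd y)"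
    by (auto simp: prod_eq_iff complex_eq_iff)
  then show "\<exists>f\<in>trig_restr. f x \<noteq> f y"
    by (elim disjE) (erule bexI[OF _ trig_restr_components(1)] bexI[OF _ trig_restr_components(2)]
      bexI[OF _ trig_restr_components(3)] bexI[OF _ trig_restr_components(4)])+
qed

text \<open>The real trigonometric polynomials form an algebra that contains the four real
coordinates of the torus, hence separates points.\<close>

lemma trig_dense_torus:
  assumes "continuous_on torus G" "0 < \<epsilon>"
  shows "\<exists>S a. finite S \<and> S \<subseteq> freqs \<and> (\<forall>z. trig S a z \<in> \<real> \<and> norm (of_real (G (torus_pt z)) - trig S a z) < \<epsilon>)"
proof -
  interpret R: function_ring_on trig_restr torus by (rule function_ring_trig_restr)
  obtain F where F: "F \<in> UNIV \<rightarrow> trig_restr" "uniform_limit torus F G sequentially"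
    using R.Stone_Weierstrass[OF assms(1)] by blast
  obtain j where j: "\<forall>x\<in>torus. dist (F j x) (G x) < \<epsilon>"
    using uniform_limitD[OF F(2) assms(2)] by (metis (mono_tags, lifting) eventually_sequentially order_refl)
  have "F j \<in> trig_restr" using F(1) by (rule funcset_mem) simp
  then obtain S a where S: "finite S" "S \<subseteq> freqs" "\<And>z. of_real (F j (torus_pt z)) = trig S a z"
    unfolding trig_restr_def by blast
  have "trig S a z \<in> \<real> \<and> norm (of_real (G (torus_pt z)) - trig S a z) < \<epsilon>" for z
  proof -
    have "torus_pt z \<in> torus" by (auto simp: torus_pt_surj)
    then have "dist (F j (torus_pt z)) (G (torus_pt z)) < \<epsilon>" using j by blast
    then have "norm (complex_of_real (G (torus_pt z) - F j (torus_pt z))) < \<epsilon>"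
      unfolding norm_of_real by (simp add: dist_real_def abs_minus_commute)
    then show ?thesis unfolding S(3)[symmetric] by simp
  qed
  then show ?thesis using S by blast
qed

lemma cis_eq_diff_int: "cis (\<kappa> * s) = cis (\<kappa> * t) \<Longrightarrow> \<exists>k::int. s = t + of_int k * l"
proof -
  assume "cis (\<kappa> * s) = cis (\<kappa> * t)"
  then have "sin (\<kappa> * s) = sin (\<kappa> * t) \<and> cos (\<kappa> * s) = cos (\<kappa> * t)"
    by (auto simp: complex_eq_iff)
  then obtain k :: int where "\<kappa> * s = \<kappa> * t + 2 * pi * k" using sin_cos_eq_iff by blast
  then have "\<kappa> * s = \<kappa> * (t + of_int k * l)" using l_pos by (simp add: \<kappa>_def field_simps)
  then have "s = t + of_int k * l" using \<kappa>_pos by simp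
  then show ?thesis by blast
qed

lemma torus_pt_eq_in_Q:
  assumes "z \<in> Q" "z' \<in> Q" "torus_pt z = torus_pt z'" "z \<in> box c (c + Complex l l)"
  shows "z = z'"
proof -
  have *: "s = t" if "cis (\<kappa> * s) = cis (\<kappa> * t)" "a < s" "s < a + l" "a \<le> t" "t \<le> a + l" for s t a
  proof -
    have "\<exists>k::int. s = t + of_int k * l" using that(1) by (rule cis_eq_diff_int)
    then obtain k :: int where k: "s = t + of_int k * l" by blast
    have "\<bar>of_int k * l\<bar> < l" using k that by linarith
    then have "\<bar>real_of_int k\<bar> < 1" using l_pos by (simp add: abs_mult)
    then have "k = 0" by linarith
    then show ?thesis using k by simp
  qed
  show ?thesis
    using assms by (intro complex_eqI; intro *[where a="Re c"] *[where a="Im c"])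
      (auto simp: torus_pt_def mem_Q in_box_complex_iff)
qed

lemma e_periodic:
  assumes "torus_pt z = torus_pt z'" "n \<in> freqs"
  shows "e n z = e n z'"
proof -
  obtain j k :: int where jk: "Re z = Re z' + of_int j * l" "Im z = Im z' + of_int k * l"
    using cis_eq_diff_int[of "Re z" "Re z'"] cis_eq_diff_int[of "Im z" "Im z'"] assms(1)
    by (auto simp: torus_pt_def)
  have "\<kappa> * (n \<bullet> z) = \<kappa> * (n \<bullet> z') + 2 * pi * (Re n * of_int j + Im n * of_int k)"
    using l_pos by (simp add: inner_complex_def jk \<kappa>_def field_simps)
  moreover have "Re n * of_int j + Im n * of_int k \<in> \<int>" using assms(2) by (auto simp: freqs_def)
  ultimately show ?thesis by (simp add: e_def cis_mult[symmetric] cis_multiple_2pi)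
qed

text \<open>A continuous surjection from the compact square onto the torus is a closed map, so a continuous
function that is constant on its fibres descends to the torus.\<close>

lemma torus_factor:
  assumes g: "continuous_on Q g" and per: "\<And>z z'. z \<in> Q \<Longrightarrow> z' \<in> Q \<Longrightarrow> torus_pt z = torus_pt z' \<Longrightarrow> g z = g z'"
  shows "\<exists>G::complex \<times> complex \<Rightarrow> real. continuous_on torus G \<and> (\<forall>z\<in>Q. G (torus_pt z) = g z)"
proof -
  define G where "G x = g (SOME z. z \<in> Q \<and> torus_pt z = x)" for x
  have G: "G (torus_pt z) = g z" if "z \<in> Q" for z
  proof -
    define z' where "z' = (SOME z'. z' \<in> Q \<and> torus_pt z' = torus_pt z)"
    have z': "z' \<in> Q \<and> torus_pt z' = torus_pt z" unfolding z'_def by (rule someI[of _ z]) (use that in auto)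
    then have "g z' = g z" using that by (intro per) auto
    then show ?thesis by (simp add: G_def z'_def)
  qed
  have TorQ: "torus = torus_pt ` Q"
  proof -
    have "\<exists>t'. a \<le> t' \<and> t' \<le> a + l \<and> cis (\<kappa> * t') = cis (\<kappa> * t)" for t a
    proof -
      define k where "k = \<lfloor>(t - a) / l\<rfloor>"
      have "of_int k \<le> (t - a) / l" "(t - a) / l < of_int k + 1" unfolding k_def by linarith+
      then have k: "of_int k * l \<le> t - a" "t - a < of_int k * l + l"
        using l_pos by (simp_all add: field_simps)
      have "cis (\<kappa> * (t - of_int k * l)) = cis (\<kappa> * t - 2 * pi * of_int k)"
        using l_pos by (simp add: \<kappa>_def field_simps)
      also have "\<dots> = cis (\<kappa> * t)" by (simp add: cis_divide[symmetric] cis_multiple_2pi)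
      finally show ?thesis using k by (intro exI[of _ "t - of_int k * l"]) auto
    qed
    then have ex: "\<exists>z'\<in>Q. torus_pt z' = torus_pt z" for z
    proof -
      obtain t' s' where "Re c \<le> t'" "t' \<le> Re c + l" "cis (\<kappa> * t') = cis (\<kappa> * Re z)"
         "Im c \<le> s'" "s' \<le> Im c + l" "cis (\<kappa> * s') = cis (\<kappa> * Im z)"
        using \<open>\<And>t a. \<exists>t'. a \<le> t' \<and> t' \<le> a + l \<and> cis (\<kappa> * t') = cis (\<kappa> * t)\<close> by meson
      then show ?thesis by (intro bexI[of _ "Complex t' s'"]) (auto simp: torus_pt_def mem_Q)
    qed
    show ?thesis
    proof (intro set_eqI iffI)
      fix x assume "x \<in> torus"
      then obtain z where "x = torus_pt z" by (auto simp: torus_pt_surj)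
      with ex[of z] show "x \<in> torus_pt ` Q" by (auto simp: image_iff) metis
    qed (auto simp: torus_pt_surj)
  qed
  have "continuous_on torus G"
  proof (rule continuous_on_closed_vimage[THEN iffD2, rule_format])
    show "closed torus" by (simp add: torus_def closed_Times)
    fix B :: "real set" assume B: "closed B"
    have "G -` B \<inter> torus = torus_pt ` (g -` B \<inter> Q)"
      unfolding TorQ using G by auto
    moreover have "compact (g -` B \<inter> Q)"
    proof -
      have "closed (g -` B \<inter> Q)"
        using continuous_on_closed_vimage[OF compact_imp_closed[OF compact_Q], of g] g B by blast
      then have "compact (Q \<inter> (g -` B \<inter> Q))" by (rule compact_Int_closed[OF compact_Q])
      moreover have "Q \<inter> (g -` B \<inter> Q) = g -` B \<inter> Q" by blast
      ultimately show ?thesis by simp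
    qed
    ultimately have "compact (G -` B \<inter> torus)"
      by (simp only:, intro compact_continuous_image continuous_on_subset[OF continuous_torus_pt]) auto
    then show "closed (G -` B \<inter> torus)" by (rule compact_imp_closed)
  qed
  then show ?thesis using G by blast
qed

lemma AE_M_lebesgue:
  assumes "AE z in lebesgue. P z"
  shows "AE z in M. P z"
proof -
  have "AE z in lebesgue. z \<in> Q \<longrightarrow> P z" using assms by eventually_elim blast
  then show ?thesis by (subst AE_restrict_space_iff) simp_all
qed

text \<open>A measurable function is an almost everywhere limit of continuous functions. Truncating these keeps
the bound, and multiplying them by cutoffs that increase to the indicator of the open square makes
them compatible with the identification of opposite sides. The limit is unaffected because the
boundary is a null set.\<close>

lemma trig_approx_real:
  fixes \<phi> :: "complex \<Rightarrow> real"
  assumes \<phi>: "\<phi> \<in> borel_measurable M" and B: "\<And>z. \<bar>\<phi> z\<bar> \<le> B"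
  shows "\<exists>S a. (\<forall>j::nat. finite (S j) \<and> S j \<subseteq> freqs \<and> (\<forall>z\<in>Q. norm (trig (S j) (a j) z) \<le> B + 1)) \<and>
     (AE z in M. (\<lambda>j. trig (S j) (a j) z) \<longlonglongrightarrow> of_real (\<phi> z))"
proof -
  have B0: "0 \<le> B" using B[of 0] by linarith
  have "\<phi> measurable_on Q" using \<phi> by (subst measurable_on_iff_borel_measurable) auto
  then obtain N g where N: "negligible N" and g: "\<And>n. continuous_on UNIV (g n)"
    and lim: "\<And>x. x \<notin> N \<Longrightarrow> (\<lambda>n. g n x) \<longlonglongrightarrow> (if x \<in> Q then \<phi> x else 0)"
    unfolding measurable_on_def by blast
  define U where "U = box c (c + Complex l l)"
  define cut where "cut n z = min 1 (real n * infdist z (- U))" for n z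
  define h where "h n z = cut n z * max (- B) (min B (g n z))" for n z
  have hc: "continuous_on UNIV (h n)" for n
    unfolding h_def cut_def by (intro continuous_intros g)
  have cut01: "0 \<le> cut n z" "cut n z \<le> 1" for n z by (auto simp: cut_def infdist_nonneg)
  have hB: "\<bar>h n z\<bar> \<le> B" for n z
  proof -
    have "\<bar>h n z\<bar> \<le> 1 * B" unfolding h_def abs_mult using cut01[of n z] B0 by (intro mult_mono) auto
    then show ?thesis by simp
  qed
  have h0: "h n z = 0" if "z \<in> Q - U" for n z
    using that by (simp add: h_def cut_def)
  have hlim: "(\<lambda>n. h n z) \<longlonglongrightarrow> \<phi> z" if "z \<in> U" "z \<notin> N" for z
  proof -
    have zQ: "z \<in> Q" using that box_subset_cbox by (auto simp: U_def Q_def)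
    have "U \<noteq> UNIV" unfolding U_def using bounded_box by (metis not_bounded_UNIV)
    then have "- U \<noteq> {}" by auto
    moreover have "closed (- U)" by (simp add: U_def open_box closed_Compl)
    ultimately have d: "0 < infdist z (- U)"
      using that infdist_nonneg[of z "-U"] in_closed_iff_infdist_zero[of "-U" z] by force
    obtain n0 :: nat where n0: "1 / infdist z (- U) \<le> real n0" using real_arch_simple by blast
    have "eventually (\<lambda>n. cut n z = 1) sequentially"
      unfolding eventually_sequentially
    proof (intro exI[of _ n0] allI impI)
      fix n assume "n0 \<le> n"
      then have "1 / infdist z (- U) \<le> real n" using n0 by simp
      then show "cut n z = 1" using d by (simp add: cut_def field_simps)
    qed
    moreover have "(\<lambda>n. max (- B) (min B (g n z))) \<longlonglongrightarrow> max (- B) (min B (\<phi> z))"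
      using lim[OF that(2)] zQ by (intro tendsto_intros) auto
    then have "(\<lambda>n. max (- B) (min B (g n z))) \<longlonglongrightarrow> \<phi> z"
      using B[of z] by (simp add: abs_le_iff max_def min_def split: if_splits)
    ultimately have "(\<lambda>n. cut n z * max (- B) (min B (g n z))) \<longlonglongrightarrow> 1 * \<phi> z"
      by (rule tendsto_mult[OF tendsto_eventually])
    then show ?thesis by (simp add: h_def)
  qed
  have "\<exists>S a. finite S \<and> S \<subseteq> freqs \<and> (\<forall>z\<in>Q. norm (of_real (h j z) - trig S a z) < 1 / Suc j)" for j
  proof -
    have "h j z = h j z'" if "z \<in> Q" "z' \<in> Q" "torus_pt z = torus_pt z'" for z z'
    proof (cases "z \<in> U \<or> z' \<in> U")
      case True
      then have "z = z'" using torus_pt_eq_in_Q[of z z'] torus_pt_eq_in_Q[of z' z] that by (auto simp: U_def)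
      then show ?thesis by simp
    next
      case False then show ?thesis using that h0 by simp
    qed
    then obtain G where G: "continuous_on torus G" "\<forall>z\<in>Q. G (torus_pt z) = h j z"
      using torus_factor[of "h j"] continuous_on_subset[OF hc[of j], of Q] by blast
    obtain S a where S: "finite S" "S \<subseteq> freqs" "\<forall>z. trig S a z \<in> \<real> \<and> norm (of_real (G (torus_pt z)) - trig S a z) < 1 / Suc j"
      using trig_dense_torus[OF G(1), of "1 / Suc j"] by auto
    show ?thesis
    proof (intro exI[of _ S] exI[of _ a] conjI ballI)
      fix z assume "z \<in> Q"
      then have "h j z = G (torus_pt z)" using G(2) by simp
      then show "norm (of_real (h j z) - trig S a z) < 1 / Suc j" using S(3) by simp
    qed (use S in auto)
  qed
  then obtain S a where Sa: "\<And>j. finite (S j)" "\<And>j. S j \<subseteq> freqs"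
      "\<And>j z. z \<in> Q \<Longrightarrow> norm (of_real (h j z) - trig (S j) (a j) z) < 1 / Suc j"
    by metis
  show ?thesis
  proof (intro exI[of _ S] exI[of _ a] conjI allI ballI)
    fix j z assume z: "z \<in> Q"
    have "norm (trig (S j) (a j) z) \<le> norm (complex_of_real (h j z)) + norm (of_real (h j z) - trig (S j) (a j) z)"
      using norm_triangle_ineq4[of "complex_of_real (h j z)" "of_real (h j z) - trig (S j) (a j) z"] by simp
    also have "\<dots> \<le> B + 1 / Suc j"
      using hB[of j z] Sa(3)[OF z, of j] by simp
    also have "\<dots> \<le> B + 1" by simp
    finally show "norm (trig (S j) (a j) z) \<le> B + 1" .
  next
    have "negligible (N \<union> (Q - U))"
      using N negligible_frontier_interval[of c "c + Complex l l"] by (simp add: U_def Q_def)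
    then have "N \<union> (Q - U) \<in> null_sets lebesgue" by (simp add: negligible_iff_null_sets)
    then have "AE z in lebesgue. z \<notin> N \<union> (Q - U)" by (rule AE_not_in)
    then have "AE z in M. z \<notin> N \<union> (Q - U)" by (rule AE_M_lebesgue)
    moreover have "AE z in M. z \<in> Q" by (rule AE_I2) simp
    ultimately show "AE z in M. (\<lambda>j. trig (S j) (a j) z) \<longlonglongrightarrow> of_real (\<phi> z)"
    proof eventually_elim
      case (elim z)
      then have "(\<lambda>j. complex_of_real (h j z)) \<longlonglongrightarrow> of_real (\<phi> z)"
        by (intro tendsto_of_real hlim) auto
      moreover have "(\<lambda>j. of_real (h j z) - trig (S j) (a j) z) \<longlonglongrightarrow> 0"
        by (rule Lim_null_comparison[OF _ LIMSEQ_inverse_real_of_nat])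
          (use Sa(3)[of z] elim in \<open>auto intro!: always_eventually less_imp_le simp: inverse_eq_divide\<close>)
      ultimately have "(\<lambda>j. complex_of_real (h j z) - (of_real (h j z) - trig (S j) (a j) z)) \<longlonglongrightarrow> of_real (\<phi> z) - 0"
        by (rule tendsto_diff)
      then show ?case by simp
    qed
  qed (use Sa in auto)
qed

lemma trig_approx:
  fixes \<phi> :: "complex \<Rightarrow> complex"
  assumes \<phi>: "\<phi> \<in> borel_measurable M" and B: "\<And>z. norm (\<phi> z) \<le> B"
  shows "\<exists>S a. (\<forall>j::nat. finite (S j) \<and> S j \<subseteq> freqs \<and> (\<forall>z\<in>Q. norm (trig (S j) (a j) z) \<le> 2 * (B + 1))) \<and>
     (AE z in M. (\<lambda>j. trig (S j) (a j) z) \<longlonglongrightarrow> \<phi> z)"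
proof -
  have m: "(\<lambda>z. Re (\<phi> z)) \<in> borel_measurable M" "(\<lambda>z. Im (\<phi> z)) \<in> borel_measurable M"
    using \<phi> by measurable
  have b: "\<bar>Re (\<phi> z)\<bar> \<le> B" "\<bar>Im (\<phi> z)\<bar> \<le> B" for z
    using B[of z] abs_Re_le_cmod[of "\<phi> z"] abs_Im_le_cmod[of "\<phi> z"] by linarith+
  obtain S a where 1: "\<forall>j::nat. finite (S j) \<and> S j \<subseteq> freqs \<and> (\<forall>z\<in>Q. norm (trig (S j) (a j) z) \<le> B + 1)"
     "AE z in M. (\<lambda>j. trig (S j) (a j) z) \<longlonglongrightarrow> of_real (Re (\<phi> z))"
    using trig_approx_real[OF m(1) b(1)] by blast
  obtain S' a' where 2: "\<forall>j::nat. finite (S' j) \<and> S' j \<subseteq> freqs \<and> (\<forall>z\<in>Q. norm (trig (S' j) (a' j) z) \<le> B + 1)"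
     "AE z in M. (\<lambda>j. trig (S' j) (a' j) z) \<longlonglongrightarrow> of_real (Im (\<phi> z))"
    using trig_approx_real[OF m(2) b(2)] by blast
  define T where "T j = S j \<union> S' j" for j
  define b where "b j n = (if n \<in> S j then a j n else 0) + (if n \<in> S' j then \<i> * a' j n else 0)" for j n
  have T: "trig (T j) (b j) z = trig (S j) (a j) z + \<i> * trig (S' j) (a' j) z" for j z
    unfolding trig_cmult T_def b_def using 1(1) 2(1) trig_add[of "S j" "S' j" "a j" z "\<lambda>n. \<i> * a' j n"] by simp
  show ?thesis
  proof (intro exI[of _ T] exI[of _ b] conjI allI ballI)
    fix j z assume "z \<in> Q"
    then have "norm (trig (S j) (a j) z) \<le> B + 1" "norm (\<i> * trig (S' j) (a' j) z) \<le> B + 1"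
      using 1(1) 2(1) by (simp_all add: norm_mult)
    then have "norm (trig (T j) (b j) z) \<le> (B + 1) + (B + 1)"
      unfolding T by (intro norm_triangle_le add_mono)
    then show "norm (trig (T j) (b j) z) \<le> 2 * (B + 1)" by simp
  next
    show "AE z in M. (\<lambda>j. trig (T j) (b j) z) \<longlonglongrightarrow> \<phi> z"
      using 1(2) 2(2)
    proof eventually_elim
      case (elim z)
      then have "(\<lambda>j. trig (S j) (a j) z + \<i> * trig (S' j) (a' j) z) \<longlonglongrightarrow> of_real (Re (\<phi> z)) + \<i> * of_real (Im (\<phi> z))"
        by (intro tendsto_intros)
      then show ?case by (simp add: T complex_eq[symmetric])
    qed
  qed (use 1(1) 2(1) in \<open>simp_all add: T_def\<close>)
qed

end

section \<open>The conjugate function inequality of M. Riesz\<close>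

text \<open>Write \<open>z = r cis \<phi>\<close>. Near the imaginary axis \<open>p \<phi>\<close> exceeds \<open>pi / 2\<close> in absolute value without
exceeding \<open>pi\<close>, since \<open>1 < p \<le> 2\<close>; so \<open>Re (z powr p)\<close> is at most a negative multiple of \<open>r powr p\<close>.
Away from the imaginary axis \<open>r\<close> is at most a multiple of \<open>Re z\<close>.\<close>

lemma right_half_plane_powr_ineq:
  fixes p :: real
  assumes p: "1 < p" "p \<le> 2"
  obtains A B :: real where "0 \<le> A" "0 \<le> B"
    "\<And>z. 0 < Re z \<Longrightarrow> norm z powr p \<le> A * Re z powr p - B * Re (z powr of_real p)"
proof -
  \<comment> \<open>any angle strictly between \<open>pi / (2 p)\<close> and \<open>pi / 2\<close> separates the two regimes\<close>
  define t where "t = (pi / (2 * p) + pi / 2) / 2"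
  have "pi / (2 * p) < pi / 2" "0 < pi / (2 * p)" using p by (auto simp: field_simps)
  then have t: "t < pi / 2" "0 < t" by (auto simp: t_def)
  have pt: "p * t = pi / 4 + p * pi / 4" using p by (simp add: t_def field_simps)
  have pt1: "pi / 2 < p * t" "p * t \<le> pi" unfolding pt using p pi_gt_zero by (auto simp: field_simps)
  define k where "k = - cos (p * t)"
  have k: "0 < k" unfolding k_def using pt1 cos_monotone_0_pi[of "pi/2" "p * t"] by simp
  have ct: "0 < cos t" using t by (intro cos_gt_zero) auto
  define B where "B = 1 / k"
  define A where "A = (1 + B) * (1 / cos t) powr p"
  have B: "0 < B" using k by (simp add: B_def)
  have main: "norm z powr p \<le> A * Re z powr p - B * Re (z powr of_real p)" if z: "0 < Re z" for z
  proof -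
    define \<phi> where "\<phi> = Im (Ln z)"
    define r where "r = norm z"
    have z0: "z \<noteq> 0" using z by auto
    have r: "0 < r" using z0 by (simp add: r_def)
    have \<phi>: "\<bar>\<phi>\<bar> < pi / 2" unfolding \<phi>_def using Re_Ln_pos_lt[OF z0] z by simp
    have Rez: "Re z = r * cos \<phi>"
    proof -
      have "z = exp (Ln z)" using z0 by simp
      then have "Re z = exp (Re (Ln z)) * cos \<phi>" by (metis Re_exp \<phi>_def)
      then show ?thesis using z0 by (simp add: r_def)
    qed
    have Rep: "Re (z powr of_real p) = r powr p * cos (p * \<phi>)"
      using z0 by (simp add: powr_def Re_exp \<phi>_def r_def)
    show ?thesis
    proof (cases "t \<le> \<bar>\<phi>\<bar>")
      case True
      have "cos (p * \<phi>) = cos (p * \<bar>\<phi>\<bar>)" using p by (simp add: abs_if)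
      also have "\<dots> \<le> cos (p * t)"
      proof (rule cos_monotone_0_pi_le)
        show "p * t \<le> p * \<bar>\<phi>\<bar>" using True p by simp
        have "p * \<bar>\<phi>\<bar> \<le> 2 * (pi / 2)" using p \<phi> by (intro mult_mono) auto
        then show "p * \<bar>\<phi>\<bar> \<le> pi" by simp
      qed (use p t in auto)
      finally have "cos (p * \<phi>) \<le> - k" by (simp add: k_def)
      then have "B * (r powr p * cos (p * \<phi>)) \<le> B * (r powr p * (- k))"
        using B by (intro mult_left_mono) auto
      also have "\<dots> = - (r powr p)" using k by (simp add: B_def)
      finally have "r powr p \<le> - (B * Re (z powr of_real p))" unfolding Rep by simp
      moreover have "0 \<le> A * Re z powr p" using B by (auto simp: A_def)
      ultimately show ?thesis by (simp add: r_def)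
    next
      case False
      then have "cos t \<le> cos \<bar>\<phi>\<bar>" using t by (intro cos_monotone_0_pi_le) auto
      then have "r * cos t \<le> Re z" unfolding Rez using r by simp
      then have "r \<le> Re z * (1 / cos t)" using ct by (simp add: field_simps)
      then have "r powr p \<le> (Re z * (1 / cos t)) powr p" using r p by (intro powr_mono2) auto
      also have "\<dots> = Re z powr p * (1 / cos t) powr p" using z ct by (intro powr_mult)
      finally have 1: "(1 + B) * r powr p \<le> A * Re z powr p"
        using B by (simp add: A_def mult_ac mult_left_mono)
      have "r powr p * cos (p * \<phi>) \<le> r powr p * 1" by (intro mult_left_mono) auto
      then have "B * Re (z powr of_real p) \<le> B * r powr p" unfolding Rep using B by simp
      with 1 show ?thesis by (simp add: r_def distrib_right)
    qed
  qed
  show thesis by (rule that[OF _ _ main]) (use B in \<open>auto simp: A_def\<close>)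
qed

lemma continuous_on_norm_powr:
  fixes F :: "complex \<Rightarrow> complex"
  assumes "continuous_on S F" "0 < p"
  shows "continuous_on S (\<lambda>z. norm (F z) powr p)"
  using assms by (intro continuous_on_powr' continuous_intros) auto

context square begin

text \<open>Trigonometric polynomials of Hardy type: a constant \<open>w\<close> plus characters whose frequencies lie in the
open half plane \<open>L n > 0\<close>. The constant is carried as an argument because it is the mean value, and
because it is multiplicative: no product of two such characters has frequency zero.\<close>

inductive hardy :: "(complex \<Rightarrow> real) \<Rightarrow> (complex \<Rightarrow> complex) \<Rightarrow> complex \<Rightarrow> bool"
  for L :: "complex \<Rightarrow> real" where
  hardy_const: "hardy L (\<lambda>_. w) w"
| hardy_mono: "n \<in> freqs \<Longrightarrow> 0 < L n \<Longrightarrow> hardy L (\<lambda>z. a * e n z) 0"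
| hardy_add: "hardy L F w \<Longrightarrow> hardy L G v \<Longrightarrow> hardy L (\<lambda>z. F z + G z) (w + v)"

lemma hardy_continuous: "hardy L F w \<Longrightarrow> continuous_on UNIV F"
  by (induction rule: hardy.induct) (auto intro!: continuous_intros continuous_e)

lemma hardy_periodic: "hardy L F w \<Longrightarrow> torus_pt z = torus_pt z' \<Longrightarrow> F z = F z'"
  by (induction rule: hardy.induct) (auto dest: e_periodic)

lemma hardy_cmult: "hardy L F w \<Longrightarrow> hardy L (\<lambda>z. k * F z) (k * w)"
proof (induction rule: hardy.induct)
  case (hardy_const w) then show ?case by (rule hardy.hardy_const)
next
  case (hardy_mono n a)
  then show ?case using hardy.hardy_mono[of n L "k * a"] by (simp add: mult.assoc)
next
  case (hardy_add F w G v)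
  then show ?case using hardy.hardy_add[of L "\<lambda>z. k * F z" "k * w" "\<lambda>z. k * G z" "k * v"]
    by (simp add: distrib_left)
qed

lemma hardy_diff: "hardy L F w \<Longrightarrow> hardy L G v \<Longrightarrow> hardy L (\<lambda>z. F z - G z) (w - v)"
  using hardy_add[of L F w "\<lambda>z. - 1 * G z" "- 1 * v"] hardy_cmult[of L G v "-1"] by simp

lemma hardy_mult_mono:
  assumes "linear L" "n \<in> freqs" "0 < L n"
  shows "hardy L F w \<Longrightarrow> hardy L (\<lambda>z. a * e n z * F z) 0"
proof (induction rule: hardy.induct)
  case (hardy_const w)
  then show ?case using hardy.hardy_mono[of n L "w * a"] assms by (simp add: mult_ac)
next
  case (hardy_mono m b)
  have "L (n + m) = L n + L m" using assms(1) by (rule linear_add)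
  then show ?case using hardy.hardy_mono[of "n + m" L "a * b"] assms hardy_mono
    by (simp add: mult_ac e_add[symmetric] freqs_add)
next
  case (hardy_add F w G v)
  then show ?case using hardy.hardy_add[of L "\<lambda>z. a * e n z * F z" 0 "\<lambda>z. a * e n z * G z" 0]
    by (simp add: distrib_left)
qed

lemma hardy_mult:
  assumes "linear L" "hardy L F w" "hardy L G v"
  shows "hardy L (\<lambda>z. F z * G z) (w * v)"
  using assms(2)
proof (induction rule: hardy.induct)
  case (hardy_const w)
  show ?case by (rule hardy_cmult[OF assms(3)])
next
  case (hardy_mono n a)
  then show ?case using hardy_mult_mono[OF assms(1) _ _ assms(3), of n a] by simp
next
  case (hardy_add F w F' w')
  then show ?case using hardy.hardy_add[of L "\<lambda>z. F z * G z" "w * v" "\<lambda>z. F' z * G z" "w' * v"]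
    by (simp add: distrib_right)
qed

lemma hardy_power: "linear L \<Longrightarrow> hardy L F w \<Longrightarrow> hardy L (\<lambda>z. F z ^ k) (w ^ k)"
  by (induction k) (auto intro: hardy_const hardy_mult)

lemma integral_hardy:
  assumes "linear L"
  shows "hardy L F w \<Longrightarrow> (\<integral>z. F z \<partial>M) = of_real (l\<^sup>2) * w"
proof (induction rule: hardy.induct)
  case (hardy_const w) then show ?case by (simp add: measure_M scaleR_conv_of_real)
next
  case (hardy_mono n a)
  then have "n \<noteq> 0" using linear_0[OF assms] by auto
  then show ?case using hardy_mono integral_e[of n] by simp
next
  case (hardy_add F w G v)
  then show ?case by (simp add: hardy_continuous continuous_integrable_M distrib_left)
qed

lemma integrable_norm_powr: "continuous_on UNIV F \<Longrightarrow> 0 < p \<Longrightarrow> integrable M (\<lambda>z. norm (F z) powr p)"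
  for F :: "complex \<Rightarrow> complex"
  by (intro continuous_integrable_M continuous_on_norm_powr)

text \<open>The analytic function \<open>\<zeta> powr p\<close> has the mean value property for functions of Hardy type, because its
Taylor polynomials do. The binomial series around one converges uniformly on the range of \<open>F\<close>
when that range lies in a disc of radius \<open>r < 1\<close>. The disc is convex, hence also contains the mean
\<open>w\<close> of \<open>F\<close>.\<close>

lemma hardy_mean_powr:
  assumes L: "linear L" and F: "hardy L F w" and r: "\<And>z. z \<in> Q \<Longrightarrow> norm (F z - 1) \<le> r" "0 \<le> r" "r < 1"
  shows "(\<integral>z. F z powr p \<partial>M) = of_real (l\<^sup>2) * w powr p" and "norm (w - 1) \<le> r"
    and "integrable M (\<lambda>z. F z powr p)"
proof -
  have F1: "hardy L (\<lambda>z. F z - 1) (w - 1)" by (intro hardy_diff F hardy_const)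
  have l2: "0 < l\<^sup>2" using l_pos by simp
  have "norm (of_real (l\<^sup>2) * (w - 1)) \<le> (\<integral>z. norm (F z - 1) \<partial>M)"
    unfolding integral_hardy[OF L F1, symmetric] by (rule integral_norm_bound)
  also have "\<dots> \<le> (\<integral>z. r \<partial>M)"
    using r by (intro integral_mono integrable_norm continuous_integrable_M hardy_continuous[OF F1]) auto
  also have "\<dots> = l\<^sup>2 * r" by (simp add: measure_M)
  finally show w: "norm (w - 1) \<le> r" using l2 by (simp add: norm_mult norm_power)
  \<comment> \<open>convergence at a point of modulus between \<open>r\<close> and one gives absolute convergence at modulus \<open>r\<close>\<close>
  have "(\<lambda>n. (p gchoose n) * (of_real ((1 + r) / 2) :: complex) ^ n) sums (1 + of_real ((1 + r) / 2)) powr p"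
    by (rule gen_binomial_complex) (use r in \<open>simp del: of_real_divide\<close>)
  then have "summable (\<lambda>n. (p gchoose n) * (of_real ((1 + r) / 2) :: complex) ^ n)" by (rule sums_summable)
  then have sr: "summable (\<lambda>n. norm ((p gchoose n) * (of_real r :: complex) ^ n))"
    by (rule powser_insidea) (use r in \<open>simp del: of_real_divide\<close>)
  define f where "f n z = (p gchoose n) * (F z - 1) ^ n" for n z
  have fb: "norm (f n z) \<le> norm ((p gchoose n) * (of_real r :: complex) ^ n)" if "z \<in> Q" for n z
    unfolding f_def norm_mult norm_power using r(1)[OF that] r(2)
    by (intro mult_left_mono power_mono) auto
  have fc: "continuous_on UNIV (f n)" for n
    unfolding f_def by (intro continuous_intros hardy_continuous[OF F])
  have sums: "(\<lambda>n. f n z) sums (F z powr p)" if "z \<in> Q" for z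
    using gen_binomial_complex[of "F z - 1" p] r(1)[OF that] r(3) by (simp add: f_def)
  have int: "integrable M (f n)" for n by (rule continuous_integrable_M[OF fc])
  have abs: "AE z in M. summable (\<lambda>n. norm (f n z))"
    by (rule AE_I2, rule summable_comparison_test'[OF sr, of 0]) (auto intro: fb)
  have nrm: "summable (\<lambda>n. \<integral>z. norm (f n z) \<partial>M)"
  proof (rule summable_comparison_test'[of _ 0])
    show "summable (\<lambda>n. l\<^sup>2 * norm ((p gchoose n) * (of_real r :: complex) ^ n))"
      by (rule summable_mult[OF sr])
    fix n
    have "(\<integral>z. norm (f n z) \<partial>M) \<le> (\<integral>z. norm ((p gchoose n) * (of_real r :: complex) ^ n) \<partial>M)"
      using int fb by (intro integral_mono) auto
    then show "norm (\<integral>z. norm (f n z) \<partial>M) \<le> l\<^sup>2 * norm ((p gchoose n) * (of_real r :: complex) ^ n)"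
      by (simp add: measure_M)
  qed
  have eq: "(\<Sum>n. f n z) = F z powr p" if "z \<in> Q" for z
    using sums[OF that] by (simp add: sums_iff)
  have "integrable M (\<lambda>z. \<Sum>n. f n z)" by (rule integrable_suminf[OF int abs nrm])
  also have "integrable M (\<lambda>z. \<Sum>n. f n z) \<longleftrightarrow> integrable M (\<lambda>z. F z powr p)"
    by (intro Bochner_Integration.integrable_cong) (auto simp: eq)
  finally show "integrable M (\<lambda>z. F z powr p)" .
  have "(\<lambda>n. \<integral>z. f n z \<partial>M) sums (\<integral>z. (\<Sum>n. f n z) \<partial>M)"
    by (rule sums_integral[OF int abs nrm])
  also have "(\<integral>z. (\<Sum>n. f n z) \<partial>M) = (\<integral>z. F z powr p \<partial>M)"
    by (intro Bochner_Integration.integral_cong) (auto simp: eq)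
  also have "(\<lambda>n. \<integral>z. f n z \<partial>M) = (\<lambda>n. of_real (l\<^sup>2) * ((p gchoose n) * (w - 1) ^ n))"
    using integral_hardy[OF L hardy_power[OF L F1]] by (simp add: f_def mult_ac)
  finally have "(\<lambda>n. of_real (l\<^sup>2) * ((p gchoose n) * (w - 1) ^ n)) sums (\<integral>z. F z powr p \<partial>M)" .
  moreover have "(\<lambda>n. of_real (l\<^sup>2) * ((p gchoose n) * (w - 1) ^ n)) sums (of_real (l\<^sup>2) * w powr p)"
    using gen_binomial_complex[of "w - 1" p] w r by (intro sums_mult) simp
  ultimately show "(\<integral>z. F z powr p \<partial>M) = of_real (l\<^sup>2) * w powr p" by (rule sums_unique2)
qed

text \<open>The inequality of Riesz when the real part is positive: in the pointwise inequality on the right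
half plane the last term has mean \<open>Re (w powr p) \<ge> 0\<close>. The compact range of \<open>F\<close> is brought into a disc around one
by division by a large real number \<open>R\<close>; both sides are homogeneous of the same degree.\<close>

lemma riesz_positive:
  assumes p: "1 < p" "p \<le> 2"
  obtains A where "0 \<le> A"
    "\<And>L F w. linear L \<Longrightarrow> hardy L F w \<Longrightarrow> w \<in> \<real> \<Longrightarrow> (\<And>z. z \<in> Q \<Longrightarrow> 0 < Re (F z)) \<Longrightarrow>
       (\<integral>z. norm (F z) powr p \<partial>M) \<le> A * (\<integral>z. \<bar>Re (F z)\<bar> powr p \<partial>M)"
proof -
  obtain A B :: real where AB: "0 \<le> A" "0 \<le> B"
    "\<And>z. 0 < Re z \<Longrightarrow> norm z powr p \<le> A * Re z powr p - B * Re (z powr of_real p)"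
    using right_half_plane_powr_ineq[OF p] by metis
  have "(\<integral>z. norm (F z) powr p \<partial>M) \<le> A * (\<integral>z. \<bar>Re (F z)\<bar> powr p \<partial>M)"
    if L: "linear L" and F: "hardy L F w" and w: "w \<in> \<real>" and pos: "\<And>z. z \<in> Q \<Longrightarrow> 0 < Re (F z)" for L F w
  proof -
    have Fc: "continuous_on Q F" using hardy_continuous[OF F] continuous_on_subset by blast
    have Qne: "Q \<noteq> {}" using l_pos by (metis add_increasing2 empty_iff less_imp_le mem_Q order_refl)
    obtain z0 where z0: "z0 \<in> Q" "\<And>z. z \<in> Q \<Longrightarrow> Re (F z0) \<le> Re (F z)"
      using continuous_attains_inf[OF compact_Q Qne continuous_on_Re[OF Fc]] by blast
    obtain z1 where z1: "z1 \<in> Q" "\<And>z. z \<in> Q \<Longrightarrow> norm (F z) \<le> norm (F z1)"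
      using continuous_attains_sup[OF compact_Q Qne continuous_on_norm[OF Fc]] by blast
    define \<delta> N where "\<delta> = Re (F z0)" and "N = norm (F z1)"
    have \<delta>: "0 < \<delta>" using pos z0 by (simp add: \<delta>_def)
    have N: "0 < N" using \<delta> z0 z1 by (metis N_def \<delta>_def complex_Re_le_cmod less_le_trans)
    \<comment> \<open>a disc of radius less than \<open>R\<close> around \<open>R\<close> contains all points with real part at least \<open>\<delta>\<close> and modulus at most \<open>N\<close> as soon as \<open>R > N\<^sup>2 / (2 \<delta>)\<close>\<close>
    define R where "R = N\<^sup>2 / \<delta>"
    have R: "0 < R" using N \<delta> by (simp add: R_def)
    define r where "r = sqrt (1 - N\<^sup>2 / R\<^sup>2)"
    have bound: "(norm (F z / of_real R - 1))\<^sup>2 \<le> 1 - N\<^sup>2 / R\<^sup>2" if "z \<in> Q" for z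
    proof -
      have "(norm (F z - of_real R))\<^sup>2 = (norm (F z))\<^sup>2 - 2 * R * Re (F z) + R\<^sup>2"
        unfolding cmod_power2 by (simp add: power2_eq_square algebra_simps)
      also have "\<dots> \<le> N\<^sup>2 - 2 * R * \<delta> + R\<^sup>2"
      proof -
        have "(norm (F z))\<^sup>2 \<le> N\<^sup>2" using z1 that by (auto simp: N_def intro: power_mono)
        moreover have "R * \<delta> \<le> R * Re (F z)" using R z0 that by (auto simp: \<delta>_def)
        ultimately show ?thesis by linarith
      qed
      also have "R * \<delta> = N\<^sup>2" using \<delta> by (simp add: R_def)
      then have "N\<^sup>2 - 2 * R * \<delta> + R\<^sup>2 = R\<^sup>2 - N\<^sup>2" by simp
      finally have *: "(norm (F z - of_real R))\<^sup>2 \<le> R\<^sup>2 - N\<^sup>2" .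
      have "F z / of_real R - 1 = (F z - of_real R) / of_real R" using R by (simp add: diff_divide_distrib)
      then have "(norm (F z / of_real R - 1))\<^sup>2 = (norm (F z - of_real R))\<^sup>2 / R\<^sup>2"
        using R by (simp add: norm_divide power_divide)
      also have "\<dots> \<le> (R\<^sup>2 - N\<^sup>2) / R\<^sup>2" using * by (intro divide_right_mono) auto
      also have "\<dots> = 1 - N\<^sup>2 / R\<^sup>2" using R by (simp add: diff_divide_distrib)
      finally show ?thesis .
    qed
    have r: "norm (F z / of_real R - 1) \<le> r" if "z \<in> Q" for z
      unfolding r_def using bound[OF that] by (rule real_le_rsqrt)
    have r0: "0 \<le> r" using r[OF z0(1)] norm_ge_zero order_trans by blast
    have r1: "r < 1" unfolding r_def using N R by (subst real_sqrt_lt_1_iff) simp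
    define G where "G z = (1 / of_real R) * F z" for z
    have G: "hardy L G ((1 / of_real R) * w)" unfolding G_def[abs_def] by (rule hardy_cmult[OF F])
    have Gr: "norm (G z - 1) \<le> r" if "z \<in> Q" for z using r[OF that] by (simp add: G_def)
    note mean = hardy_mean_powr(1)[OF L G Gr r0 r1, where p="complex_of_real p"] hardy_mean_powr(2)[OF L G Gr r0 r1]
      hardy_mean_powr(3)[OF L G Gr r0 r1, where p="complex_of_real p"]
    obtain x where x: "(1 / of_real R) * w = of_real x"
      using w by (metis Reals_cases of_real_1 of_real_divide of_real_mult)
    have "norm (complex_of_real x - 1) \<le> r" using mean(2) unfolding x .
    then have "\<bar>x - 1\<bar> \<le> r" by (metis norm_of_real of_real_1 of_real_diff)
    then have "0 < x" using r1 by linarith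
    then have "Re (of_real (l\<^sup>2) * complex_of_real x powr of_real p) \<ge> 0"
      by (simp add: powr_of_real)
    then have "Re (\<integral>z. G z powr of_real p \<partial>M) \<ge> 0"
      using mean(1) by (simp only: x)
    then have Re0: "(\<integral>z. Re (G z powr of_real p) \<partial>M) \<ge> 0" using mean(3) by simp
    have GQ: "0 < Re (G z)" if "z \<in> Q" for z using pos[OF that] R by (simp add: G_def)
    have Gi: "integrable M (\<lambda>z. norm (G z) powr p)" "integrable M (\<lambda>z. \<bar>Re (G z)\<bar> powr p)"
      using p integrable_norm_powr[of G p] integrable_norm_powr[of "\<lambda>z. of_real (Re (G z))" p] hardy_continuous[OF G]
      by (auto intro: continuous_intros)
    have "(\<integral>z. norm (G z) powr p \<partial>M) \<le> (\<integral>z. A * \<bar>Re (G z)\<bar> powr p - B * Re (G z powr of_real p) \<partial>M)"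
      using Gi mean(3) AB(3)[OF GQ] GQ by (intro integral_mono) (auto simp: abs_of_pos)
    also have "\<dots> = A * (\<integral>z. \<bar>Re (G z)\<bar> powr p \<partial>M) - B * (\<integral>z. Re (G z powr of_real p) \<partial>M)"
      using Gi mean(3) by simp
    also have "\<dots> \<le> A * (\<integral>z. \<bar>Re (G z)\<bar> powr p \<partial>M)" using AB Re0 by simp
    finally have fin: "(\<integral>z. norm (G z) powr p \<partial>M) \<le> A * (\<integral>z. \<bar>Re (G z)\<bar> powr p \<partial>M)" .
    have "norm (G z) powr p = (1 / R) powr p * norm (F z) powr p" for z
      using R by (simp add: G_def norm_mult norm_divide powr_mult powr_divide)
    moreover have "\<bar>Re (G z)\<bar> powr p = (1 / R) powr p * \<bar>Re (F z)\<bar> powr p" for z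
      using R by (simp add: G_def abs_mult powr_mult powr_divide)
    ultimately have "(1 / R) powr p * (\<integral>z. norm (F z) powr p \<partial>M) \<le> (1 / R) powr p * (A * (\<integral>z. \<bar>Re (F z)\<bar> powr p \<partial>M))"
      using fin by (simp add: mult_ac)
    then show ?thesis using R by (subst (asm) mult_le_cancel_left_pos) auto
  qed
  then show thesis using that AB(1) by blast
qed

text \<open>A negative frequency can be replaced by its opposite without changing the real part, because
\<open>e (- n) = cnj (e n)\<close>.\<close>

lemma trig_real_part_hardy:
  assumes L: "linear L" and gen: "\<And>n. n \<in> freqs \<Longrightarrow> n \<noteq> 0 \<Longrightarrow> L n \<noteq> 0"
    and S: "finite S" "S \<subseteq> freqs"
  obtains F w where "hardy L F w" "w \<in> \<real>" "\<And>z. Re (F z) = Re (trig S a z)"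
proof -
  from S have "\<exists>F w. hardy L F w \<and> w \<in> \<real> \<and> (\<forall>z. Re (F z) = Re (trig S a z))"
  proof (induction S rule: finite_induct)
    case empty
    show ?case by (intro exI[of _ "\<lambda>_. 0"] exI[of _ 0]) (auto simp: trig_def intro: hardy_const)
  next
    case (insert n S)
    then obtain F w where F: "hardy L F w" "w \<in> \<real>" "\<forall>z. Re (F z) = Re (trig S a z)" by auto
    have ins: "Re (trig (insert n S) a z) = Re (F z) + Re (a n * e n z)" for z
      using insert F(3) by (simp add: trig_def)
    obtain G v where G: "hardy L G v" "v \<in> \<real>" "\<forall>z. Re (G z) = Re (a n * e n z)"
    proof -
      consider "n = 0" | "0 < L n" | "0 < L (- n)"
        using gen[of n] insert linear_neg[OF L, of n] by fastforce
      then show ?thesis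
      proof cases
        case 1
        then show ?thesis
          by (intro that[of "\<lambda>_. of_real (Re (a n))" "of_real (Re (a n))"]) (auto intro: hardy_const)
      next
        case 2
        then show ?thesis using insert
          by (intro that[of "\<lambda>z. a n * e n z" 0]) (auto intro: hardy_mono)
      next
        case 3
        have "Re (cnj (a n) * e (- n) z) = Re (a n * e n z)" for z
          by (metis cnj_e complex_cnj_mult complex_cnj(1) cnj.simps(1))
        then show ?thesis using insert 3
          by (intro that[of "\<lambda>z. cnj (a n) * e (- n) z" 0]) (auto intro: hardy_mono freqs_uminus)
      qed
    qed
    show ?case using hardy_add[OF F(1) G(1)] F G
      by (intro exI[of _ "\<lambda>z. F z + G z"] exI[of _ "w + v"]) (auto simp: ins)
  qed
  then show thesis using that by blast
qed

text \<open>A general real part is the difference of the real parts of two functions of Hardy type that are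
positive. A real trigonometric polynomial \<open>A\<close> within \<open>\<epsilon>\<close> of \<open>max (Re F) 0 + 2 \<epsilon>\<close> is
positive, and so is \<open>A - Re F\<close>; both exceed \<open>|Re F|\<close> by at most \<open>3 \<epsilon>\<close>, and \<open>\<epsilon>\<close> is arbitrary. The
constant does not depend on the direction \<open>L\<close>, which is essential for averaging over directions.\<close>

lemma riesz_hardy:
  assumes p: "1 < p" "p \<le> 2"
  obtains A where "0 \<le> A"
    "\<And>L F w. linear L \<Longrightarrow> (\<And>n. n \<in> freqs \<Longrightarrow> n \<noteq> 0 \<Longrightarrow> L n \<noteq> 0) \<Longrightarrow> hardy L F w \<Longrightarrow> w \<in> \<real> \<Longrightarrow>
       (\<integral>z. norm (F z) powr p \<partial>M) \<le> A * (\<integral>z. \<bar>Re (F z)\<bar> powr p \<partial>M)"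
proof -
  obtain A where A: "0 \<le> A"
    "\<And>L F w. linear L \<Longrightarrow> hardy L F w \<Longrightarrow> w \<in> \<real> \<Longrightarrow> (\<And>z. z \<in> Q \<Longrightarrow> 0 < Re (F z)) \<Longrightarrow>
       (\<integral>z. norm (F z) powr p \<partial>M) \<le> A * (\<integral>z. \<bar>Re (F z)\<bar> powr p \<partial>M)"
    using riesz_positive[OF p] by blast
  define K where "K = 2 powr p * (2 * A * 2 powr p)"
  have K0: "0 \<le> K" using A by (simp add: K_def)
  have "(\<integral>z. norm (F z) powr p \<partial>M) \<le> K * (\<integral>z. \<bar>Re (F z)\<bar> powr p \<partial>M)"
    if L: "linear L" and gen: "\<And>n. n \<in> freqs \<Longrightarrow> n \<noteq> 0 \<Longrightarrow> L n \<noteq> 0"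
      and F: "hardy L F w" and w: "w \<in> \<real>" for L F w
  proof -
    have Fc: "continuous_on UNIV F" by (rule hardy_continuous[OF F])
    have intRe: "integrable M (\<lambda>z. \<bar>Re (G z)\<bar> powr p)" if "continuous_on UNIV G" for G
      using p integrable_norm_powr[of "\<lambda>z. of_real (Re (G z))" p] that by (auto intro: continuous_intros)
    define X Y where "X = (\<integral>z. norm (F z) powr p \<partial>M)" and "Y = (\<integral>z. \<bar>Re (F z)\<bar> powr p \<partial>M)"
    have main: "X \<le> K * (Y + \<eta> * l\<^sup>2)" if \<eta>: "0 < \<eta>" for \<eta>
    proof -
      \<comment> \<open>chosen so that the excess \<open>3 \<epsilon>\<close> contributes exactly \<open>\<eta>\<close> to the integrand\<close>
      define \<epsilon> where "\<epsilon> = \<eta> powr (1 / p) / 3"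
      have \<epsilon>: "0 < \<epsilon>" "(3 * \<epsilon>) powr p = \<eta>" using \<eta> p by (auto simp: \<epsilon>_def powr_powr)
      have "continuous_on Q (\<lambda>z. max (Re (F z)) 0)"
        using Fc by (intro continuous_intros continuous_on_subset[OF Fc]) auto
      moreover have "max (Re (F z)) 0 = max (Re (F z')) 0" if "torus_pt z = torus_pt z'" for z z'
        using hardy_periodic[OF F that] by simp
      ultimately obtain G where G: "continuous_on torus G" "\<forall>z\<in>Q. G (torus_pt z) = max (Re (F z)) 0"
        using torus_factor[of "\<lambda>z. max (Re (F z)) 0"] by blast
      have "continuous_on torus (\<lambda>x. G x + 2 * \<epsilon>)" using G by (intro continuous_intros)
      from trig_dense_torus[OF this \<epsilon>(1)] obtain S a where S: "finite S" "S \<subseteq> freqs"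
        and app: "\<And>z. norm (of_real (G (torus_pt z) + 2 * \<epsilon>) - trig S a z) < \<epsilon>" by metis
      obtain FA wA where FA: "hardy L FA wA" "wA \<in> \<real>" "\<And>z. Re (FA z) = Re (trig S a z)"
        using trig_real_part_hardy[OF L gen S] by blast
      define FB where "FB z = FA z - F z" for z
      have FB: "hardy L FB (wA - w)" unfolding FB_def[abs_def] by (rule hardy_diff[OF FA(1) F])
      have near: "\<bar>max (Re (F z)) 0 + 2 * \<epsilon> - Re (FA z)\<bar> < \<epsilon>" if "z \<in> Q" for z
      proof -
        have "\<bar>Re (of_real (G (torus_pt z) + 2 * \<epsilon>) - trig S a z)\<bar> < \<epsilon>"
          using app[of z] abs_Re_le_cmod le_less_trans by blast
        then show ?thesis using G(2) that by (simp add: FA(3))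
      qed
      have posA: "0 < Re (FA z)" and posB: "0 < Re (FB z)" and leA: "\<bar>Re (FA z)\<bar> \<le> \<bar>Re (F z)\<bar> + 3 * \<epsilon>"
        and leB: "\<bar>Re (FB z)\<bar> \<le> \<bar>Re (F z)\<bar> + 3 * \<epsilon>" if "z \<in> Q" for z
        using near[OF that] \<epsilon>(1) by (auto simp: FB_def max_def abs_if split: if_splits)
      have est: "(\<integral>z. \<bar>Re (H z)\<bar> powr p \<partial>M) \<le> 2 powr p * (Y + \<eta> * l\<^sup>2)"
        if H: "continuous_on UNIV H" and le: "\<And>z. z \<in> Q \<Longrightarrow> \<bar>Re (H z)\<bar> \<le> \<bar>Re (F z)\<bar> + 3 * \<epsilon>" for H
      proof -
        have "(\<integral>z. \<bar>Re (H z)\<bar> powr p \<partial>M) \<le> (\<integral>z. 2 powr p * (\<bar>Re (F z)\<bar> powr p + \<eta>) \<partial>M)"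
        proof (rule integral_mono)
          fix z assume "z \<in> space M"
          then have "z \<in> Q" by simp
          then have "\<bar>Re (H z)\<bar> powr p \<le> (\<bar>Re (F z)\<bar> + 3 * \<epsilon>) powr p"
            using p le by (intro powr_mono2) auto
          also have "\<dots> \<le> 2 powr p * (\<bar>Re (F z)\<bar> powr p + (3 * \<epsilon>) powr p)"
            using p \<epsilon> by (intro add_powr_le) auto
          finally show "\<bar>Re (H z)\<bar> powr p \<le> 2 powr p * (\<bar>Re (F z)\<bar> powr p + \<eta>)" by (simp add: \<epsilon>)
        qed (use intRe[OF H] intRe[OF Fc] in auto)
        also have "\<dots> = 2 powr p * (Y + \<eta> * l\<^sup>2)"
          using intRe[OF Fc] by (simp add: Y_def measure_M mult.commute)
        finally show ?thesis .
      qed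
      have eqF: "F z = FA z + (- FB z)" for z by (simp add: FB_def)
      have "X \<le> (\<integral>z. 2 powr p * (norm (FA z) powr p + norm (FB z) powr p) \<partial>M)"
        unfolding X_def
      proof (rule integral_mono)
        fix z
        show "norm (F z) powr p \<le> 2 powr p * (norm (FA z) powr p + norm (FB z) powr p)"
          using norm_add_powr_le[of p "FA z" "- FB z"] p unfolding eqF[of z] by simp
      qed (use p Fc FA FB in \<open>auto intro!: integrable_norm_powr Bochner_Integration.integrable_add integrable_mult_right dest: hardy_continuous\<close>)
      also have "\<dots> = 2 powr p * ((\<integral>z. norm (FA z) powr p \<partial>M) + (\<integral>z. norm (FB z) powr p \<partial>M))"
        using integrable_norm_powr[OF hardy_continuous[OF FA(1)], of p] integrable_norm_powr[OF hardy_continuous[OF FB], of p] p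
        by simp
      also have "\<dots> \<le> 2 powr p * (A * (2 powr p * (Y + \<eta> * l\<^sup>2)) + A * (2 powr p * (Y + \<eta> * l\<^sup>2)))"
      proof (intro mult_left_mono add_mono)
        show "(\<integral>z. norm (FA z) powr p \<partial>M) \<le> A * (2 powr p * (Y + \<eta> * l\<^sup>2))"
          using A(2)[OF L FA(1,2) posA] mult_left_mono[OF est[OF hardy_continuous[OF FA(1)] leA] A(1)] by linarith
        have "wA - w \<in> \<real>" using FA w by auto
        then show "(\<integral>z. norm (FB z) powr p \<partial>M) \<le> A * (2 powr p * (Y + \<eta> * l\<^sup>2))"
          using A(2)[OF L FB _ posB] mult_left_mono[OF est[OF hardy_continuous[OF FB] leB] A(1)] by linarith
      qed auto
      also have "\<dots> = K * (Y + \<eta> * l\<^sup>2)" by (simp add: K_def algebra_simps)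
      finally show ?thesis .
    qed
    have "X \<le> K * Y"
    proof (rule field_le_epsilon)
      fix d :: real assume d: "0 < d"
      define \<eta> where "\<eta> = d / (l\<^sup>2 * (K + 1))"
      have \<eta>: "0 < \<eta>" using d K0 l_pos by (simp add: \<eta>_def)
      have "K * (\<eta> * l\<^sup>2) = d * (K / (K + 1))" using l_pos K0 by (simp add: \<eta>_def)
      also have "\<dots> \<le> d * 1" using d K0 by (intro mult_left_mono) auto
      finally show "X \<le> K * Y + d" using main[OF \<eta>] by (simp add: distrib_left)
    qed
    then show ?thesis by (simp add: X_def Y_def)
  qed
  then show thesis using that K0 by blast
qed

lemma trig_norm_powr_integrable: "0 < p \<Longrightarrow> integrable M (\<lambda>z. norm (trig S a z) powr p)"
  by (rule integrable_norm_powr[OF continuous_trig])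

text \<open>Split the polynomial as \<open>a0 + P + cnj G\<close> with \<open>P\<close> and \<open>G\<close> of Hardy type and mean zero. Its real and
imaginary parts are, up to the constant, the real parts of \<open>P + G\<close> and \<open>- \<i> (P - G)\<close>. Hence the inequality of Riesz
bounds \<open>P\<close> and \<open>G\<close> separately, and the multiplier produces \<open>P - cnj G\<close>.\<close>

lemma sgn_multiplier_bound:
  assumes p: "1 < p" "p \<le> 2"
  obtains K where "0 \<le> K"
    "\<And>L S a. linear L \<Longrightarrow> (\<And>n. n \<in> freqs \<Longrightarrow> n \<noteq> 0 \<Longrightarrow> L n \<noteq> 0) \<Longrightarrow> finite S \<Longrightarrow> S \<subseteq> freqs \<Longrightarrow>
       (\<integral>z. norm (trig S (\<lambda>n. of_real (sgn (L n)) * a n) z) powr p \<partial>M) \<le> K * (\<integral>z. norm (trig S a z) powr p \<partial>M)"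
proof -
  obtain A where A: "0 \<le> A"
    "\<And>L F w. linear L \<Longrightarrow> (\<And>n. n \<in> freqs \<Longrightarrow> n \<noteq> 0 \<Longrightarrow> L n \<noteq> 0) \<Longrightarrow> hardy L F w \<Longrightarrow> w \<in> \<real> \<Longrightarrow>
       (\<integral>z. norm (F z) powr p \<partial>M) \<le> A * (\<integral>z. \<bar>Re (F z)\<bar> powr p \<partial>M)"
    using riesz_hardy[OF p] by blast
  define K where "K = 2 powr p * (2 powr p * (A + A) + 2 powr p)"
  have "(\<integral>z. norm (trig S (\<lambda>n. of_real (sgn (L n)) * a n) z) powr p \<partial>M) \<le> K * (\<integral>z. norm (trig S a z) powr p \<partial>M)"
    if L: "linear L" and gen: "\<And>n. n \<in> freqs \<Longrightarrow> n \<noteq> 0 \<Longrightarrow> L n \<noteq> 0"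
      and S: "finite S" "S \<subseteq> freqs" for L S a
  proof -
    define I where "I = (\<integral>z. norm (trig S a z) powr p \<partial>M)"
    define Sp Sn where "Sp = {n\<in>S. 0 < L n}" and "Sn = {n\<in>S. L n < 0}"
    define a0 where "a0 = (if 0 \<in> S then a 0 else 0)"
    have split: "(\<Sum>n\<in>S. f n) = (\<Sum>n\<in>Sp. f n) + (\<Sum>n\<in>Sn. f n) + (if 0 \<in> S then f 0 else 0)" for f :: "complex \<Rightarrow> complex"
    proof -
      have L0: "L 0 = 0" using L by (rule linear_0)
      have un: "S = (Sp \<union> Sn) \<union> ({0} \<inter> S)" using gen S(2) L0 by (auto simp: Sp_def Sn_def) (metis linorder_neqE_linordered_idom subsetD)
      have "(\<Sum>n\<in>S. f n) = (\<Sum>n\<in>(Sp \<union> Sn) \<union> ({0} \<inter> S). f n)" using un by simp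
      also have "\<dots> = (\<Sum>n\<in>Sp. f n) + (\<Sum>n\<in>Sn. f n) + (\<Sum>n\<in>{0} \<inter> S. f n)"
        using S(1) L0 by (subst sum.union_disjoint; (subst sum.union_disjoint)?) (auto simp: Sp_def Sn_def)
      also have "(\<Sum>n\<in>{0} \<inter> S. f n) = (if 0 \<in> S then f 0 else 0)" by auto
      finally show ?thesis .
    qed
    define P G where "P z = trig Sp a z" and "G z = cnj (trig Sn a z)" for z
    have tpS: "trig S a z = P z + cnj (G z) + a0" for z
      unfolding trig_def[of S] split by (simp add: P_def G_def trig_def a0_def)
    have tpH: "trig S (\<lambda>n. of_real (sgn (L n)) * a n) z = P z - cnj (G z)" for z
      unfolding trig_def[of S] split
      by (simp add: P_def G_def trig_def linear_0[OF L] Sp_def Sn_def sum_negf[symmetric] cong: sum.cong_simp)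
    have fin: "finite Sp" "finite Sn" using S by (auto simp: Sp_def Sn_def)
    have sumP: "hardy L (\<lambda>z. \<Sum>n\<in>T. b n * e (sig n) z) 0" if "finite T" "\<And>n. n \<in> T \<Longrightarrow> sig n \<in> freqs \<and> 0 < L (sig n)" for T b sig
      using that
    proof (induction T rule: finite_induct)
      case empty show ?case using hardy_const[of L 0] by simp
    next
      case (insert n T)
      then have "hardy L (\<lambda>z. b n * e (sig n) z + (\<Sum>n\<in>T. b n * e (sig n) z)) (0 + 0)"
        by (intro hardy_add hardy_mono) auto
      then show ?case using insert by simp
    qed
    have P: "hardy L P 0" unfolding P_def[abs_def] trig_def
      using fin S(2) by (intro sumP[of Sp "\<lambda>n. n" a]) (auto simp: Sp_def)
    have G: "hardy L G 0"
    proof -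
      have "hardy L (\<lambda>z. \<Sum>n\<in>Sn. cnj (a n) * e (- n) z) 0"
        using fin S(2) by (intro sumP[of Sn uminus "\<lambda>n. cnj (a n)"]) (auto simp: Sn_def linear_neg[OF L] intro: freqs_uminus)
      then show ?thesis by (simp add: G_def[abs_def] trig_def cnj_e)
    qed
    define F1 F2 where "F1 z = P z + G z + of_real (Re a0)" and "F2 z = - \<i> * (P z - G z) + of_real (Im a0)" for z
    have F1: "hardy L F1 (of_real (Re a0))" and F2: "hardy L F2 (of_real (Im a0))"
      using hardy_add[OF hardy_add[OF P G] hardy_const[of L "of_real (Re a0)"]]
        hardy_add[OF hardy_cmult[OF hardy_diff[OF P G], of "- \<i>"] hardy_const[of L "of_real (Im a0)"]]
      by (simp_all add: F1_def[abs_def] F2_def[abs_def])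
    have ReF: "Re (F1 z) = Re (trig S a z)" "Re (F2 z) = Im (trig S a z)" for z
      by (simp_all add: F1_def F2_def tpS)
    have cont: "continuous_on UNIV F1" "continuous_on UNIV F2" using F1 F2 by (auto dest: hardy_continuous)
    have intS: "integrable M (\<lambda>z. norm (trig T b z) powr p)" for T b
      using p by (intro trig_norm_powr_integrable) auto
    have int12: "integrable M (\<lambda>z. norm (F1 z) powr p)" "integrable M (\<lambda>z. norm (F2 z) powr p)"
      using p cont by (auto intro: integrable_norm_powr)
    have le1: "(\<integral>z. norm (F1 z) powr p \<partial>M) \<le> A * I"
    proof (rule order_trans[OF A(2)[OF L gen F1]])
      show "A * (\<integral>z. \<bar>Re (F1 z)\<bar> powr p \<partial>M) \<le> A * I" unfolding I_def
      proof (intro mult_left_mono integral_mono' A(1) intS)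
        fix z show "\<bar>Re (F1 z)\<bar> powr p \<le> norm (trig S a z) powr p"
          unfolding ReF using p by (intro powr_mono2 abs_Re_le_cmod) auto
      qed simp
    qed auto
    have le2: "(\<integral>z. norm (F2 z) powr p \<partial>M) \<le> A * I"
    proof (rule order_trans[OF A(2)[OF L gen F2]])
      show "A * (\<integral>z. \<bar>Re (F2 z)\<bar> powr p \<partial>M) \<le> A * I" unfolding I_def
      proof (intro mult_left_mono integral_mono' A(1) intS)
        fix z show "\<bar>Re (F2 z)\<bar> powr p \<le> norm (trig S a z) powr p"
          unfolding ReF using p by (intro powr_mono2 abs_Im_le_cmod) auto
      qed simp
    qed auto
    have le0: "l\<^sup>2 * norm a0 powr p \<le> I"
    proof -
      have l2: "0 < l\<^sup>2" using l_pos by simp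
      have "(\<integral>z. trig S a z \<partial>M) = of_real (l\<^sup>2) * a0"
        using integral_hardy[OF L P] integral_hardy[OF L G] P G unfolding tpS
        by (simp add: continuous_integrable_M hardy_continuous measure_M scaleR_conv_of_real)
      then have "l\<^sup>2 * norm a0 = norm (\<integral>z. trig S a z \<partial>M)" by (simp add: norm_mult norm_power)
      also have "\<dots> \<le> (\<integral>z. norm (trig S a z) \<partial>M)" by (rule integral_norm_bound)
      finally have "(l\<^sup>2 * norm a0) powr p \<le> (\<integral>z. norm (trig S a z) \<partial>M) powr p"
        using p by (intro powr_mono2) auto
      also have "\<dots> \<le> (l\<^sup>2) powr (p - 1) * I"
        unfolding I_def using Jensen_powr[OF finite_M, of p "trig S a"] p l_pos
        by (simp add: measure_M Lp_def intS borel_measurable_M)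
      finally have "(l\<^sup>2) powr (p - 1) * (l\<^sup>2 * norm a0 powr p) \<le> (l\<^sup>2) powr (p - 1) * I"
        using l2 by (simp add: powr_mult powr_diff)
      then show ?thesis using l2 by (subst (asm) mult_le_cancel_left_pos) auto
    qed
    have pw: "norm (P z - cnj (G z)) \<le> (norm (F1 z) + norm (F2 z)) + 2 * norm a0" for z
    proof -
      have "2 * P z = (F1 z - of_real (Re a0)) + \<i> * (F2 z - of_real (Im a0))"
        "2 * G z = (F1 z - of_real (Re a0)) - \<i> * (F2 z - of_real (Im a0))"
        by (simp_all add: F1_def F2_def algebra_simps)
      then have "norm (2 * P z) \<le> norm (F1 z - of_real (Re a0)) + norm (\<i> * (F2 z - of_real (Im a0)))"
        "norm (2 * G z) \<le> norm (F1 z - of_real (Re a0)) + norm (\<i> * (F2 z - of_real (Im a0)))"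
        by (simp_all only: norm_triangle_ineq norm_triangle_ineq4)
      moreover have "norm (F1 z - of_real (Re a0)) \<le> norm (F1 z) + norm a0"
        using norm_triangle_ineq4[of "F1 z" "of_real (Re a0)"] abs_Re_le_cmod[of a0] by simp
      moreover have "norm (\<i> * (F2 z - of_real (Im a0))) \<le> norm (F2 z) + norm a0"
        using norm_triangle_ineq4[of "F2 z" "of_real (Im a0)"] abs_Im_le_cmod[of a0] by (simp add: norm_mult)
      moreover have "norm (P z - cnj (G z)) \<le> norm (P z) + norm (G z)"
        using norm_triangle_ineq4[of "P z" "cnj (G z)"] by simp
      ultimately show ?thesis by (simp add: norm_mult)
    qed
    have "norm (P z - cnj (G z)) powr p \<le>
        2 powr p * (2 powr p * (norm (F1 z) powr p + norm (F2 z) powr p) + 2 powr p * norm a0 powr p)" for z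
    proof -
      have "norm (P z - cnj (G z)) powr p \<le> ((norm (F1 z) + norm (F2 z)) + 2 * norm a0) powr p"
        using p by (intro powr_mono2 pw) auto
      also have "\<dots> \<le> 2 powr p * ((norm (F1 z) + norm (F2 z)) powr p + (2 * norm a0) powr p)"
        using p by (intro add_powr_le) auto
      also have "\<dots> \<le> 2 powr p * (2 powr p * (norm (F1 z) powr p + norm (F2 z) powr p) + 2 powr p * norm a0 powr p)"
        using p by (intro mult_left_mono add_mono add_powr_le) (auto simp: powr_mult)
      finally show ?thesis .
    qed
    then have "(\<integral>z. norm (trig S (\<lambda>n. of_real (sgn (L n)) * a n) z) powr p \<partial>M) \<le>
        (\<integral>z. 2 powr p * (2 powr p * (norm (F1 z) powr p + norm (F2 z) powr p) + 2 powr p * norm a0 powr p) \<partial>M)"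
      using int12 intS by (intro integral_mono) (auto simp: tpH[symmetric])
    also have "\<dots> = 2 powr p * (2 powr p * ((\<integral>z. norm (F1 z) powr p \<partial>M) + (\<integral>z. norm (F2 z) powr p \<partial>M)) + 2 powr p * (l\<^sup>2 * norm a0 powr p))"
      using int12 by (simp add: measure_M)
    also have "\<dots> \<le> 2 powr p * (2 powr p * (A * I + A * I) + 2 powr p * I)"
      using le0 le1 le2 by (intro mult_left_mono add_mono) auto
    also have "\<dots> = K * I" by (simp add: K_def algebra_simps)
    finally show ?thesis by (simp add: I_def)
  qed
  moreover have "0 \<le> K" using A by (simp add: K_def)
  ultimately show thesis using that by blast
qed

end

section \<open>The symbol of the Beurling transform as an average over directions\<close>

definition half_wave :: "real \<Rightarrow> complex" where "half_wave s = cis (- s) * of_real (sgn (cos s))"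

lemma half_wave_measurable [measurable]: "half_wave \<in> borel_measurable borel"
proof -
  have [measurable]: "cis \<in> borel_measurable borel"
    by (intro borel_measurable_continuous_onI) (auto simp: cis_conv_exp intro!: continuous_intros)
  have [measurable]: "(cos :: real \<Rightarrow> real) \<in> borel_measurable borel"
    by (intro borel_measurable_continuous_onI continuous_intros)
  show ?thesis unfolding half_wave_def[abs_def] by measurable
qed

lemma norm_half_wave_le: "norm (half_wave s) \<le> 1"
  by (simp add: half_wave_def norm_mult sgn_if)

lemma half_wave_periodic: "half_wave (s - 2 * pi) = half_wave s"
proof -
  have "cos (s - 2 * pi) = cos s" by (metis cos_periodic diff_add_cancel)
  moreover have "cis (- (s - 2 * pi)) = cis (- s)" by (simp add: cis.ctr cos_diff sin_diff)
  ultimately show ?thesis by (simp add: half_wave_def)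
qed

lemma integrable_ind_bounded:
  fixes f :: "real \<Rightarrow> complex"
  assumes [measurable]: "f \<in> borel_measurable borel" and "\<And>x. norm (f x) \<le> B"
    and "A \<in> sets lborel" "emeasure lborel A < \<infinity>"
  shows "integrable lborel (\<lambda>x. indicator A x *\<^sub>R f x)"
proof (rule Bochner_Integration.integrable_bound)
  show "integrable lborel (\<lambda>x. B * indicator A x)"
    using assms by (intro integrable_mult_right integrable_real_indicator) auto
  show "AE x in lborel. norm (indicator A x *\<^sub>R f x) \<le> norm (B * indicator A x)"
    using assms(2) order_trans[OF norm_ge_zero assms(2)] by (auto simp: indicator_def)
qed (use assms in measurable)

lemma half_wave_integral_shift:
  assumes "0 \<le> \<phi>" "\<phi> \<le> 2 * pi"
  shows "(\<integral>t. indicator {0..2*pi} t *\<^sub>R half_wave (t - \<phi>) \<partial>lborel) = (\<integral>t. indicator {0..2*pi} t *\<^sub>R half_wave t \<partial>lborel)"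
proof -
  have int: "integrable lborel (\<lambda>x. indicator {a..<b} x *\<^sub>R half_wave x)" "integrable lborel (\<lambda>x. indicator {a..b} x *\<^sub>R half_wave x)" for a b
    by (rule integrable_ind_bounded[OF half_wave_measurable norm_half_wave_le]; cases "a \<le> b"; simp)+
  have "(\<integral>t. indicator {0..2*pi} t *\<^sub>R half_wave (t - \<phi>) \<partial>lborel) = (\<integral>s. indicator {0..2*pi} (\<phi> + s) *\<^sub>R half_wave s \<partial>lborel)"
    using lborel_integral_real_affine[of 1 "\<lambda>t. indicator {0..2*pi} t *\<^sub>R half_wave (t - \<phi>)" \<phi>] by simp
  also have "\<dots> = (\<integral>s. indicator {- \<phi>..<0} s *\<^sub>R half_wave s + indicator {0..2*pi-\<phi>} s *\<^sub>R half_wave s \<partial>lborel)"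
    using assms by (intro Bochner_Integration.integral_cong) (auto simp: indicator_def)
  also have "\<dots> = (\<integral>s. indicator {- \<phi>..<0} s *\<^sub>R half_wave s \<partial>lborel) + (\<integral>s. indicator {0..2*pi-\<phi>} s *\<^sub>R half_wave s \<partial>lborel)"
    by (intro Bochner_Integration.integral_add int)
  also have "(\<integral>s. indicator {- \<phi>..<0} s *\<^sub>R half_wave s \<partial>lborel) = (\<integral>s. indicator {- \<phi>..<0} (- (2*pi) + s) *\<^sub>R half_wave (- (2*pi) + s) \<partial>lborel)"
    using lborel_integral_real_affine[of 1 "\<lambda>s. indicator {- \<phi>..<0} s *\<^sub>R half_wave s" "- (2*pi)"] by simp
  also have "\<dots> = (\<integral>s. indicator {2*pi - \<phi>..<2*pi} s *\<^sub>R half_wave s \<partial>lborel)"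
  proof (intro Bochner_Integration.integral_cong refl)
    fix s
    have "half_wave (- (2*pi) + s) = half_wave s" using half_wave_periodic[of s] by simp
    then show "indicator {- \<phi>..<0} (- (2*pi) + s) *\<^sub>R half_wave (- (2*pi) + s) = indicator {2*pi - \<phi>..<2*pi} s *\<^sub>R half_wave s"
      by (auto simp: indicator_def)
  qed
  also have "\<dots> + (\<integral>s. indicator {0..2*pi-\<phi>} s *\<^sub>R half_wave s \<partial>lborel) =
      (\<integral>s. indicator {2*pi - \<phi>..<2*pi} s *\<^sub>R half_wave s + indicator {0..2*pi-\<phi>} s *\<^sub>R half_wave s \<partial>lborel)"
    by (intro Bochner_Integration.integral_add[symmetric] int)
  also have "\<dots> = (\<integral>t. indicator {0..2*pi} t *\<^sub>R half_wave t \<partial>lborel)"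
  proof (rule integral_cong_AE)
    have "AE s in lborel. s \<notin> {2*pi - \<phi>, 2*pi}" by (intro AE_not_in countable_imp_null_set_lborel) auto
    then show "AE s in lborel. indicator {2*pi - \<phi>..<2*pi} s *\<^sub>R half_wave s + indicator {0..2*pi-\<phi>} s *\<^sub>R half_wave s = indicator {0..2*pi} s *\<^sub>R half_wave s"
      by eventually_elim (use assms in \<open>auto simp: indicator_def\<close>)
  qed auto
  finally show ?thesis .
qed

definition dir_const :: complex where "dir_const = (\<integral>t. indicator {0..2*pi} t *\<^sub>R half_wave t \<partial>lborel)"

text \<open>The real part of the integrand is \<open>|cos t|\<close>.\<close>

lemma dir_const_nonzero: "dir_const \<noteq> 0"
proof -
  have int: "integrable lborel (\<lambda>t. indicator {0..2*pi} t *\<^sub>R half_wave t)"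
    by (rule integrable_ind_bounded[OF half_wave_measurable norm_half_wave_le]) auto
  have "(\<integral>t. (1/2) * indicator {0..pi/3} t \<partial>lborel) \<le> (\<integral>t. Re (indicator {0..2*pi} t *\<^sub>R half_wave t) \<partial>lborel)"
  proof (rule integral_mono)
    fix t :: real
    have Re: "Re (half_wave t) = \<bar>cos t\<bar>" by (simp add: half_wave_def abs_sgn)
    show "(1/2) * indicator {0..pi/3} t \<le> Re (indicator {0..2*pi} t *\<^sub>R half_wave t)"
    proof (cases "t \<in> {0..pi/3}")
      case True
      then have "cos (pi/3) \<le> cos t" by (intro cos_monotone_0_pi_le) auto
      then show ?thesis using True by (auto simp: Re cos_60 indicator_def)
    qed (simp add: Re)
  qed (use integrable_Re[OF int] in auto)
  also have "\<dots> = Re dir_const" by (simp only: dir_const_def integral_Re[OF int])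
  also have "(\<integral>t. (1/2) * indicator {0..pi/3} t \<partial>lborel) = pi / 6" by simp
  finally have "0 < Re dir_const" using pi_gt_zero by linarith
  then show ?thesis by auto
qed

lemma Re_cis_mult: "Re (m * cis (- t)) = norm m * cos (t - Arg2pi m)"
proof -
  have "m = of_real (norm m) * cis (Arg2pi m)"
    using Arg2pi[of m] by (auto simp: cis_conv_exp mult.commute is_Arg_def)
  then have "m * cis (- t) = of_real (norm m) * cis (Arg2pi m - t)"
    by (metis cis_mult diff_conv_add_uminus mult.assoc)
  then show ?thesis by (simp add: cos_diff mult.commute)
qed

text \<open>Both sides are covariant under rotation of \<open>m\<close>: the integrand is \<open>cis (- \<phi>)\<close> times a shift by the
argument \<open>\<phi>\<close> of \<open>m\<close> of a fixed function with period \<open>2 pi\<close>.\<close>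

lemma direction_average:
  assumes "m \<noteq> 0"
  shows "(\<integral>t. indicator {0..2*pi} t *\<^sub>R (cis (- t) * of_real (sgn (Re (m * cis (- t))))) \<partial>lborel) = dir_const * (cnj m / norm m)"
proof -
  define \<phi> where "\<phi> = Arg2pi m"
  have \<phi>: "0 \<le> \<phi>" "\<phi> \<le> 2 * pi" using Arg2pi[of m] by (auto simp: \<phi>_def)
  have m: "m = of_real (norm m) * cis \<phi>"
    using Arg2pi[of m] by (auto simp: cis_conv_exp \<phi>_def mult.commute is_Arg_def)
  have cm: "cnj m / norm m = cis (- \<phi>)"
  proof -
    have "cnj m = of_real (norm m) * cis (- \<phi>)" by (subst m) (simp add: cis_cnj)
    then show ?thesis using assms by simp
  qed
  have "cis (- t) * of_real (sgn (Re (m * cis (- t)))) = cis (- \<phi>) * half_wave (t - \<phi>)" for t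
    unfolding Re_cis_mult \<phi>_def[symmetric] using assms by (simp add: half_wave_def cis_mult mult.assoc[symmetric] sgn_mult)
  then have "(\<integral>t. indicator {0..2*pi} t *\<^sub>R (cis (- t) * of_real (sgn (Re (m * cis (- t))))) \<partial>lborel)
      = (\<integral>t. cis (- \<phi>) * (indicator {0..2*pi} t *\<^sub>R half_wave (t - \<phi>)) \<partial>lborel)" by simp
  also have "\<dots> = cis (- \<phi>) * dir_const"
    unfolding integral_mult_right_zero half_wave_integral_shift[OF \<phi>] dir_const_def ..
  finally show ?thesis by (simp add: cm mult.commute)
qed

lemma direction_generic:
  assumes "m \<noteq> 0"
  shows "AE t in lborel. Re (m * cis (- t)) \<noteq> 0"
proof -
  have "{t. Re (m * cis (- t)) = 0} \<subseteq> range (\<lambda>i::int. of_int i * (pi / 2) + Arg2pi m)"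
  proof
    fix t assume "t \<in> {t. Re (m * cis (- t)) = 0}"
    then have "norm m * cos (t - Arg2pi m) = 0" by (simp only: mem_Collect_eq Re_cis_mult)
    then have "cos (t - Arg2pi m) = 0" using assms by simp
    then obtain i :: int where "t - Arg2pi m = of_int i * (pi / 2)" by (auto simp: cos_zero_iff_int)
    then have "t = of_int i * (pi / 2) + Arg2pi m" by simp
    then show "t \<in> range (\<lambda>i::int. of_int i * (pi / 2) + Arg2pi m)" by blast
  qed
  then have "countable {t. Re (m * cis (- t)) = 0}" by (rule countable_subset) simp
  then have "AE t in lborel. t \<notin> {t. Re (m * cis (- t)) = 0}"
    by (intro AE_not_in countable_imp_null_set_lborel)
  then show ?thesis by simp
qed

context square begin

lemma countable_freqs: "countable freqs"
proof -
  have "freqs \<subseteq> range (\<lambda>(i, j). Complex (of_int i) (of_int j))"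
    by (auto simp: freqs_def Ints_def image_def complex_eq_iff)
  then show ?thesis by (rule countable_subset) simp
qed

text \<open>Up to the factor \<open>\<i> \<kappa> / 2\<close>, this is the symbol of \<open>\<partial>\<^bsub>zbar\<^esub> - a \<partial>\<^bsub>z\<^esub>\<close>.\<close>

definition freq_map :: "complex \<Rightarrow> complex \<Rightarrow> complex" where "freq_map a n = n - a * cnj n"

lemma freq_map_nonzero: "norm a < 1 \<Longrightarrow> n \<noteq> 0 \<Longrightarrow> freq_map a n \<noteq> 0"
proof
  assume a: "norm a < 1" "n \<noteq> 0" and "freq_map a n = 0"
  then have "norm n = norm a * norm n" by (metis freq_map_def complex_mod_cnj eq_iff_diff_eq_0 norm_mult)
  then show False using a by simp
qed

definition dir_form :: "complex \<Rightarrow> real \<Rightarrow> complex \<Rightarrow> real" where "dir_form a t n = Re (freq_map a n * cis (- t))"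

lemma linear_dir_form: "linear (dir_form a t)"
  by (rule linearI) (auto simp: dir_form_def freq_map_def algebra_simps)

lemma dir_form_generic:
  assumes "norm a < 1"
  shows "AE t in lborel. \<forall>n\<in>freqs. n \<noteq> 0 \<longrightarrow> dir_form a t n \<noteq> 0"
proof -
  have "AE t in lborel. \<forall>n\<in>freqs - {0}. dir_form a t n \<noteq> 0"
    using countable_freqs direction_generic[OF freq_map_nonzero[OF assms]]
    by (subst AE_ball_countable) (auto simp: dir_form_def)
  then show ?thesis by eventually_elim auto
qed

text \<open>The symbol of a complex Riesz transform in the coordinate \<open>freq_map a n\<close>. Its value at \<open>n = 0\<close> is zero by
the convention for division by zero.\<close>

definition riesz_symbol :: "complex \<Rightarrow> complex \<Rightarrow> complex" where "riesz_symbol a n = cnj (freq_map a n) / norm (freq_map a n)"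

lemma riesz_symbol_integral:
  assumes "norm a < 1"
  shows "(\<integral>t. indicator {0..2*pi} t *\<^sub>R (cis (- t) * of_real (sgn (dir_form a t n))) \<partial>lborel) = dir_const * riesz_symbol a n"
proof (cases "freq_map a n = 0")
  case True then show ?thesis by (simp add: riesz_symbol_def dir_form_def)
next
  case False
  then show ?thesis unfolding riesz_symbol_def dir_form_def by (rule direction_average)
qed

lemma dir_form_measurable [measurable]: "(\<lambda>t. dir_form a t n) \<in> borel_measurable borel"
  unfolding dir_form_def by (intro borel_measurable_continuous_onI) (auto simp: cis_conv_exp intro!: continuous_intros)

text \<open>The method of rotations: the multiplier is an average over the directions \<open>t\<close> of the sign multipliers,
whose norms are bounded uniformly in \<open>t\<close>. Directions for which some frequency lies on
the boundary line of the half plane form a null set.\<close>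

lemma riesz_symbol_multiplier_bound:
  assumes a: "norm a < 1" and p: "1 < p" "p \<le> 2"
  obtains K where "0 \<le> K"
    "\<And>S b. finite S \<Longrightarrow> S \<subseteq> freqs \<Longrightarrow>
       (\<integral>z. norm (trig S (\<lambda>n. riesz_symbol a n * b n) z) powr p \<partial>M) \<le> K * (\<integral>z. norm (trig S b z) powr p \<partial>M)"
proof -
  obtain K where K: "0 \<le> K"
    "\<And>L S a. linear L \<Longrightarrow> (\<And>n. n \<in> freqs \<Longrightarrow> n \<noteq> 0 \<Longrightarrow> L n \<noteq> 0) \<Longrightarrow> finite S \<Longrightarrow> S \<subseteq> freqs \<Longrightarrow>
       (\<integral>z. norm (trig S (\<lambda>n. of_real (sgn (L n)) * a n) z) powr p \<partial>M) \<le> K * (\<integral>z. norm (trig S a z) powr p \<partial>M)"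
    using sgn_multiplier_bound[OF p] by blast
  define \<Theta> where "\<Theta> = restrict_space lborel {0..2*pi}"
  have mT: "measure \<Theta> (space \<Theta>) = 2 * pi"
    by (simp add: \<Theta>_def measure_restrict_space)
  have fT: "finite_measure \<Theta>"
    by (intro finite_measureI) (simp add: \<Theta>_def emeasure_restrict_space space_restrict_space)
  interpret T: finite_measure \<Theta> by fact
  interpret TM: pair_sigma_finite \<Theta> M by unfold_locales
  interpret TMf: finite_measure "\<Theta> \<Otimes>\<^sub>M M" by (rule finite_measure_pair_measure[OF finite_M fT])
  define C where "C = (2 * pi) powr (p - 1) * (2 * pi * K) / norm dir_const powr p"
  have main: "(\<integral>z. norm (trig S (\<lambda>n. riesz_symbol a n * b n) z) powr p \<partial>M) \<le> C * (\<integral>z. norm (trig S b z) powr p \<partial>M)"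
    if S: "finite S" "S \<subseteq> freqs" for S b
  proof -
    define I where "I = (\<integral>z. norm (trig S b z) powr p \<partial>M)"
    define H where "H t z = trig S (\<lambda>n. of_real (sgn (dir_form a t n)) * b n) z" for t z
    define B where "B = (\<Sum>n\<in>S. norm (b n))"
    have HB: "norm (H t z) \<le> B" for t z
      unfolding H_def B_def
      by (rule order_trans[OF norm_trig_le]) (auto intro!: sum_mono simp: norm_mult sgn_if)
    have LLT [measurable]: "(\<lambda>t. dir_form a t n) \<in> borel_measurable \<Theta>" for n
      unfolding \<Theta>_def by (intro measurable_restrict_space1) simp
    have eM [measurable]: "e n \<in> borel_measurable M" for n by (rule borel_measurable_M) simp
    have Hm [measurable]: "(\<lambda>x. H (fst x) (snd x)) \<in> borel_measurable (\<Theta> \<Otimes>\<^sub>M M)"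
      unfolding H_def trig_def by measurable
    have Hmt [measurable]: "(\<lambda>t. H t z) \<in> borel_measurable \<Theta>" for z
      unfolding H_def trig_def by measurable
    have Hp: "norm (H t z) powr p \<le> B powr p" for t z using p HB by (intro powr_mono2) auto
    have intp: "integrable (\<Theta> \<Otimes>\<^sub>M M) (\<lambda>x. norm (H (fst x) (snd x)) powr p)"
      by (rule TMf.integrable_const_bound[where B="B powr p"]) (auto intro: Hp)
    have intt: "integrable \<Theta> (\<lambda>t. norm (H t z) powr p)" for z
      by (rule T.integrable_const_bound[where B="B powr p"]) (auto intro: Hp)
    have point: "norm dir_const powr p * norm (trig S (\<lambda>n. riesz_symbol a n * b n) z) powr p \<le>
        (2 * pi) powr (p - 1) * (\<integral>t. norm (H t z) powr p \<partial>\<Theta>)" for z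
    proof -
      have cm [measurable]: "(\<lambda>t. cis (- t)) \<in> borel_measurable borel"
        by (intro borel_measurable_continuous_onI) (auto simp: cis_conv_exp intro!: continuous_intros)
      have int1: "integrable lborel (\<lambda>t. indicator {0..2*pi} t *\<^sub>R (cis (- t) * of_real (sgn (dir_form a t n))))" for n
        by (rule integrable_ind_bounded[where B=1]) (auto simp: norm_mult sgn_if)
      have "dir_const * trig S (\<lambda>n. riesz_symbol a n * b n) z = (\<Sum>n\<in>S. (dir_const * riesz_symbol a n) * (b n * e n z))"
        by (simp add: trig_def sum_distrib_left mult_ac)
      also have "\<dots> = (\<Sum>n\<in>S. \<integral>t. indicator {0..2*pi} t *\<^sub>R (cis (- t) * of_real (sgn (dir_form a t n))) * (b n * e n z) \<partial>lborel)"
        by (simp only: riesz_symbol_integral[OF a, symmetric] integral_mult_left_zero)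
      also have "\<dots> = (\<integral>t. (\<Sum>n\<in>S. indicator {0..2*pi} t *\<^sub>R (cis (- t) * of_real (sgn (dir_form a t n))) * (b n * e n z)) \<partial>lborel)"
        using int1 by (intro Bochner_Integration.integral_sum[symmetric] integrable_mult_left) auto
      also have "\<dots> = (\<integral>t. indicator {0..2*pi} t *\<^sub>R (cis (- t) * H t z) \<partial>lborel)"
        by (intro Bochner_Integration.integral_cong refl)
          (simp add: H_def trig_def sum_distrib_left scaleR_sum_right mult_ac)
      also have "\<dots> = (\<integral>t. cis (- t) * H t z \<partial>\<Theta>)"
        unfolding \<Theta>_def by (subst integral_restrict_space) auto
      finally have "norm dir_const * norm (trig S (\<lambda>n. riesz_symbol a n * b n) z) = norm (\<integral>t. cis (- t) * H t z \<partial>\<Theta>)"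
        by (simp add: norm_mult[symmetric])
      also have "\<dots> \<le> (\<integral>t. norm (cis (- t) * H t z) \<partial>\<Theta>)" by (rule integral_norm_bound)
      also have "\<dots> = (\<integral>t. norm (H t z) \<partial>\<Theta>)" by (simp add: norm_mult)
      finally have "(norm dir_const * norm (trig S (\<lambda>n. riesz_symbol a n * b n) z)) powr p \<le> (\<integral>t. norm (H t z) \<partial>\<Theta>) powr p"
        using p by (intro powr_mono2) auto
      also have "\<dots> \<le> (2 * pi) powr (p - 1) * (\<integral>t. norm (H t z) powr p \<partial>\<Theta>)"
        using Jensen_powr[OF fT, of p "\<lambda>t. H t z"] p intt unfolding mT by (simp add: Lp_def)
      finally show ?thesis by (simp add: powr_mult)
    qed
    have "norm dir_const powr p * (\<integral>z. norm (trig S (\<lambda>n. riesz_symbol a n * b n) z) powr p \<partial>M) \<le>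
        (\<integral>z. (2 * pi) powr (p - 1) * (\<integral>t. norm (H t z) powr p \<partial>\<Theta>) \<partial>M)"
    proof -
      have "integrable M (\<lambda>z. \<integral>t. norm (H t z) powr p \<partial>\<Theta>)"
        using TM.integrable_snd[of "\<lambda>t z. norm (H t z) powr p"] intp by (simp add: case_prod_unfold)
      then have "(\<integral>z. norm dir_const powr p * norm (trig S (\<lambda>n. riesz_symbol a n * b n) z) powr p \<partial>M) \<le>
        (\<integral>z. (2 * pi) powr (p - 1) * (\<integral>t. norm (H t z) powr p \<partial>\<Theta>) \<partial>M)"
        using point p by (intro integral_mono integrable_mult_right trig_norm_powr_integrable) auto
      then show ?thesis by simp
    qed
    also have "\<dots> = (2 * pi) powr (p - 1) * (\<integral>z. (\<integral>t. norm (H t z) powr p \<partial>\<Theta>) \<partial>M)" by simp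
    also have "(\<integral>z. (\<integral>t. norm (H t z) powr p \<partial>\<Theta>) \<partial>M) = (\<integral>t. (\<integral>z. norm (H t z) powr p \<partial>M) \<partial>\<Theta>)"
      using TM.Fubini_integral[of "\<lambda>t z. norm (H t z) powr p"] intp by (simp add: case_prod_unfold)
    also have "\<dots> \<le> (\<integral>t. K * I \<partial>\<Theta>)"
    proof (rule integral_mono_AE)
      show "integrable \<Theta> (\<lambda>t. \<integral>z. norm (H t z) powr p \<partial>M)"
        using TM.integrable_fst[of "\<lambda>t z. norm (H t z) powr p"] intp by (simp add: case_prod_unfold)
      have "AE t in \<Theta>. \<forall>n\<in>freqs. n \<noteq> 0 \<longrightarrow> dir_form a t n \<noteq> 0"
        unfolding \<Theta>_def using dir_form_generic[OF a] by (subst AE_restrict_space_iff) auto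
      then show "AE t in \<Theta>. (\<integral>z. norm (H t z) powr p \<partial>M) \<le> K * I"
        by eventually_elim (unfold H_def I_def, intro K(2) linear_dir_form S, blast)
    qed simp
    also have "\<dots> = 2 * pi * K * I" by (simp add: mT)
    finally have fin: "norm dir_const powr p * (\<integral>z. norm (trig S (\<lambda>n. riesz_symbol a n * b n) z) powr p \<partial>M) \<le> (2 * pi) powr (p - 1) * (2 * pi * K * I)"
      by simp
    have "0 < norm dir_const powr p" using dir_const_nonzero by simp
    then show ?thesis using fin by (simp add: C_def I_def field_simps)
  qed
  have "0 \<le> C" using K by (simp add: C_def)
  with main show thesis using that by blast
qed

text \<open>Away from zero this is \<open>cnj n / freq_map a n\<close>, the symbol that recovers \<open>u\<^bsub>z\<^esub>\<close> from \<open>u\<^bsub>zbar\<^esub> - a u\<^bsub>z\<^esub>\<close>; for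
\<open>a = 0\<close> it is the symbol of the Beurling transform. It is written as an affine function of
\<open>(riesz_symbol a n)\<^sup>2\<close> so that its boundedness is evident.\<close>

definition beurling_symbol :: "complex \<Rightarrow> complex \<Rightarrow> complex" where
  "beurling_symbol a n = (cnj a + (riesz_symbol a n)\<^sup>2) / of_real (1 - (norm a)\<^sup>2)"

text \<open>Since \<open>(riesz_symbol a n)\<^sup>2 = cnj N / N\<close> with \<open>N = freq_map a n\<close>, the claim is that \<open>cnj n\<close> is a linear combination of \<open>N\<close> and
\<open>cnj N\<close>.\<close>

lemma beurling_symbol_eq:
  assumes a: "norm a < 1" and n: "n \<noteq> 0"
  shows "beurling_symbol a n * freq_map a n = cnj n"
proof -
  have N: "freq_map a n \<noteq> 0" by (rule freq_map_nonzero[OF assms])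
  have a2: "(norm a)\<^sup>2 < 1" using a by (simp add: abs_square_less_1)
  have "(riesz_symbol a n)\<^sup>2 * freq_map a n = cnj (freq_map a n) * (cnj (freq_map a n) * freq_map a n) / (of_real (norm (freq_map a n)))\<^sup>2"
    by (simp add: riesz_symbol_def power2_eq_square)
  also have "cnj (freq_map a n) * freq_map a n = (of_real (norm (freq_map a n)))\<^sup>2"
    by (metis complex_norm_square mult.commute of_real_power)
  finally have "(riesz_symbol a n)\<^sup>2 * freq_map a n = cnj (freq_map a n)" using N by simp
  then have "(cnj a + (riesz_symbol a n)\<^sup>2) * freq_map a n = cnj a * freq_map a n + cnj (freq_map a n)" by (simp add: distrib_right)
  also have "\<dots> = cnj n - (a * cnj a) * cnj n" by (simp add: freq_map_def algebra_simps)
  also have "a * cnj a = of_real ((norm a)\<^sup>2)" by (simp only: complex_norm_square)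
  finally have "(cnj a + (riesz_symbol a n)\<^sup>2) * freq_map a n = of_real (1 - (norm a)\<^sup>2) * cnj n" by (simp add: algebra_simps)
  moreover have "1 - (norm a)\<^sup>2 \<noteq> 0" using a2 by simp
  then have "complex_of_real (1 - (norm a)\<^sup>2) \<noteq> 0" by (simp only: of_real_eq_0_iff not_False_eq_True)
  ultimately show ?thesis by (simp add: beurling_symbol_def del: of_real_diff of_real_power)
qed

lemma beurling_symbol_even: "beurling_symbol a (- n) = beurling_symbol a n"
proof -
  have "freq_map a (- n) = - freq_map a n" by (simp add: freq_map_def)
  then show ?thesis by (simp add: beurling_symbol_def riesz_symbol_def)
qed

lemma beurling_symbol_multiplier_bound:
  assumes a: "norm a < 1" and p: "1 < p" "p \<le> 2"
  obtains K where "0 \<le> K"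
    "\<And>S b. finite S \<Longrightarrow> S \<subseteq> freqs \<Longrightarrow>
       (\<integral>z. norm (trig S (\<lambda>n. beurling_symbol a n * b n) z) powr p \<partial>M) \<le> K * (\<integral>z. norm (trig S b z) powr p \<partial>M)"
proof -
  obtain K where K: "0 \<le> K" "\<And>S b. finite S \<Longrightarrow> S \<subseteq> freqs \<Longrightarrow>
       (\<integral>z. norm (trig S (\<lambda>n. riesz_symbol a n * b n) z) powr p \<partial>M) \<le> K * (\<integral>z. norm (trig S b z) powr p \<partial>M)"
    using riesz_symbol_multiplier_bound[OF a p] by blast
  define D where "D = norm (complex_of_real (1 / (1 - (norm a)\<^sup>2))) powr p"
  define C where "C = D * (2 powr p * (norm a powr p + K * K))"
  have "(\<integral>z. norm (trig S (\<lambda>n. beurling_symbol a n * b n) z) powr p \<partial>M) \<le> C * (\<integral>z. norm (trig S b z) powr p \<partial>M)"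
    if S: "finite S" "S \<subseteq> freqs" for S b
  proof -
    define I where "I = (\<integral>z. norm (trig S b z) powr p \<partial>M)"
    define R where "R = (\<lambda>z. trig S (\<lambda>n. riesz_symbol a n * (riesz_symbol a n * b n)) z)"
    have int: "integrable M (\<lambda>z. norm (trig S b z) powr p)" for b using p by (intro trig_norm_powr_integrable) auto
    have RI: "(\<integral>z. norm (R z) powr p \<partial>M) \<le> K * K * I"
      using K(2)[OF S, of "\<lambda>n. riesz_symbol a n * b n"] mult_left_mono[OF K(2)[OF S, of b] K(1)]
      by (simp add: R_def I_def)
    have eq: "trig S (\<lambda>n. beurling_symbol a n * b n) z = of_real (1 / (1 - (norm a)\<^sup>2)) * (cnj a * trig S b z + R z)" for z
      by (simp add: R_def trig_cmult beurling_symbol_def trig_def sum_distrib_left sum.distrib[symmetric] field_simps power2_eq_square)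
    have "norm (trig S (\<lambda>n. beurling_symbol a n * b n) z) powr p \<le> D * (2 powr p * (norm a powr p * norm (trig S b z) powr p + norm (R z) powr p))" for z
      unfolding eq norm_mult using norm_add_powr_le[of p "cnj a * trig S b z" "R z"] p
      by (simp add: powr_mult D_def norm_mult mult_left_mono)
    then have "(\<integral>z. norm (trig S (\<lambda>n. beurling_symbol a n * b n) z) powr p \<partial>M) \<le>
       (\<integral>z. D * (2 powr p * (norm a powr p * norm (trig S b z) powr p + norm (R z) powr p)) \<partial>M)"
      using int unfolding R_def by (intro integral_mono) auto
    also have "\<dots> = D * (2 powr p * (norm a powr p * I + (\<integral>z. norm (R z) powr p \<partial>M)))"
      using int unfolding R_def I_def by simp
    also have "\<dots> \<le> D * (2 powr p * (norm a powr p * I + K * K * I))"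
      using RI by (intro mult_left_mono add_mono) (auto simp: D_def)
    also have "\<dots> = C * I" by (simp add: C_def algebra_simps)
    finally show ?thesis by (simp add: I_def)
  qed
  moreover have "0 \<le> C" by (simp add: C_def D_def K)
  ultimately show thesis using that by blast
qed

end

section \<open>Calculus of smooth test functions\<close>

lemma Ck_Suc_imp: "Ck (Suc n) \<phi> \<Longrightarrow> Ck n \<phi>"
proof (induction n arbitrary: \<phi>)
  case 0
  then show ?case
    by (auto intro!: continuous_at_imp_continuous_on differentiable_imp_continuous_within)
next
  case (Suc n)
  then show ?case by (metis Ck.simps(2))
qed

lemma Ck_const: "Ck n (\<lambda>_. k)"
  by (induction n arbitrary: k) (auto simp: frechet_derivative_const)

lemma Ck_add: "Ck n \<phi> \<Longrightarrow> Ck n \<psi> \<Longrightarrow> Ck n (\<lambda>z. \<phi> z + \<psi> z)"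
proof (induction n arbitrary: \<phi> \<psi>)
  case 0
  then show ?case by (auto intro: continuous_intros)
next
  case (Suc n)
  have "((\<lambda>z. \<phi> z + \<psi> z) has_derivative (\<lambda>v. frechet_derivative \<phi> (at z) v + frechet_derivative \<psi> (at z) v)) (at z)" for z
    using Suc.prems by (intro has_derivative_add) (auto simp: frechet_derivative_works[symmetric])
  then have "frechet_derivative (\<lambda>z. \<phi> z + \<psi> z) (at z) = (\<lambda>v. frechet_derivative \<phi> (at z) v + frechet_derivative \<psi> (at z) v)" for z
    by (rule frechet_derivative_at[symmetric])
  then show ?case using Suc by simp
qed

lemma Ck_mult: "Ck n \<phi> \<Longrightarrow> Ck n \<psi> \<Longrightarrow> Ck n (\<lambda>z. \<phi> z * \<psi> z)"
proof (induction n arbitrary: \<phi> \<psi>)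
  case 0
  then show ?case by (auto intro: continuous_intros)
next
  case (Suc n)
  have "((\<lambda>z. \<phi> z * \<psi> z) has_derivative (\<lambda>v. \<phi> z * frechet_derivative \<psi> (at z) v + frechet_derivative \<phi> (at z) v * \<psi> z)) (at z)" for z
    using Suc.prems by (intro has_derivative_mult) (auto simp: frechet_derivative_works[symmetric])
  then have D: "frechet_derivative (\<lambda>z. \<phi> z * \<psi> z) (at z) = (\<lambda>v. \<phi> z * frechet_derivative \<psi> (at z) v + frechet_derivative \<phi> (at z) v * \<psi> z)" for z
    by (rule frechet_derivative_at[symmetric])
  have "Ck n (\<lambda>z. \<phi> z * frechet_derivative \<psi> (at z) v + frechet_derivative \<phi> (at z) v * \<psi> z)" for v
    using Suc.prems Ck_Suc_imp[of n \<phi>] Ck_Suc_imp[of n \<psi>] by (intro Ck_add Suc.IH) (auto simp del: Ck.simps simp: Ck.simps(2)[of n])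
  then show ?case using Suc.prems by (simp add: D differentiable_mult)
qed

lemma inner_chain_derivative:
  assumes "DERIV g (z \<bullet> w) :> d"
  shows "((\<lambda>z. g (z \<bullet> w)) has_derivative (\<lambda>v. d * (v \<bullet> w))) (at z)"
proof -
  have "((\<lambda>z. z \<bullet> w) has_derivative (\<lambda>v. v \<bullet> w)) (at z)" by (rule has_derivative_inner_left) simp
  then show ?thesis
    using has_derivative_compose[of "\<lambda>z. z \<bullet> w" "\<lambda>v. v \<bullet> w" z UNIV g "(*) d"] assms
    by (simp add: has_field_derivative_def)
qed

text \<open>All test functions needed below are products of functions of a single linear form \<open>z \<bullet> w\<close>. For such functions
iterated Frechet derivatives reduce to a sequence \<open>g\<close> of iterated ordinary derivatives.\<close>

lemma Ck_ridge:
  assumes g: "\<And>j x. DERIV (g j) x :> g (Suc j) x"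
  shows "Ck n (\<lambda>z. g j (z \<bullet> w))"
proof (induction n arbitrary: j)
  case 0
  have "continuous_on UNIV (g j)"
    by (intro continuous_at_imp_continuous_on ballI) (rule DERIV_isCont[OF g])
  then show ?case
    by (auto intro!: continuous_on_compose2[of UNIV "g j" UNIV] continuous_intros)
next
  case (Suc n)
  have d: "((\<lambda>z. g j (z \<bullet> w)) has_derivative (\<lambda>v. g (Suc j) (z \<bullet> w) * (v \<bullet> w))) (at z)" for z
    by (rule inner_chain_derivative[OF g])
  then have D: "frechet_derivative (\<lambda>z. g j (z \<bullet> w)) (at z) = (\<lambda>v. g (Suc j) (z \<bullet> w) * (v \<bullet> w))" for z
    by (rule frechet_derivative_at[symmetric])
  have "(\<lambda>z. g j (z \<bullet> w)) differentiable (at z)" for z using d by (rule differentiableI)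
  then show ?case using Suc by (simp add: D Ck_mult Ck_const)
qed

lemma Ck_cos_ridge: "Ck n (\<lambda>z. cos (z \<bullet> w + t))"
proof -
  have "DERIV (\<lambda>x. cos (x + t + real j * (pi/2))) x :> cos (x + t + real (Suc j) * (pi/2))" for j x
  proof -
    have "cos (x + t + real (Suc j) * (pi/2)) = cos ((x + t + real j * (pi/2)) + pi/2)"
      by (simp add: distrib_right add_divide_distrib algebra_simps)
    then have "cos (x + t + real (Suc j) * (pi/2)) = - sin (x + t + real j * (pi/2))" by (simp add: cos_add)
    then show ?thesis by (auto intro!: derivative_eq_intros)
  qed
  from Ck_ridge[of "\<lambda>j x. cos (x + t + real j * (pi/2))", OF this, where n=n and j=0 and w=w] show ?thesis by simp
qed

lemma Ck_inner: "Ck n (\<lambda>z. z \<bullet> w)"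
proof -
  define g :: "nat \<Rightarrow> real \<Rightarrow> real" where "g j x = (if j = 0 then x else if j = 1 then 1 else 0)" for j x
  have "DERIV (g j) x :> g (Suc j) x" for j x
    unfolding g_def by (cases "j = 0"; cases "j = 1") (auto intro!: derivative_eq_intros)
  from Ck_ridge[of g, OF this, where n=n and j=0 and w=w] show ?thesis by (simp add: g_def)
qed

lemma Ck_cmult: "Ck n \<phi> \<Longrightarrow> Ck n (\<lambda>z. k * \<phi> z)" by (intro Ck_mult Ck_const)

section \<open>Diagonalising a constant coefficient elliptic operator\<close>

text \<open>With \<open>B = u\<^bsub>zbar\<^esub>\<close>, \<open>A = u\<^bsub>z\<^esub>\<close> and \<open>k = B - a A - b cnj A\<close>, the function \<open>u - \<beta> cnj u\<close> has \<open>z\<close>-derivative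
\<open>A - \<beta> cnj B\<close> and \<open>zbar\<close>-derivative \<open>B - \<beta> cnj A\<close>, and the two identities say exactly that
\<open>(B - \<beta> cnj A) - a' (A - \<beta> cnj B) = k + a' \<beta> cnj k\<close>. Inserting \<open>\<beta> = s b\<close> with real \<open>s\<close> leaves the quadratic
equation \<open>1 - s D + s\<^sup>2 |b|\<^sup>2 = 0\<close>; its smaller root has \<open>s |b| < 1\<close> because \<open>2 |b| < D\<close>, which is
ellipticity.\<close>

lemma ellipticity_diagonal:
  fixes a b :: complex
  assumes ab: "norm a + norm b < 1"
  obtains \<beta> a' where "norm \<beta> < 1" "norm a' < 1" "a = a' * (1 - \<beta> * cnj b)" "\<beta> = b + a' * \<beta> * cnj a"
proof -
  define D where "D = 1 + (norm b)\<^sup>2 - (norm a)\<^sup>2"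
  have "(norm a)\<^sup>2 < (1 - norm b)\<^sup>2" using ab by (intro power_strict_mono) auto
  then have D: "2 * norm b < D" by (simp add: D_def power2_eq_square algebra_simps)
  have D0: "0 < D" using D norm_ge_zero[of b] by linarith
  have "(2 * norm b)\<^sup>2 < D\<^sup>2" using D by (intro power_strict_mono) auto
  then have disc: "0 < D\<^sup>2 - 4 * (norm b)\<^sup>2" by (simp add: power_mult_distrib)
  define R where "R = sqrt (D\<^sup>2 - 4 * (norm b)\<^sup>2)"
  have R: "0 < R" "R\<^sup>2 = D\<^sup>2 - 4 * (norm b)\<^sup>2" using disc by (auto simp: R_def)
  \<comment> \<open>the smaller root in rationalised form, which also covers \<open>b = 0\<close>\<close>
  define s where "s = 2 / (D + R)"
  have DR: "0 < D + R" using D0 R by simp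
  have s0: "0 < s" using DR by (simp add: s_def)
  have quad: "1 - s * D + s\<^sup>2 * (norm b)\<^sup>2 = 0"
  proof -
    have sX: "s * (D + R) = 2" unfolding s_def using DR by (intro nonzero_eq_divide_eq[THEN iffD1]) auto
    have "(D + R)\<^sup>2 * (1 - s * D + s\<^sup>2 * (norm b)\<^sup>2) =
        (D + R)\<^sup>2 - (s * (D + R)) * D * (D + R) + (s * (D + R))\<^sup>2 * (norm b)\<^sup>2"
      by (simp add: power2_eq_square algebra_simps)
    also have "\<dots> = (D + R)\<^sup>2 - 2 * D * (D + R) + 4 * (norm b)\<^sup>2"
      unfolding sX by simp
    also have "\<dots> = R\<^sup>2 - D\<^sup>2 + 4 * (norm b)\<^sup>2" by (simp add: power2_eq_square algebra_simps)
    also have "\<dots> = 0" by (simp add: R)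
    finally show ?thesis using DR by simp
  qed
  have sb: "s * norm b < 1" using D DR R by (simp add: s_def field_simps)
  define \<delta> where "\<delta> = 1 - s * (norm b)\<^sup>2"
  have "s * norm b * norm b \<le> 1 * norm b" using sb by (intro mult_right_mono) auto
  then have \<delta>: "norm a < \<delta>" using ab by (simp add: \<delta>_def power2_eq_square mult.assoc)
  have \<delta>0: "0 < \<delta>" using \<delta> norm_ge_zero[of a] by linarith
  define \<beta> where "\<beta> = of_real s * b"
  define a' where "a' = a / of_real \<delta>"
  have bb: "b * cnj b = of_real ((norm b)\<^sup>2)" and aa: "a * cnj a = of_real ((norm a)\<^sup>2)"
    by (simp_all only: complex_norm_square)
  have 1: "1 - \<beta> * cnj b = of_real \<delta>"
    by (simp add: \<beta>_def \<delta>_def mult.assoc bb)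
  show thesis
  proof (rule that[of \<beta> a'])
    show "norm \<beta> < 1" using sb s0 by (simp add: \<beta>_def norm_mult)
    show "norm a' < 1" using \<delta> \<delta>0 by (simp add: a'_def norm_divide)
    show "a = a' * (1 - \<beta> * cnj b)" unfolding 1 using \<delta>0 by (simp add: a'_def)
    have "s * \<delta> = \<delta> + s * (norm a)\<^sup>2"
      using quad by (simp add: \<delta>_def D_def power2_eq_square algebra_simps)
    then have "s = 1 + s * (norm a)\<^sup>2 / \<delta>" using \<delta>0 by (simp add: field_simps)
    then have "complex_of_real s = 1 + of_real s * of_real ((norm a)\<^sup>2) / of_real \<delta>"
      by (metis of_real_1 of_real_add of_real_divide of_real_mult)
    then have \<beta>: "\<beta> = (1 + of_real s * (a * cnj a) / of_real \<delta>) * b"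
      unfolding aa \<beta>_def by (rule arg_cong)
    have "b + a' * \<beta> * cnj a = (1 + of_real s * (a * cnj a) / of_real \<delta>) * b"
      by (simp add: a'_def \<beta>_def algebra_simps)
    with \<beta> show "\<beta> = b + a' * \<beta> * cnj a" by (simp only:)
  qed
qed

context square begin

section \<open>Duality and regularity for the linear equation\<close>

text \<open>Bounded measurable functions are limits of uniformly bounded trigonometric polynomials, and \<open>v\<close> is
integrable, so dominated convergence extends the bound.\<close>

lemma duality_bounded:
  assumes r: "1 < r" and v: "integrable M v" and C: "0 \<le> C"
    and bound: "\<And>S a. finite S \<Longrightarrow> S \<subseteq> freqs \<Longrightarrow>
      norm (\<integral>z. v z * trig S a z \<partial>M) \<le> C * (\<integral>z. norm (trig S a z) powr r \<partial>M) powr (1/r)"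
    and \<phi>: "\<phi> \<in> borel_measurable M" "\<And>z. norm (\<phi> z) \<le> B"
  shows "norm (\<integral>z. v z * \<phi> z \<partial>M) \<le> C * (\<integral>z. norm (\<phi> z) powr r \<partial>M) powr (1/r)"
proof -
  have [measurable]: "v \<in> borel_measurable M" "\<phi> \<in> borel_measurable M" using v \<phi> by auto
  have tpm [measurable]: "trig S a \<in> borel_measurable M" for S a by (rule borel_measurable_M) simp
  obtain S a where S: "\<And>j::nat. finite (S j)" "\<And>j. S j \<subseteq> freqs"
     and b: "\<And>j z. z \<in> Q \<Longrightarrow> norm (trig (S j) (a j) z) \<le> 2 * (B + 1)"
     and lim: "AE z in M. (\<lambda>j. trig (S j) (a j) z) \<longlonglongrightarrow> \<phi> z"
    using trig_approx[OF \<phi>] by blast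
  have "(\<lambda>j. \<integral>z. v z * trig (S j) (a j) z \<partial>M) \<longlonglongrightarrow> (\<integral>z. v z * \<phi> z \<partial>M)"
  proof (rule integral_dominated_convergence[where w="\<lambda>z. norm (v z) * (2 * (B + 1))"])
    show "AE z in M. (\<lambda>j. v z * trig (S j) (a j) z) \<longlonglongrightarrow> v z * \<phi> z"
      using lim by eventually_elim (intro tendsto_intros)
    show "AE z in M. norm (v z * trig (S j) (a j) z) \<le> norm (v z) * (2 * (B + 1))" for j
      by (rule AE_I2) (use b in \<open>auto simp: norm_mult intro!: mult_left_mono\<close>)
  qed (use v in \<open>auto intro: integrable_mult_left integrable_norm\<close>)
  then have 1: "(\<lambda>j. norm (\<integral>z. v z * trig (S j) (a j) z \<partial>M)) \<longlonglongrightarrow> norm (\<integral>z. v z * \<phi> z \<partial>M)"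
    by (rule tendsto_norm)
  have "(\<lambda>j. \<integral>z. norm (trig (S j) (a j) z) powr r \<partial>M) \<longlonglongrightarrow> (\<integral>z. norm (\<phi> z) powr r \<partial>M)"
  proof (rule integral_dominated_convergence[where w="\<lambda>z. (2 * (B + 1)) powr r"])
    show "AE z in M. (\<lambda>j. norm (trig (S j) (a j) z) powr r) \<longlonglongrightarrow> norm (\<phi> z) powr r"
      using lim by eventually_elim (use r in \<open>auto intro!: tendsto_powr' tendsto_norm\<close>)
    show "AE z in M. norm (norm (trig (S j) (a j) z) powr r) \<le> (2 * (B + 1)) powr r" for j
      by (rule AE_I2) (use b r in \<open>auto intro!: powr_mono2\<close>)
  qed auto
  then have "(\<lambda>j. C * (\<integral>z. norm (trig (S j) (a j) z) powr r \<partial>M) powr (1/r)) \<longlonglongrightarrow> C * (\<integral>z. norm (\<phi> z) powr r \<partial>M) powr (1/r)"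
    using r by (intro tendsto_mult tendsto_powr') auto
  then show ?thesis by (rule LIMSEQ_le[OF 1]) (use bound S in auto)
qed

text \<open>Test against \<open>cnj (sgn v) |v| powr (q - 1)\<close> on the set where \<open>|v| \<le> N\<close>. Writing \<open>I\<close> for the integral
of \<open>|v| powr q\<close> over that set, the bound reads \<open>I \<le> C * I powr (1/r)\<close>, so \<open>I \<le> C powr q\<close>; let \<open>N\<close> grow. Only integrability of
\<open>v\<close> is presupposed, and that is what makes the estimates below improve regularity.\<close>

lemma Lp_by_duality:
  assumes qr: "1 < q" "1 < r" "1/q + 1/r = 1" and v: "integrable M v" and C: "0 \<le> C"
    and bound: "\<And>S a. finite S \<Longrightarrow> S \<subseteq> freqs \<Longrightarrow>
      norm (\<integral>z. v z * trig S a z \<partial>M) \<le> C * (\<integral>z. norm (trig S a z) powr r \<partial>M) powr (1/r)"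
  shows "Lp M q v" and "(\<integral>z. norm (v z) powr q \<partial>M) \<le> C powr q"
proof -
  have vm [measurable]: "v \<in> borel_measurable M" using v by auto
  have qr': "(q - 1) * r = q" using qr by (simp add: field_simps)
  define f where "f N z = (if norm (v z) \<le> real N then norm (v z) powr q else 0)" for N z
  have [measurable]: "f N \<in> borel_measurable M" for N unfolding f_def[abs_def] by measurable
  have fb: "norm (f N z) \<le> real N powr q" for N z using qr by (auto simp: f_def intro: powr_mono2)
  have fi: "integrable M (f N)" for N by (rule integrable_M_bounded[OF _ fb]) simp
  have est: "(\<integral>z. f N z \<partial>M) \<le> C powr q" for N
  proof -
    \<comment> \<open>the extremal function in Hoelder's inequality, truncated so as to be bounded\<close>
    define \<phi> where "\<phi> z = (if norm (v z) \<le> real N then cnj (sgn (v z)) * of_real (norm (v z) powr (q - 1)) else 0)" for z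
    have cnjm: "cnj \<in> borel_measurable borel" by (intro borel_measurable_continuous_onI continuous_intros)
    have [measurable]: "(\<lambda>z. cnj (sgn (v z))) \<in> borel_measurable M"
      using measurable_compose[OF _ cnjm, of "\<lambda>z. sgn (v z)" M] by simp
    have pm: "\<phi> \<in> borel_measurable M" unfolding \<phi>_def[abs_def] by measurable
    have n\<phi>: "norm (\<phi> z) = (if norm (v z) \<le> real N then norm (v z) powr (q - 1) else 0)" for z
      using qr by (auto simp: \<phi>_def norm_mult norm_sgn)
    have pb: "norm (\<phi> z) \<le> real N powr (q - 1)" for z
      unfolding n\<phi> using qr by (auto intro: powr_mono2)
    have v\<phi>: "v z * \<phi> z = of_real (f N z)" for z
    proof (cases "v z = 0")
      case False
      have "v z * cnj (sgn (v z)) = of_real (norm (v z))"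
        using False by (simp add: sgn_div_norm scaleR_conv_of_real complex_norm_square[symmetric] power2_eq_square field_simps)
      then have "v z * (cnj (sgn (v z)) * of_real (norm (v z) powr (q - 1))) = of_real (norm (v z) * norm (v z) powr (q - 1))"
        by (metis mult.assoc of_real_mult)
      also have "norm (v z) * norm (v z) powr (q - 1) = norm (v z) powr q"
        using False by (simp add: powr_mult_base)
      finally show ?thesis by (simp add: \<phi>_def f_def)
    qed (auto simp: \<phi>_def f_def)
    have \<phi>r: "norm (\<phi> z) powr r = f N z" for z
      unfolding n\<phi> f_def using qr by (simp add: powr_powr qr')
    define I where "I = (\<integral>z. f N z \<partial>M)"
    have I0: "0 \<le> I" unfolding I_def by (intro integral_nonneg_AE AE_I2) (auto simp: f_def)
    have "norm (\<integral>z. v z * \<phi> z \<partial>M) \<le> C * (\<integral>z. norm (\<phi> z) powr r \<partial>M) powr (1/r)"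
      by (rule duality_bounded[OF qr(2) v C bound pm pb])
    then have le: "I \<le> C * I powr (1/r)" using I0 by (simp add: v\<phi> \<phi>r I_def)
    have "I \<le> C powr q"
    proof (cases "I = 0")
      case False
      then have Ip: "0 < I" using I0 by simp
      have "I = I powr (1/q) * I powr (1/r)" using Ip qr by (simp add: powr_add[symmetric])
      then have "I powr (1/q) * I powr (1/r) \<le> C * I powr (1/r)" using le by simp
      then have "I powr (1/q) \<le> C" using Ip by simp
      then have "(I powr (1/q)) powr q \<le> C powr q" using qr by (intro powr_mono2) auto
      then show ?thesis using Ip qr by (simp add: powr_powr)
    qed simp
    then show ?thesis by (simp add: I_def)
  qed
  have mono: "mono (\<lambda>N. f N z)" for z by (rule monoI) (auto simp: f_def)
  have lim: "(\<lambda>N. f N z) \<longlonglongrightarrow> norm (v z) powr q" for z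
  proof (rule tendsto_eventually)
    obtain N0 :: nat where "norm (v z) \<le> real N0" using real_arch_simple by blast
    then show "\<forall>\<^sub>F N in sequentially. f N z = norm (v z) powr q"
      by (intro eventually_sequentiallyI[of N0]) (auto simp: f_def)
  qed
  have inc: "incseq (\<lambda>N. \<integral>z. f N z \<partial>M)"
    by (rule incseq_SucI, rule integral_mono) (use fi mono in \<open>auto simp: mono_def\<close>)
  obtain x where x: "(\<lambda>N. \<integral>z. f N z \<partial>M) \<longlonglongrightarrow> x" "\<And>N. (\<integral>z. f N z \<partial>M) \<le> x"
    using incseq_convergent[OF inc] est by blast
  have "integrable M (\<lambda>z. norm (v z) powr q)"
    by (rule integrable_monotone_convergence[OF fi _ _ x(1)]) (use mono lim in auto)
  then show "Lp M q v" by (simp add: Lp_def)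
  have "(\<integral>z. norm (v z) powr q \<partial>M) = x"
    by (rule integral_monotone_convergence[OF fi _ _ x(1)]) (use mono lim in auto)
  also have "x \<le> C powr q" by (rule LIMSEQ_le_const2[OF x(1)]) (use est in auto)
  finally show "(\<integral>z. norm (v z) powr q \<partial>M) \<le> C powr q" .
qed

lemma integrable_mult_e:
  assumes v: "integrable M v"
  shows "integrable M (\<lambda>z. v z * e n z)"
proof (rule Bochner_Integration.integrable_bound[OF v])
  show "(\<lambda>z. v z * e n z) \<in> borel_measurable M"
    by (rule borel_measurable_times[OF borel_measurable_integrable[OF v] borel_measurable_M]) simp
qed (simp add: norm_mult)

text \<open>Uniqueness of Fourier coefficients is the duality bound with constant zero.\<close>

lemma AE_zero_by_fourier:
  assumes v: "integrable M v" and z: "\<And>n. n \<in> freqs \<Longrightarrow> (\<integral>z. v z * e n z \<partial>M) = 0"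
  shows "AE z in M. v z = 0"
proof -
  note ve = integrable_mult_e[OF v]
  have "norm (\<integral>z. v z * trig S a z \<partial>M) \<le> 0 * (\<integral>z. norm (trig S a z) powr 2 \<partial>M) powr (1/2)"
    if "finite S" "S \<subseteq> freqs" for S a
  proof -
    have "(\<integral>z. v z * trig S a z \<partial>M) = (\<integral>z. (\<Sum>n\<in>S. a n * (v z * e n z)) \<partial>M)"
      by (simp add: trig_def sum_distrib_left mult_ac)
    also have "\<dots> = (\<Sum>n\<in>S. a n * (\<integral>z. v z * e n z \<partial>M))" using ve by simp
    also have "\<dots> = 0" using that z by (auto intro!: sum.neutral)
    finally show ?thesis by simp
  qed
  note dual = Lp_by_duality[where q=2 and r=2 and C=0, OF _ _ _ v _ this]
  have L: "Lp M 2 v" by (rule dual(1)) auto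
  have "(\<integral>z. norm (v z) powr 2 \<partial>M) \<le> 0 powr 2" by (rule dual(2)) auto
  then have "(\<integral>z. norm (v z) powr 2 \<partial>M) = 0" by (intro antisym) auto
  then have "AE z in M. norm (v z) powr 2 = 0"
    using L by (subst (asm) integral_nonneg_eq_0_iff_AE) (auto simp: Lp_def)
  then show ?thesis by eventually_elim auto
qed

lemma integral_trig_mult:
  assumes "finite S" "finite S'" "S \<subseteq> freqs" "S' \<subseteq> freqs"
  shows "(\<integral>z. trig S a z * trig S' b z \<partial>M) = (\<Sum>n\<in>S. \<Sum>m\<in>S'. a n * b m * (if n + m = 0 then of_real (l\<^sup>2) else 0))"
proof -
  have "(\<integral>z. trig S a z * trig S' b z \<partial>M) = (\<integral>z. (\<Sum>n\<in>S. \<Sum>m\<in>S'. a n * b m * e (n + m) z) \<partial>M)"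
    by (simp add: trig_def sum_product e_add[symmetric] mult_ac)
  also have "\<dots> = (\<Sum>n\<in>S. \<Sum>m\<in>S'. \<integral>z. a n * b m * e (n + m) z \<partial>M)"
    by (simp add: continuous_integrable_M continuous_e)
  also have "\<dots> = (\<Sum>n\<in>S. \<Sum>m\<in>S'. a n * b m * (if n + m = 0 then of_real (l\<^sup>2) else 0))"
    using assms by (intro sum.cong refl) (auto simp: integral_e freqs_add subset_iff)
  finally show ?thesis .
qed

lemma multiplier_exchange:
  assumes "finite S" "finite S'" "S \<subseteq> freqs" "S' \<subseteq> freqs" and even: "\<And>n. m (- n) = m n"
  shows "(\<integral>z. trig S (\<lambda>n. m n * a n) z * trig S' b z \<partial>M) = (\<integral>z. trig S a z * trig S' (\<lambda>n. m n * b n) z \<partial>M)"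
  unfolding integral_trig_mult[OF assms(1-4)]
proof (intro sum.cong refl)
  fix x y
  show "m x * a x * b y * (if x + y = 0 then of_real (l\<^sup>2) else 0) = a x * (m y * b y) * (if x + y = 0 then of_real (l\<^sup>2) else 0)"
    using even[of x] by (auto simp: add_eq_0_iff mult_ac)
qed

lemma trig_Lp: "0 < p \<Longrightarrow> Lp M p (trig S a)"
  by (simp add: Lp_def trig_norm_powr_integrable borel_measurable_M)

text \<open>For \<open>p > 2\<close> the bound at the conjugate exponent is transposed; the symbol is even, so the multiplier is its own
transpose.\<close>

lemma beurling_symbol_multiplier_bound_all:
  assumes a: "norm a < 1" and p: "1 < p"
  obtains K where "0 \<le> K"
    "\<And>S b. finite S \<Longrightarrow> S \<subseteq> freqs \<Longrightarrow>
       (\<integral>z. norm (trig S (\<lambda>n. beurling_symbol a n * b n) z) powr p \<partial>M) \<le> K * (\<integral>z. norm (trig S b z) powr p \<partial>M)"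
proof (cases "p \<le> 2")
  case True
  then show thesis using beurling_symbol_multiplier_bound[OF a p] that by blast
next
  case False
  define r where "r = p / (p - 1)"
  have r: "1 < r" "r \<le> 2" "1/p + 1/r = 1" using p False by (auto simp: r_def field_simps)
  obtain K where K: "0 \<le> K" "\<And>S b. finite S \<Longrightarrow> S \<subseteq> freqs \<Longrightarrow>
       (\<integral>z. norm (trig S (\<lambda>n. beurling_symbol a n * b n) z) powr r \<partial>M) \<le> K * (\<integral>z. norm (trig S b z) powr r \<partial>M)"
    using beurling_symbol_multiplier_bound[OF a r(1,2)] by blast
  have "(\<integral>z. norm (trig S (\<lambda>n. beurling_symbol a n * b n) z) powr p \<partial>M) \<le> K powr (1/r * p) * (\<integral>z. norm (trig S b z) powr p \<partial>M)"
    if S: "finite S" "S \<subseteq> freqs" for S b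
  proof -
    define I where "I = (\<integral>z. norm (trig S b z) powr p \<partial>M)"
    have I0: "0 \<le> I" by (simp add: I_def)
    define C where "C = I powr (1/p) * K powr (1/r)"
    have "(\<integral>z. norm (trig S (\<lambda>n. beurling_symbol a n * b n) z) powr p \<partial>M) \<le> C powr p"
    proof (rule Lp_by_duality(2)[OF p r(1) r(3)])
      show "integrable M (trig S (\<lambda>n. beurling_symbol a n * b n))" by (intro continuous_integrable_M continuous_trig)
      fix S' b' assume S': "finite S'" "S' \<subseteq> freqs"
      define I' where "I' = (\<integral>z. norm (trig S' b' z) powr r \<partial>M)"
      have "norm (\<integral>z. trig S (\<lambda>n. beurling_symbol a n * b n) z * trig S' b' z \<partial>M) = norm (\<integral>z. trig S b z * trig S' (\<lambda>n. beurling_symbol a n * b' n) z \<partial>M)"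
        by (simp only: multiplier_exchange[OF S(1) S'(1) S(2) S'(2), where m="beurling_symbol a", OF beurling_symbol_even])
      also have "\<dots> \<le> (\<integral>z. norm (trig S b z * trig S' (\<lambda>n. beurling_symbol a n * b' n) z) \<partial>M)" by (rule integral_norm_bound)
      also have "\<dots> \<le> I powr (1/p) * (\<integral>z. norm (trig S' (\<lambda>n. beurling_symbol a n * b' n) z) powr r \<partial>M) powr (1/r)"
        unfolding I_def using p r by (intro Hoelder trig_Lp) auto
      also have "\<dots> \<le> I powr (1/p) * (K * I') powr (1/r)"
        using K(2)[OF S', of b'] r by (intro mult_left_mono powr_mono2) (auto simp: I'_def)
      also have "\<dots> = C * I' powr (1/r)"
        using K(1) by (simp add: C_def powr_mult I'_def)
      finally show "norm (\<integral>z. trig S (\<lambda>n. beurling_symbol a n * b n) z * trig S' b' z \<partial>M) \<le> C * (\<integral>z. norm (trig S' b' z) powr r \<partial>M) powr (1/r)"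
        by (simp add: I'_def)
    qed (simp add: C_def)
    also have "C powr p = K powr (1/r * p) * I"
      using I0 K(1) p by (simp add: C_def powr_mult powr_powr mult.commute)
    finally show ?thesis by (simp add: I_def)
  qed
  then show thesis using that[of "K powr (1/r * p)"] by simp
qed

text \<open>The hypothesis on Fourier coefficients transposes to \<open>\<integral> u \<phi> = \<integral> k (T \<phi>)\<close> for trigonometric polynomials
\<open>\<phi>\<close>, where \<open>T\<close> is the multiplier operator; then Hoelder's inequality and duality apply.\<close>

lemma Lp_of_multiplier:
  assumes a: "norm a < 1" and q: "1 < q" and u: "integrable M u" and k: "Lp M q k"
    and fourier: "\<And>n. n \<in> freqs \<Longrightarrow> (\<integral>z. u z * e n z \<partial>M) = beurling_symbol a n * (\<integral>z. k z * e n z \<partial>M)"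
  shows "Lp M q u"
proof -
  define r where "r = q / (q - 1)"
  have r: "1 < r" "1/q + 1/r = 1" using q by (auto simp: r_def field_simps)
  obtain K where K: "0 \<le> K" "\<And>S b. finite S \<Longrightarrow> S \<subseteq> freqs \<Longrightarrow>
       (\<integral>z. norm (trig S (\<lambda>n. beurling_symbol a n * b n) z) powr r \<partial>M) \<le> K * (\<integral>z. norm (trig S b z) powr r \<partial>M)"
    using beurling_symbol_multiplier_bound_all[OF a r(1)] by blast
  define I where "I = (\<integral>z. norm (k z) powr q \<partial>M)"
  define C where "C = I powr (1/q) * K powr (1/r)"
  have "Lp M 1 k" by (rule Lp_mono[OF finite_M k]) (use q in auto)
  then have ki: "integrable M k" by (simp add: Lp_1_iff)
  have pair: "(\<integral>z. v z * trig S b z \<partial>M) = (\<Sum>n\<in>S. b n * (\<integral>z. v z * e n z \<partial>M))" if "integrable M v" for v S b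
  proof -
    have "(\<integral>z. v z * trig S b z \<partial>M) = (\<integral>z. (\<Sum>n\<in>S. b n * (v z * e n z)) \<partial>M)"
      by (simp add: trig_def sum_distrib_left mult_ac)
    also have "\<dots> = (\<Sum>n\<in>S. b n * (\<integral>z. v z * e n z \<partial>M))" using integrable_mult_e[OF that] by simp
    finally show ?thesis .
  qed
  show ?thesis
  proof (rule Lp_by_duality(1)[OF q r u])
    fix S b assume S: "finite S" "S \<subseteq> freqs"
    define I' where "I' = (\<integral>z. norm (trig S b z) powr r \<partial>M)"
    have "(\<integral>z. u z * trig S b z \<partial>M) = (\<integral>z. k z * trig S (\<lambda>n. beurling_symbol a n * b n) z \<partial>M)"
      unfolding pair[OF u] pair[OF ki] using S fourier by (intro sum.cong refl) (auto simp: subset_iff)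
    then have "norm (\<integral>z. u z * trig S b z \<partial>M) \<le> (\<integral>z. norm (k z * trig S (\<lambda>n. beurling_symbol a n * b n) z) \<partial>M)"
      by (simp only: integral_norm_bound)
    also have "\<dots> \<le> I powr (1/q) * (\<integral>z. norm (trig S (\<lambda>n. beurling_symbol a n * b n) z) powr r \<partial>M) powr (1/r)"
      unfolding I_def using q r k by (intro Hoelder trig_Lp) auto
    also have "\<dots> \<le> I powr (1/q) * (K * I') powr (1/r)"
      using K(2)[OF S, of b] r by (intro mult_left_mono powr_mono2) (auto simp: I'_def)
    also have "\<dots> = C * I' powr (1/r)"
      using K(1) by (simp add: C_def powr_mult I'_def)
    finally show "norm (\<integral>z. u z * trig S b z \<partial>M) \<le> C * (\<integral>z. norm (trig S b z) powr r \<partial>M) powr (1/r)"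
      by (simp add: I'_def)
  qed (simp add: C_def)
qed

text \<open>Weak differentiability with a boundary condition: arbitrary smooth functions are admitted as test
functions, not only those with compact support in the square. It holds for functions that
vanish near the boundary, and it allows characters as test functions.\<close>

definition boxder :: "complex \<Rightarrow> (complex \<Rightarrow> complex) \<Rightarrow> (complex \<Rightarrow> complex) \<Rightarrow> bool" where
  "boxder v u g \<longleftrightarrow> integrable M u \<and> integrable M g \<and>
     (\<forall>\<psi>. (\<forall>n. Ck n \<psi>) \<longrightarrow>
       (\<integral>z. frechet_derivative \<psi> (at z) v *\<^sub>R u z \<partial>M) = - (\<integral>z. \<psi> z *\<^sub>R g z \<partial>M))"

lemma Ck_continuous: "(\<And>n. Ck n \<psi>) \<Longrightarrow> continuous_on UNIV \<psi>" by (metis Ck.simps(1))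

lemma integrable_mult_continuous:
  fixes u :: "complex \<Rightarrow> complex" and \<psi> :: "complex \<Rightarrow> real"
  assumes u: "integrable M u" and \<psi>: "continuous_on UNIV \<psi>"
  shows "integrable M (\<lambda>z. \<psi> z *\<^sub>R u z)"
proof -
  have "bounded (\<psi> ` Q)"
    by (intro compact_imp_bounded compact_continuous_image compact_Q continuous_on_subset[OF \<psi>]) auto
  then obtain B where B: "\<And>z. z \<in> Q \<Longrightarrow> norm (\<psi> z) \<le> B" by (auto simp: bounded_iff)
  show ?thesis
  proof (rule Bochner_Integration.integrable_bound[of _ "\<lambda>z. B * norm (u z)"])
    show "integrable M (\<lambda>z. B * norm (u z))" using u by auto
    show "(\<lambda>z. \<psi> z *\<^sub>R u z) \<in> borel_measurable M"
      using u continuous_measurable_M[OF \<psi>] by (intro borel_measurable_scaleR) auto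
    show "AE z in M. norm (\<psi> z *\<^sub>R u z) \<le> norm (B * norm (u z))"
    proof (rule AE_I2)
      fix z assume "z \<in> space M"
      then have "\<bar>\<psi> z\<bar> \<le> B" using B by simp
      then have "\<bar>\<psi> z\<bar> * norm (u z) \<le> B * norm (u z)" by (intro mult_right_mono) auto
      also have "\<dots> \<le> norm (B * norm (u z))" by simp
      finally show "norm (\<psi> z *\<^sub>R u z) \<le> norm (B * norm (u z))" by simp
    qed
  qed
qed

text \<open>Integration by parts against \<open>e n\<close>, whose derivative in the direction \<open>v\<close> is \<open>\<i> \<kappa> (n \<bullet> v) (e n)\<close>. Test functions are real, so the
real and imaginary parts of the character are treated separately.\<close>

lemma boxder_e:
  assumes "boxder v u g"
  shows "(\<integral>z. g z * e n z \<partial>M) = - (\<i> * \<kappa> * (n \<bullet> v)) * (\<integral>z. u z * e n z \<partial>M)"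
proof -
  have u: "integrable M u" and g: "integrable M g" using assms by (auto simp: boxder_def)
  define c1 c2 where "c1 z = cos (z \<bullet> (\<kappa> *\<^sub>R n) + 0)" and "c2 z = cos (z \<bullet> (\<kappa> *\<^sub>R n) + (- pi / 2))" for z
  have ck: "Ck k c1" "Ck k c2" for k unfolding c1_def[abs_def] c2_def[abs_def] by (rule Ck_cos_ridge)+
  have c2: "c2 z = sin (z \<bullet> (\<kappa> *\<^sub>R n))" for z by (simp add: c2_def cos_diff)
  have c1: "c1 z = cos (z \<bullet> (\<kappa> *\<^sub>R n))" for z by (simp add: c1_def)
  have "(c1 has_derivative (\<lambda>v. - sin (z \<bullet> (\<kappa> *\<^sub>R n)) * (v \<bullet> (\<kappa> *\<^sub>R n)))) (at z)" for z
    unfolding c1[abs_def] by (rule inner_chain_derivative) (rule DERIV_cos)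
  then have "frechet_derivative c1 (at z) = (\<lambda>v. - sin (z \<bullet> (\<kappa> *\<^sub>R n)) * (v \<bullet> (\<kappa> *\<^sub>R n)))" for z
    by (rule frechet_derivative_at[symmetric])
  then have D1: "frechet_derivative c1 (at z) v = - c2 z * (\<kappa> * (n \<bullet> v))" for z
    by (simp add: c2 inner_commute[of v])
  have "(c2 has_derivative (\<lambda>v. cos (z \<bullet> (\<kappa> *\<^sub>R n)) * (v \<bullet> (\<kappa> *\<^sub>R n)))) (at z)" for z
    unfolding c2[abs_def] by (rule inner_chain_derivative) (rule DERIV_sin)
  then have "frechet_derivative c2 (at z) = (\<lambda>v. cos (z \<bullet> (\<kappa> *\<^sub>R n)) * (v \<bullet> (\<kappa> *\<^sub>R n)))" for z
    by (rule frechet_derivative_at[symmetric])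
  then have D2: "frechet_derivative c2 (at z) v = c1 z * (\<kappa> * (n \<bullet> v))" for z
    by (simp add: c1 inner_commute[of v])
  have e: "e n z = of_real (c1 z) + \<i> * of_real (c2 z)" for z
    unfolding e_def c1 c2 by (simp add: cis.ctr complex_eq_iff inner_commute)
  have I: "integrable M (\<lambda>z. c1 z *\<^sub>R h z)" "integrable M (\<lambda>z. c2 z *\<^sub>R h z)" if "integrable M h" for h :: "complex \<Rightarrow> complex"
    using ck by (auto intro!: integrable_mult_continuous[OF that] Ck_continuous)
  have eI: "(\<integral>z. h z * e n z \<partial>M) = (\<integral>z. c1 z *\<^sub>R h z \<partial>M) + \<i> * (\<integral>z. c2 z *\<^sub>R h z \<partial>M)" if "integrable M h" for h
  proof -
    have "(\<integral>z. h z * e n z \<partial>M) = (\<integral>z. c1 z *\<^sub>R h z + \<i> * (c2 z *\<^sub>R h z) \<partial>M)"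
      by (simp add: e scaleR_conv_of_real algebra_simps)
    also have "\<dots> = (\<integral>z. c1 z *\<^sub>R h z \<partial>M) + (\<integral>z. \<i> * (c2 z *\<^sub>R h z) \<partial>M)"
      using I[OF that] by (intro Bochner_Integration.integral_add integrable_mult_right) auto
    finally show ?thesis by (simp only: integral_mult_right_zero)
  qed
  define k where "k = \<kappa> * (n \<bullet> v)"
  have 1: "(\<integral>z. c1 z *\<^sub>R g z \<partial>M) = of_real k * (\<integral>z. c2 z *\<^sub>R u z \<partial>M)"
  proof -
    have "(\<integral>z. frechet_derivative c1 (at z) v *\<^sub>R u z \<partial>M) = - (\<integral>z. c1 z *\<^sub>R g z \<partial>M)"
      using assms ck by (auto simp: boxder_def)
    moreover have "(\<integral>z. frechet_derivative c1 (at z) v *\<^sub>R u z \<partial>M) = (\<integral>z. (- of_real k) * (c2 z *\<^sub>R u z) \<partial>M)"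
      unfolding D1 by (intro Bochner_Integration.integral_cong) (auto simp: k_def scaleR_conv_of_real)
    ultimately show ?thesis by (simp only: integral_mult_right_zero) (simp add: minus_equation_iff)
  qed
  have 2: "(\<integral>z. c2 z *\<^sub>R g z \<partial>M) = - of_real k * (\<integral>z. c1 z *\<^sub>R u z \<partial>M)"
  proof -
    have "(\<integral>z. frechet_derivative c2 (at z) v *\<^sub>R u z \<partial>M) = - (\<integral>z. c2 z *\<^sub>R g z \<partial>M)"
      using assms ck by (auto simp: boxder_def)
    moreover have "(\<integral>z. frechet_derivative c2 (at z) v *\<^sub>R u z \<partial>M) = (\<integral>z. of_real k * (c1 z *\<^sub>R u z) \<partial>M)"
      unfolding D2 by (intro Bochner_Integration.integral_cong) (auto simp: k_def scaleR_conv_of_real)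
    ultimately show ?thesis by (simp only: integral_mult_right_zero) (simp add: minus_equation_iff)
  qed
  show ?thesis unfolding eI[OF g] eI[OF u] 1 2 k_def[symmetric]
    by (simp add: k_def[symmetric] algebra_simps) (simp add: k_def algebra_simps)
qed

text \<open>The \<open>L\<^sup>q\<close> estimate for \<open>u\<^bsub>zbar\<^esub> - a u\<^bsub>z\<^esub> - b cnj u\<^bsub>z\<^esub> = k\<close>. In the proof \<open>A\<close> and \<open>B\<close> are \<open>u\<^bsub>z\<^esub>\<close> and \<open>u\<^bsub>zbar\<^esub>\<close>, primes
mark the derivatives of \<open>u - \<beta> cnj u\<close>, and \<open>E\<close> and \<open>E'\<close> are the Fourier coefficients of \<open>u\<close> and of
\<open>u - \<beta> cnj u\<close>. Since \<open>|\<beta>| < 1\<close> the substitution is invertible.\<close>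

lemma boxder_regularity:
  assumes ab: "norm a + norm b < 1" and q: "1 < q"
    and x: "boxder 1 u ux" and y: "boxder \<i> u uy"
    and k: "Lp M q (\<lambda>z. (ux z + \<i> * uy z) / 2 - a * ((ux z - \<i> * uy z) / 2) - b * cnj ((ux z - \<i> * uy z) / 2))"
  shows "Lp M q ux" "Lp M q uy"
proof -
  obtain \<beta> a' where \<beta>: "norm \<beta> < 1" and a': "norm a' < 1"
    and eqs: "a = a' * (1 - \<beta> * cnj b)" "\<beta> = b + a' * \<beta> * cnj a"
    using ellipticity_diagonal[OF ab] by blast
  define A where "A z = (ux z - \<i> * uy z) / 2" for z
  define B where "B z = (ux z + \<i> * uy z) / 2" for z
  define K where "K z = B z - a * A z - b * cnj (A z)" for z
  have K: "Lp M q K" using k by (simp add: K_def[abs_def] A_def B_def)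
  have int: "integrable M u" "integrable M ux" "integrable M uy" using x y by (auto simp: boxder_def)
  have AB: "integrable M A" "integrable M B" unfolding A_def[abs_def] B_def[abs_def] using int by auto
  have cAB: "integrable M (\<lambda>z. cnj (A z))" "integrable M (\<lambda>z. cnj (B z))" using AB by auto
  define E where "E n = (\<integral>z. u z * e n z \<partial>M)" for n
  have ux: "(\<integral>z. ux z * e n z \<partial>M) = - (\<i> * \<kappa> * Re n) * E n"
    and uy: "(\<integral>z. uy z * e n z \<partial>M) = - (\<i> * \<kappa> * Im n) * E n" for n
    using boxder_e[OF x, of n] boxder_e[OF y, of n] by (simp_all add: E_def inner_complex_def)
  have Ae: "(\<integral>z. A z * e n z \<partial>M) = - (\<i> * \<kappa> / 2) * cnj n * E n" for n
  proof -
    have "(\<integral>z. A z * e n z \<partial>M) = (\<integral>z. (1/2) * (ux z * e n z) - (\<i>/2) * (uy z * e n z) \<partial>M)"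
      by (intro Bochner_Integration.integral_cong) (auto simp: A_def field_simps)
    also have "\<dots> = (1/2) * (\<integral>z. ux z * e n z \<partial>M) - (\<i>/2) * (\<integral>z. uy z * e n z \<partial>M)"
      using int by (subst Bochner_Integration.integral_diff) (auto intro!: integrable_mult_right integrable_mult_e)
    also have "\<dots> = - (\<i> * \<kappa> / 2) * (of_real (Re n) - \<i> * of_real (Im n)) * E n"
      by (simp add: ux uy algebra_simps)
    also have "of_real (Re n) - \<i> * of_real (Im n) = cnj n" by (simp add: complex_eq_iff)
    finally show ?thesis .
  qed
  have Be: "(\<integral>z. B z * e n z \<partial>M) = - (\<i> * \<kappa> / 2) * n * E n" for n
  proof -
    have "(\<integral>z. B z * e n z \<partial>M) = (\<integral>z. (1/2) * (ux z * e n z) + (\<i>/2) * (uy z * e n z) \<partial>M)"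
      by (intro Bochner_Integration.integral_cong) (auto simp: B_def field_simps)
    also have "\<dots> = (1/2) * (\<integral>z. ux z * e n z \<partial>M) + (\<i>/2) * (\<integral>z. uy z * e n z \<partial>M)"
      using int by (subst Bochner_Integration.integral_add) (auto intro!: integrable_mult_right integrable_mult_e)
    also have "\<dots> = - (\<i> * \<kappa> / 2) * (of_real (Re n) + \<i> * of_real (Im n)) * E n"
      by (simp add: ux uy add_divide_distrib diff_divide_distrib algebra_simps)
    also have "of_real (Re n) + \<i> * of_real (Im n) = n" by (simp add: complex_eq_iff)
    finally show ?thesis .
  qed
  have cnje: "(\<integral>z. cnj (h z) * e n z \<partial>M) = cnj (\<integral>z. h z * e (- n) z \<partial>M)" for h n
  proof -
    have "(\<integral>z. cnj (h z) * e n z \<partial>M) = (\<integral>z. cnj (h z * e (- n) z) \<partial>M)"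
      by (simp add: cnj_e)
    also have "\<dots> = cnj (\<integral>z. h z * e (- n) z \<partial>M)" by (rule Bochner_Integration.integral_cnj)
    finally show ?thesis .
  qed
  define A' where "A' z = A z - \<beta> * cnj (B z)" for z
  define B' where "B' z = B z - \<beta> * cnj (A z)" for z
  define E' where "E' n = E n - \<beta> * cnj (E (- n))" for n
  have A'i: "integrable M A'" and B'i: "integrable M B'"
    unfolding A'_def[abs_def] B'_def[abs_def] using AB cAB by auto
  have A'e: "(\<integral>z. A' z * e n z \<partial>M) = - (\<i> * \<kappa> / 2) * cnj n * E' n" for n
  proof -
    have "(\<integral>z. A' z * e n z \<partial>M) = (\<integral>z. A z * e n z - \<beta> * (cnj (B z) * e n z) \<partial>M)"
      by (intro Bochner_Integration.integral_cong) (auto simp: A'_def algebra_simps)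
    also have "\<dots> = (\<integral>z. A z * e n z \<partial>M) - \<beta> * (\<integral>z. cnj (B z) * e n z \<partial>M)"
      using AB cAB by (subst Bochner_Integration.integral_diff) (auto intro!: integrable_mult_right integrable_mult_e)
    also have "\<dots> = - (\<i> * \<kappa> / 2) * cnj n * E' n"
      unfolding cnje Ae Be E'_def by (simp add: add_divide_distrib diff_divide_distrib algebra_simps)
    finally show ?thesis .
  qed
  have B'e: "(\<integral>z. B' z * e n z \<partial>M) = - (\<i> * \<kappa> / 2) * n * E' n" for n
  proof -
    have "(\<integral>z. B' z * e n z \<partial>M) = (\<integral>z. B z * e n z - \<beta> * (cnj (A z) * e n z) \<partial>M)"
      by (intro Bochner_Integration.integral_cong) (auto simp: B'_def algebra_simps)
    also have "\<dots> = (\<integral>z. B z * e n z \<partial>M) - \<beta> * (\<integral>z. cnj (A z) * e n z \<partial>M)"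
      using AB cAB by (subst Bochner_Integration.integral_diff) (auto intro!: integrable_mult_right integrable_mult_e)
    also have "\<dots> = - (\<i> * \<kappa> / 2) * n * E' n"
      unfolding cnje Ae Be E'_def by (simp add: add_divide_distrib diff_divide_distrib algebra_simps)
    finally show ?thesis .
  qed
  define K' where "K' z = B' z - a' * A' z" for z
  have K'K: "K' z = K z + (a' * \<beta>) * cnj (K z)" for z
  proof -
    have "K z + (a' * \<beta>) * cnj (K z) =
        B z + (a' * \<beta>) * cnj (B z) - (a + a' * \<beta> * cnj b) * A z - (b + a' * \<beta> * cnj a) * cnj (A z)"
      by (simp add: K_def algebra_simps)
    also have "a + a' * \<beta> * cnj b = a'" using eqs(1) by (simp add: algebra_simps)
    also have "b + a' * \<beta> * cnj a = \<beta>" using eqs(2) by simp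
    finally show ?thesis by (simp add: K'_def A'_def B'_def algebra_simps)
  qed
  have K'L: "Lp M q K'" unfolding K'K[abs_def] using q K by (intro Lp_add Lp_cmult Lp_cnj) auto
  have "(\<integral>z. A' z * e n z \<partial>M) = beurling_symbol a' n * (\<integral>z. K' z * e n z \<partial>M)" for n
  proof -
    have "(\<integral>z. K' z * e n z \<partial>M) = (\<integral>z. B' z * e n z - a' * (A' z * e n z) \<partial>M)"
      by (intro Bochner_Integration.integral_cong) (auto simp: K'_def algebra_simps)
    also have "\<dots> = (\<integral>z. B' z * e n z \<partial>M) - a' * (\<integral>z. A' z * e n z \<partial>M)"
      using A'i B'i by (subst Bochner_Integration.integral_diff) (auto intro!: integrable_mult_right integrable_mult_e)
    also have "\<dots> = - (\<i> * \<kappa> / 2) * freq_map a' n * E' n" unfolding A'e B'e by (simp add: freq_map_def add_divide_distrib diff_divide_distrib algebra_simps)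
    finally have K'e: "(\<integral>z. K' z * e n z \<partial>M) = - (\<i> * \<kappa> / 2) * freq_map a' n * E' n" .
    show ?thesis
    proof (cases "n = 0")
      case True then show ?thesis unfolding K'e A'e by (simp add: freq_map_def)
    next
      case False
      have "beurling_symbol a' n * (- (\<i> * \<kappa> / 2) * freq_map a' n * E' n) = - (\<i> * \<kappa> / 2) * (beurling_symbol a' n * freq_map a' n) * E' n"
        by simp
      also have "beurling_symbol a' n * freq_map a' n = cnj n" by (rule beurling_symbol_eq[OF a' False])
      finally show ?thesis unfolding K'e A'e by (rule sym)
    qed
  qed
  then have A'L: "Lp M q A'" by (intro Lp_of_multiplier[OF a' q A'i K'L])
  have "B' = (\<lambda>z. K' z + a' * A' z)" by (simp add: K'_def fun_eq_iff)
  moreover have "Lp M q (\<lambda>z. K' z + a' * A' z)" using q by (intro Lp_add K'L Lp_cmult A'L) auto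
  ultimately have B'L: "Lp M q B'" by (simp only:)
  define d where "d = 1 - (norm \<beta>)\<^sup>2"
  have d: "complex_of_real d \<noteq> 0"
    using \<beta> by (simp add: d_def abs_square_eq_1 power2_eq_1_iff del: of_real_diff)
  have bb: "\<beta> * cnj \<beta> = 1 - of_real d" by (simp add: d_def complex_norm_square[symmetric])
  have "A z = (1 / of_real d) * (A' z + \<beta> * cnj (B' z))" for z
  proof -
    have "A' z + \<beta> * cnj (B' z) = A z - (\<beta> * cnj \<beta>) * A z" by (simp add: A'_def B'_def algebra_simps)
    also have "\<dots> = of_real d * A z" unfolding bb by (simp add: algebra_simps)
    finally show ?thesis using d by simp
  qed
  moreover have "Lp M q (\<lambda>z. (1 / of_real d) * (A' z + \<beta> * cnj (B' z)))"
    using q A'L B'L by (intro Lp_cmult Lp_add Lp_cnj) auto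
  ultimately have AL: "Lp M q A" by presburger
  have "B z = B' z + \<beta> * cnj (A z)" for z by (simp add: B'_def)
  moreover have "Lp M q (\<lambda>z. B' z + \<beta> * cnj (A z))"
    using q AL B'L by (intro Lp_cmult Lp_add Lp_cnj) auto
  ultimately have BL: "Lp M q B" by presburger
  have "ux z = A z + B z" "uy z = \<i> * A z + - \<i> * B z" for z
    by (simp_all add: A_def B_def field_simps)
  moreover have "Lp M q (\<lambda>z. A z + B z)" "Lp M q (\<lambda>z. \<i> * A z + - \<i> * B z)"
    using q AL BL by (intro Lp_cmult Lp_add; simp)+
  ultimately show "Lp M q ux" "Lp M q uy" by presburger+
qed

end

section \<open>Primitives along lines and the Sobolev inequality\<close>

lemma Fubini_axes:
  fixes f :: "complex \<Rightarrow> 'b::{banach, second_countable_topology}"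
  assumes ax: "axes v w" and f: "integrable lborel f"
  shows "(\<integral>z. f z \<partial>lborel) = (\<integral>s. (\<integral>t. f (t *\<^sub>R v + s *\<^sub>R w) \<partial>lborel) \<partial>lborel)"
    and "AE s in lborel. integrable lborel (\<lambda>t. f (t *\<^sub>R v + s *\<^sub>R w))"
    and "integrable lborel (\<lambda>s. \<integral>t. f (t *\<^sub>R v + s *\<^sub>R w) \<partial>lborel)"
proof -
  have [measurable]: "f \<in> borel_measurable borel" using f by auto
  have eq: "lborel = distr (lborel \<Otimes>\<^sub>M lborel) borel (\<lambda>x. fst x *\<^sub>R v + snd x *\<^sub>R w)"
    by (rule lborel_axes[OF ax])
  have "integrable (distr (lborel \<Otimes>\<^sub>M lborel) borel (\<lambda>x. fst x *\<^sub>R v + snd x *\<^sub>R w)) f"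
    using f by (subst eq[symmetric])
  then have int: "integrable (lborel \<Otimes>\<^sub>M lborel) (\<lambda>(t, s). f (t *\<^sub>R v + s *\<^sub>R w))"
    by (subst (asm) integrable_distr_eq) (auto simp: case_prod_unfold)
  have "(\<integral>z. f z \<partial>lborel) = (\<integral>x. f (fst x *\<^sub>R v + snd x *\<^sub>R w) \<partial>(lborel \<Otimes>\<^sub>M lborel))"
    by (subst eq, subst integral_distr) auto
  also have "\<dots> = (\<integral>s. (\<integral>t. f (t *\<^sub>R v + s *\<^sub>R w) \<partial>lborel) \<partial>lborel)"
    using lborel_pair.integral_snd[OF int] by (simp add: case_prod_unfold)
  finally show "(\<integral>z. f z \<partial>lborel) = (\<integral>s. (\<integral>t. f (t *\<^sub>R v + s *\<^sub>R w) \<partial>lborel) \<partial>lborel)" .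
  show "integrable lborel (\<lambda>s. \<integral>t. f (t *\<^sub>R v + s *\<^sub>R w) \<partial>lborel)"
    using lborel_pair.integrable_snd[OF int] .
  show "AE s in lborel. integrable lborel (\<lambda>t. f (t *\<^sub>R v + s *\<^sub>R w))"
    using lborel_pair.AE_integrable_snd[OF int] .
qed

lemma integrable_axes_iff:
  fixes f :: "complex \<Rightarrow> 'b::{banach, second_countable_topology}"
  assumes ax: "axes v w" and [measurable]: "f \<in> borel_measurable borel"
  shows "integrable lborel f \<longleftrightarrow> integrable (lborel \<Otimes>\<^sub>M lborel) (\<lambda>x. f (fst x *\<^sub>R v + snd x *\<^sub>R w))"
  by (subst lborel_axes[OF ax], subst integrable_distr_eq) auto

context square begin

text \<open>Fubini's theorem requires Borel functions on the product, so Lebesgue measurable functions are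
modified on a null set and extended by zero.\<close>

lemma borel_representative:
  fixes g :: "complex \<Rightarrow> complex"
  assumes "g \<in> borel_measurable M"
  obtains g0 where "g0 \<in> borel_measurable borel" "AE z in M. g z = g0 z" "\<And>z. z \<notin> Q \<Longrightarrow> g0 z = 0"
proof -
  define h where "h z = (if z \<in> Q then g z else 0)" for z
  have hm: "h \<in> borel_measurable lebesgue"
    unfolding h_def using assms by (subst borel_measurable_if) auto
  have "(\<lambda>z. Re (h z)) \<in> borel_measurable lebesgue" "(\<lambda>z. Im (h z)) \<in> borel_measurable lebesgue"
    using hm by (auto intro: borel_measurable_Re borel_measurable_Im measurable_compose[OF hm])
  then obtain h1 h2 where h12: "h1 \<in> borel_measurable lborel" "AE z in lborel. Re (h z) = h1 z"
     "h2 \<in> borel_measurable lborel" "AE z in lborel. Im (h z) = h2 z"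
    using completion_ex_borel_measurable_real[of _ lborel] by metis
  then have [measurable]: "h1 \<in> borel_measurable borel" "h2 \<in> borel_measurable borel" by auto
  define g0 where "g0 z = indicator Q z *\<^sub>R (of_real (h1 z) + \<i> * of_real (h2 z))" for z
  have "AE z in lborel. h z = g0 z"
    using h12(2,4) by eventually_elim (auto simp: g0_def h_def indicator_def complex_eq_iff)
  then have "AE z in lebesgue. h z = g0 z" by (rule AE_completion)
  then have "AE z in M. h z = g0 z" by (rule AE_M_lebesgue)
  moreover have "AE z in M. h z = g z" by (rule AE_I2) (simp add: h_def)
  ultimately have "AE z in M. g z = g0 z" by eventually_elim simp
  moreover have "g0 \<in> borel_measurable borel" unfolding g0_def by measurable
  ultimately show thesis by (intro that[of g0]) (auto simp: g0_def)
qed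

lemma integral_M_vanish:
  fixes f :: "complex \<Rightarrow> 'b::{banach, second_countable_topology}"
  assumes f: "f \<in> borel_measurable borel" and z: "\<And>z. z \<notin> Q \<Longrightarrow> f z = 0"
  shows "(\<integral>z. f z \<partial>M) = (\<integral>z. f z \<partial>lborel)" "integrable M f \<longleftrightarrow> integrable lborel f"
proof -
  have "indicator Q z *\<^sub>R f z = f z" for z using z[of z] by (auto simp: indicator_def)
  then show "(\<integral>z. f z \<partial>M) = (\<integral>z. f z \<partial>lborel)" "integrable M f \<longleftrightarrow> integrable lborel f"
    using integral_M_borel[OF f] by simp_all
qed

text \<open>The primitive of \<open>g\<close> in the direction \<open>v\<close>, computed from the side of the square where the coordinate
\<open>z \<bullet> v\<close> is smallest.\<close>

definition line_prim :: "complex \<Rightarrow> complex \<Rightarrow> (complex \<Rightarrow> complex) \<Rightarrow> complex \<Rightarrow> complex" where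
  "line_prim v w g z = (\<integral>t. (if z \<in> Q \<and> t \<le> z \<bullet> v then g (t *\<^sub>R v + (z \<bullet> w) *\<^sub>R w) else 0) \<partial>lborel)"

text \<open>The transpose of \<open>line_prim\<close>: the integral of \<open>m\<close> from \<open>z\<close> to the opposite side.\<close>

definition line_tail :: "complex \<Rightarrow> complex \<Rightarrow> (complex \<Rightarrow> complex) \<Rightarrow> complex \<Rightarrow> complex" where
  "line_tail v w m z = (\<integral>x. (if z \<bullet> v \<le> x \<and> x \<le> c \<bullet> v + l then m (x *\<^sub>R v + (z \<bullet> w) *\<^sub>R w) else 0) \<partial>lborel)"

lemma line_prim_measurable [measurable]:
  assumes [measurable]: "g \<in> borel_measurable borel"
  shows "line_prim v w g \<in> borel_measurable borel"
  unfolding line_prim_def[abs_def] by (rule lborel.borel_measurable_lebesgue_integral) measurable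

lemma norm_line_prim_le:
  assumes [measurable]: "g \<in> borel_measurable borel"
    and "integrable lborel (\<lambda>t. g (t *\<^sub>R v + (z \<bullet> w) *\<^sub>R w))"
  shows "norm (line_prim v w g z) \<le> (\<integral>t. norm (g (t *\<^sub>R v + (z \<bullet> w) *\<^sub>R w)) \<partial>lborel)"
  unfolding line_prim_def
  by (rule order_trans[OF integral_norm_bound], rule integral_mono')
    (use assms(2) in auto)

text \<open>Interchange of the integrations over \<open>t \<le> x\<close> on almost every line in the direction \<open>v\<close>.\<close>

lemma line_prim_pairing:
  assumes ax: "axes v w" and g [measurable]: "g \<in> borel_measurable borel" and gQ: "\<And>z. z \<notin> Q \<Longrightarrow> g z = 0"
    and gi: "integrable lborel g"
    and m [measurable]: "m \<in> borel_measurable borel" and mB: "\<And>z. norm (m z) \<le> B"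
  shows "integrable M (line_prim v w g)"
    and "(\<integral>z. line_prim v w g z * m z \<partial>M) = (\<integral>z. g z * line_tail v w m z \<partial>M)"
proof -
  define I where "I = {c \<bullet> v .. c \<bullet> v + l}"
  have B0: "0 \<le> B" using order_trans[OF norm_ge_zero mB] .
  define G where "G t s = g (t *\<^sub>R v + s *\<^sub>R w)" for t s
  have [measurable]: "(\<lambda>x. G (fst x) (snd x)) \<in> borel_measurable (lborel \<Otimes>\<^sub>M lborel)"
    "(\<lambda>t. G t s) \<in> borel_measurable borel" for s unfolding G_def by measurable
  have IB [measurable]: "I \<in> sets borel" by (simp add: I_def)
  have Ii: "integrable lborel (indicator I :: real \<Rightarrow> real)"
    by (rule integrable_real_indicator) (auto simp: I_def emeasure_lborel_Icc_eq)
  define N where "N s = (\<integral>t. norm (G t s) \<partial>lborel)" for s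
  have Ni: "integrable lborel N" and Gs: "AE s in lborel. integrable lborel (\<lambda>t. norm (G t s))"
    using Fubini_axes(2,3)[OF ax integrable_norm[OF gi]] by (auto simp: N_def[abs_def] G_def)
  have [measurable]: "N \<in> borel_measurable borel" using Ni by auto
  have N0: "0 \<le> N s" for s by (simp add: N_def)
  have Vn: "AE s in lborel. \<forall>x. norm (line_prim v w g (x *\<^sub>R v + s *\<^sub>R w)) \<le> indicator I x * N s"
    using Gs
  proof eventually_elim
    case (elim s)
    have Gi: "integrable lborel (\<lambda>t. G t s)" using elim by (subst (asm) integrable_norm_iff) auto
    show ?case
    proof
      fix x
      show "norm (line_prim v w g (x *\<^sub>R v + s *\<^sub>R w)) \<le> indicator I x * N s"
      proof (cases "x *\<^sub>R v + s *\<^sub>R w \<in> Q")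
        case True
        then have "x \<in> I" using ax by (simp add: mem_Q_axes axes_inner I_def)
        then show ?thesis
          using norm_line_prim_le[OF g, of v "x *\<^sub>R v + s *\<^sub>R w" w] Gi ax by (simp add: axes_inner N_def G_def)
      qed (simp add: line_prim_def N0)
    qed
  qed
  have Nm: "integrable (lborel \<Otimes>\<^sub>M lborel) (\<lambda>x. indicator I (fst x) * N (snd x))"
  proof -
    have "integrable lborel (\<lambda>t. complex_of_real (indicator I t))" "integrable lborel (\<lambda>s. complex_of_real (N s))"
      using Ii Ni by (auto simp del: of_real_indicator)
    from pair_integral_prod(1)[OF this]
    have "integrable (lborel \<Otimes>\<^sub>M lborel) (\<lambda>x. complex_of_real (indicator I (fst x) * N (snd x)))"
      by simp
    from integrable_Re[OF this] show ?thesis by simp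
  qed
  have AEp: "AE x in lborel \<Otimes>\<^sub>M lborel. norm (line_prim v w g (fst x *\<^sub>R v + snd x *\<^sub>R w)) \<le> indicator I (fst x) * N (snd x)"
  proof -
    have "AE s in lborel. AE x in lborel. norm (line_prim v w g (x *\<^sub>R v + s *\<^sub>R w)) \<le> indicator I x * N s"
      using Vn by eventually_elim simp
    moreover have ms: "{x \<in> space (lborel \<Otimes>\<^sub>M lborel). norm (line_prim v w g (fst x *\<^sub>R v + snd x *\<^sub>R w)) \<le> indicator I (fst x) * N (snd x)} \<in> sets (lborel \<Otimes>\<^sub>M lborel)"
      by measurable
    ultimately have "AE x in lborel. AE s in lborel. norm (line_prim v w g (x *\<^sub>R v + s *\<^sub>R w)) \<le> indicator I x * N s"
      by (subst lborel_pair.AE_commute) simp_all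
    then show ?thesis by (intro lborel_pair.AE_pair_measure ms) simp
  qed
  have intV: "integrable lborel (\<lambda>z. line_prim v w g z * b z)" if [measurable]: "b \<in> borel_measurable borel" and "\<And>z. norm (b z) \<le> C" for b C
  proof -
    have C0: "0 \<le> C" using order_trans[OF norm_ge_zero that(2)] .
    have "integrable (lborel \<Otimes>\<^sub>M lborel) (\<lambda>x. line_prim v w g (fst x *\<^sub>R v + snd x *\<^sub>R w) * b (fst x *\<^sub>R v + snd x *\<^sub>R w))"
    proof (rule Bochner_Integration.integrable_bound)
      show "integrable (lborel \<Otimes>\<^sub>M lborel) (\<lambda>x. C * (indicator I (fst x) * N (snd x)))"
        using Nm by (rule integrable_mult_right)
      show "AE x in lborel \<Otimes>\<^sub>M lborel. norm (line_prim v w g (fst x *\<^sub>R v + snd x *\<^sub>R w) * b (fst x *\<^sub>R v + snd x *\<^sub>R w)) \<le> norm (C * (indicator I (fst x) * N (snd x)))"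
        using AEp
      proof eventually_elim
        case (elim x)
        have "norm (line_prim v w g (fst x *\<^sub>R v + snd x *\<^sub>R w) * b (fst x *\<^sub>R v + snd x *\<^sub>R w)) \<le> (indicator I (fst x) * N (snd x)) * C"
          unfolding norm_mult by (intro mult_mono elim that) (auto simp: N0)
        then show ?case using C0 N0 by (simp add: mult.commute abs_mult)
      qed
    qed measurable
    then show ?thesis by (subst integrable_axes_iff[OF ax]) auto
  qed
  have pQ: "line_prim v w g z = 0" if "z \<notin> Q" for z using that by (simp add: line_prim_def)
  have "integrable lborel (\<lambda>z. line_prim v w g z * 1)" by (rule intV[where C=1]) auto
  then show "integrable M (line_prim v w g)" using integral_M_vanish(2)[OF line_prim_measurable[OF g] pQ] by simp
  have cop_m [measurable]: "line_tail v w m \<in> borel_measurable borel"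
    unfolding line_tail_def[abs_def] by (rule lborel.borel_measurable_lebesgue_integral) measurable
  have "(\<integral>z. line_prim v w g z * m z \<partial>M) = (\<integral>z. line_prim v w g z * m z \<partial>lborel)"
    by (rule integral_M_vanish) (auto simp: pQ)
  also have "\<dots> = (\<integral>s. (\<integral>x. line_prim v w g (x *\<^sub>R v + s *\<^sub>R w) * m (x *\<^sub>R v + s *\<^sub>R w) \<partial>lborel) \<partial>lborel)"
    by (rule Fubini_axes(1)[OF ax intV[OF m mB]])
  also have "\<dots> = (\<integral>s. (\<integral>t. g (t *\<^sub>R v + s *\<^sub>R w) * line_tail v w m (t *\<^sub>R v + s *\<^sub>R w) \<partial>lborel) \<partial>lborel)"
  proof (rule integral_cong_AE)
    show "AE s in lborel. (\<integral>x. line_prim v w g (x *\<^sub>R v + s *\<^sub>R w) * m (x *\<^sub>R v + s *\<^sub>R w) \<partial>lborel) =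
       (\<integral>t. g (t *\<^sub>R v + s *\<^sub>R w) * line_tail v w m (t *\<^sub>R v + s *\<^sub>R w) \<partial>lborel)"
      using Gs
    proof eventually_elim
      case (elim s)
      then have Gi: "integrable lborel (\<lambda>t. G t s)" by (subst (asm) integrable_norm_iff) auto
      show ?case
      proof (cases "s \<in> {c \<bullet> w..c \<bullet> w + l}")
        case False
        then have "x *\<^sub>R v + s *\<^sub>R w \<notin> Q" for x using ax by (simp add: mem_Q_axes axes_inner)
        then show ?thesis using gQ by (simp add: line_prim_def)
      next
        case True
        then have QI: "x *\<^sub>R v + s *\<^sub>R w \<in> Q \<longleftrightarrow> x \<in> I" for x using ax by (simp add: mem_Q_axes axes_inner I_def)
        define F where "F = (\<lambda>t x. if x \<in> I \<and> t \<le> x then G t s * m (x *\<^sub>R v + s *\<^sub>R w) else 0)"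
        have Fm [measurable]: "case_prod F \<in> borel_measurable (lborel \<Otimes>\<^sub>M lborel)"
          unfolding F_def by measurable
        have Fi: "integrable (lborel \<Otimes>\<^sub>M lborel) (case_prod F)"
        proof (rule Bochner_Integration.integrable_bound[OF _ Fm])
          have "integrable lborel (\<lambda>t. complex_of_real (indicator I t))" using Ii by (auto simp del: of_real_indicator)
          from pair_integral_prod(1)[OF Gi this]
          show "integrable (lborel \<Otimes>\<^sub>M lborel) (\<lambda>x. B *\<^sub>R (G (fst x) s * complex_of_real (indicator I (snd x))))"
            by (rule integrable_scaleR_right)
          show "AE x in lborel \<Otimes>\<^sub>M lborel. norm (case_prod F x) \<le> norm (B *\<^sub>R (G (fst x) s * complex_of_real (indicator I (snd x))))"
          proof (rule AE_I2)
            fix x :: "real \<times> real"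
            have "norm (G (fst x) s) * norm (m (snd x *\<^sub>R v + s *\<^sub>R w)) \<le> norm (G (fst x) s) * B"
              by (intro mult_left_mono mB) auto
            then show "norm (case_prod F x) \<le> norm (B *\<^sub>R (G (fst x) s * complex_of_real (indicator I (snd x))))"
              using B0 by (simp add: F_def norm_mult case_prod_unfold mult.commute)
          qed
        qed
        have "(\<integral>x. line_prim v w g (x *\<^sub>R v + s *\<^sub>R w) * m (x *\<^sub>R v + s *\<^sub>R w) \<partial>lborel) = (\<integral>x. (\<integral>t. F t x \<partial>lborel) \<partial>lborel)"
        proof (rule Bochner_Integration.integral_cong[OF refl])
          fix x
          have "line_prim v w g (x *\<^sub>R v + s *\<^sub>R w) * m (x *\<^sub>R v + s *\<^sub>R w)
             = (\<integral>t. (if x \<in> I \<and> t \<le> x then G t s else 0) * m (x *\<^sub>R v + s *\<^sub>R w) \<partial>lborel)"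
            unfolding line_prim_def QI axes_inner[OF ax] G_def by simp
          also have "\<dots> = (\<integral>t. F t x \<partial>lborel)"
            by (intro Bochner_Integration.integral_cong refl) (simp add: F_def)
          finally show "line_prim v w g (x *\<^sub>R v + s *\<^sub>R w) * m (x *\<^sub>R v + s *\<^sub>R w) = (\<integral>t. F t x \<partial>lborel)" .
        qed
        also have "\<dots> = (\<integral>t. (\<integral>x. F t x \<partial>lborel) \<partial>lborel)"
          by (rule lborel_pair.Fubini_integral[OF Fi])
        also have "\<dots> = (\<integral>t. g (t *\<^sub>R v + s *\<^sub>R w) * line_tail v w m (t *\<^sub>R v + s *\<^sub>R w) \<partial>lborel)"
        proof (rule Bochner_Integration.integral_cong[OF refl])
          fix t
          show "(\<integral>x. F t x \<partial>lborel) = g (t *\<^sub>R v + s *\<^sub>R w) * line_tail v w m (t *\<^sub>R v + s *\<^sub>R w)"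
          proof (cases "t \<in> I")
            case False
            then have G0: "G t s = 0" using gQ QI by (simp add: G_def)
            then have "F t = (\<lambda>x. 0)" by (simp add: F_def fun_eq_iff)
            then show ?thesis using G0 by (simp add: G_def)
          next
            case t: True
            have "g (t *\<^sub>R v + s *\<^sub>R w) * line_tail v w m (t *\<^sub>R v + s *\<^sub>R w)
               = (\<integral>x. G t s * (if t \<le> x \<and> x \<le> c \<bullet> v + l then m (x *\<^sub>R v + s *\<^sub>R w) else 0) \<partial>lborel)"
              unfolding line_tail_def axes_inner[OF ax] G_def by simp
            also have "\<dots> = (\<integral>x. F t x \<partial>lborel)"
              using t by (intro Bochner_Integration.integral_cong refl) (auto simp: F_def I_def)
            finally show ?thesis by simp
          qed
        qed
        finally show ?thesis .
      qed
    qed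
  qed measurable
  also have "\<dots> = (\<integral>z. g z * line_tail v w m z \<partial>lborel)"
  proof (rule Fubini_axes(1)[OF ax, symmetric])
    show "integrable lborel (\<lambda>z. g z * line_tail v w m z)"
    proof (rule Bochner_Integration.integrable_bound)
      show "integrable lborel (\<lambda>z. (l * B) *\<^sub>R g z)" using gi by (rule integrable_scaleR_right)
      show "AE z in lborel. norm (g z * line_tail v w m z) \<le> norm ((l * B) *\<^sub>R g z)"
      proof (rule AE_I2)
        fix z
        show "norm (g z * line_tail v w m z) \<le> norm ((l * B) *\<^sub>R g z)"
        proof (cases "z \<in> Q")
          case True
          then have zI: "z \<bullet> v \<in> I" using ax by (simp add: mem_Q_axes I_def)
          have "norm (line_tail v w m z) \<le> (\<integral>x. norm (if z \<bullet> v \<le> x \<and> x \<le> c \<bullet> v + l then m (x *\<^sub>R v + (z \<bullet> w) *\<^sub>R w) else 0) \<partial>lborel)"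
            unfolding line_tail_def by (rule integral_norm_bound)
          also have "\<dots> \<le> (\<integral>x. B * indicator I x \<partial>lborel)"
          proof (rule integral_mono')
            show "integrable lborel (\<lambda>x. B * indicator I x)" by (rule integrable_mult_right[OF Ii])
          qed (use zI mB B0 in \<open>auto simp: I_def indicator_def\<close>)
          also have "\<dots> = l * B" using l_pos by (simp add: I_def)
          finally have "norm (g z) * norm (line_tail v w m z) \<le> norm (g z) * (l * B)"
            by (intro mult_left_mono) auto
          then show ?thesis using l_pos B0 by (simp add: norm_mult mult.commute)
        qed (simp add: gQ)
      qed
    qed measurable
  qed
  also have "\<dots> = (\<integral>z. g z * line_tail v w m z \<partial>M)"
    by (rule integral_M_vanish[symmetric]) (auto simp: gQ)
  finally show "(\<integral>z. line_prim v w g z * m z \<partial>M) = (\<integral>z. g z * line_tail v w m z \<partial>M)" .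
qed

lemma boxder_cong_AE:
  assumes "boxder v u g" "AE z in M. g z = g0 z" and [measurable]: "g0 \<in> borel_measurable M"
  shows "boxder v u g0"
proof -
  have [measurable]: "g \<in> borel_measurable M" using assms(1) by (auto simp: boxder_def)
  have "integrable M g0" using assms by (subst integrable_cong_AE[symmetric]) (auto simp: boxder_def)
  moreover have "(\<integral>z. \<psi> z *\<^sub>R g z \<partial>M) = (\<integral>z. \<psi> z *\<^sub>R g0 z \<partial>M)" if "\<forall>n. Ck n \<psi>" for \<psi>
  proof (rule integral_cong_AE)
    have [measurable]: "\<psi> \<in> borel_measurable M" using that by (intro continuous_measurable_M Ck_continuous) auto
    show "(\<lambda>z. \<psi> z *\<^sub>R g z) \<in> borel_measurable M" "(\<lambda>z. \<psi> z *\<^sub>R g0 z) \<in> borel_measurable M" by measurable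
    show "AE z in M. \<psi> z *\<^sub>R g z = \<psi> z *\<^sub>R g0 z" using assms(2) by eventually_elim simp
  qed
  ultimately show ?thesis using assms(1) by (auto simp: boxder_def)
qed

text \<open>Integration of a character that oscillates in the direction \<open>v\<close>. The boundary term is a constant times
the character with the frequency component along \<open>v\<close> removed.\<close>

lemma line_tail_e_oscillating:
  assumes ax: "axes v w" and nv: "n \<bullet> v \<noteq> 0" and z: "z \<in> Q"
  shows "line_tail v w (e n) z =
    (cis (\<kappa> * ((n \<bullet> v) * (c \<bullet> v + l))) * e ((n \<bullet> w) *\<^sub>R w) z - e n z) / (\<i> * of_real (\<kappa> * (n \<bullet> v)))"
proof -
  define k where "k = \<kappa> * (n \<bullet> v)"
  have k: "\<i> * of_real k \<noteq> 0" using nv \<kappa>_pos by (simp add: k_def)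
  define a where "a = z \<bullet> v"
  define b where "b = c \<bullet> v + l"
  have ab: "a \<le> b" using z ax by (simp add: mem_Q_axes a_def b_def)
  define F where "F x = e n (x *\<^sub>R v + (z \<bullet> w) *\<^sub>R w) / (\<i> * of_real k)" for x
  have en: "e n (x *\<^sub>R v + (z \<bullet> w) *\<^sub>R w) = cis (k * x) * e ((n \<bullet> w) *\<^sub>R w) z" for x
    using ax by (simp add: e_def cis_mult k_def inner_add_right inner_commute[of w z] algebra_simps)
  have dF: "(F has_vector_derivative e n (x *\<^sub>R v + (z \<bullet> w) *\<^sub>R w)) (at x within {a..b})" for x
  proof -
    have "((\<lambda>y. exp (\<i> * of_real k * y) / (\<i> * of_real k)) has_field_derivative
        exp (\<i> * of_real k * of_real x)) (at (of_real x))"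
      using k by (auto intro!: derivative_eq_intros)
    then have "((\<lambda>x. exp (\<i> * of_real k * of_real x) / (\<i> * of_real k)) has_vector_derivative
        exp (\<i> * of_real k * of_real x)) (at x within {a..b})"
      by (rule has_vector_derivative_real_field)
    then have "((\<lambda>x. exp (\<i> * of_real k * of_real x) / (\<i> * of_real k) * e ((n \<bullet> w) *\<^sub>R w) z) has_vector_derivative
        exp (\<i> * of_real k * of_real x) * e ((n \<bullet> w) *\<^sub>R w) z) (at x within {a..b})"
      by (rule has_vector_derivative_mult_left)
    then show ?thesis unfolding F_def[abs_def] en by (simp add: cis_conv_exp mult_ac)
  qed
  have "has_bochner_integral lborel (\<lambda>x. indicator {a..b} x *\<^sub>R e n (x *\<^sub>R v + (z \<bullet> w) *\<^sub>R w)) (F b - F a)"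
    by (rule has_bochner_integral_FTC_Icc[OF ab dF])
      (auto intro!: continuous_on_compose2[OF continuous_e] continuous_intros)
  then have "(\<integral>x. indicator {a..b} x *\<^sub>R e n (x *\<^sub>R v + (z \<bullet> w) *\<^sub>R w) \<partial>lborel) = F b - F a"
    by (rule has_bochner_integral_integral_eq)
  also have "(\<integral>x. indicator {a..b} x *\<^sub>R e n (x *\<^sub>R v + (z \<bullet> w) *\<^sub>R w) \<partial>lborel) = line_tail v w (e n) z"
    unfolding line_tail_def by (intro Bochner_Integration.integral_cong refl) (simp add: a_def b_def)
  also have "F a = e n z / (\<i> * of_real k)"
    unfolding F_def a_def axes_decomp[OF ax] ..
  also have "F b = cis (\<kappa> * ((n \<bullet> v) * (c \<bullet> v + l))) * e ((n \<bullet> w) *\<^sub>R w) z / (\<i> * of_real k)"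
    unfolding F_def en by (simp add: k_def b_def mult.assoc)
  finally show ?thesis by (simp add: diff_divide_distrib k_def)
qed

lemma line_tail_e_constant:
  assumes ax: "axes v w" and nv: "n \<bullet> v = 0" and z: "z \<in> Q"
  shows "line_tail v w (e n) z = (c \<bullet> v + l - z \<bullet> v) *\<^sub>R e n z"
proof -
  define a where "a = z \<bullet> v"
  define b where "b = c \<bullet> v + l"
  have ab: "a \<le> b" using z ax by (simp add: mem_Q_axes a_def b_def)
  have en: "e n (x *\<^sub>R v + (z \<bullet> w) *\<^sub>R w) = e n z" for x
  proof -
    have "n \<bullet> (x *\<^sub>R v + (z \<bullet> w) *\<^sub>R w) = n \<bullet> ((z \<bullet> v) *\<^sub>R v + (z \<bullet> w) *\<^sub>R w)"
      using nv by (simp add: inner_add_right)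
    then show ?thesis unfolding e_def axes_decomp[OF ax] by simp
  qed
  have "line_tail v w (e n) z = (\<integral>x. indicator {a..b} x *\<^sub>R e n z \<partial>lborel)"
    unfolding line_tail_def en by (intro Bochner_Integration.integral_cong refl) (simp add: a_def b_def)
  also have "\<dots> = (b - a) *\<^sub>R e n z" using ab by (subst integral_scaleR_left) (auto simp: emeasure_lborel_Icc_eq)
  finally show ?thesis by (simp add: a_def b_def)
qed

text \<open>For a character constant in the direction \<open>v\<close>, the function \<open>(K - z \<bullet> v) e n z\<close> is not
periodic, but it is smooth, hence an admissible test function.\<close>

lemma boxder_affine_e:
  assumes ax: "axes v w" and nv: "n \<bullet> v = 0" and d: "boxder v u g"
  shows "(\<integral>z. g z * ((K - z \<bullet> v) *\<^sub>R e n z) \<partial>M) = (\<integral>z. u z * e n z \<partial>M)"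
proof -
  have u: "integrable M u" and g: "integrable M g" using d by (auto simp: boxder_def)
  define c1 where "c1 t z = cos (z \<bullet> (\<kappa> *\<^sub>R n) + t)" for t and z :: complex
  define \<psi> where "\<psi> t z = (K + (- 1) * (z \<bullet> v)) * c1 t z" for t and z :: complex
  have ck: "Ck k (c1 t)" "Ck k (\<psi> t)" for k t
    unfolding c1_def[abs_def] \<psi>_def[abs_def]
    by (intro Ck_mult Ck_add Ck_const Ck_cmult Ck_inner Ck_cos_ridge)+
  have D: "frechet_derivative (\<psi> t) (at z) v = - c1 t z" for t z
  proof -
    have "((\<lambda>z. cos (z \<bullet> (\<kappa> *\<^sub>R n) + t)) has_derivative (\<lambda>h. - sin (z \<bullet> (\<kappa> *\<^sub>R n) + t) * (h \<bullet> (\<kappa> *\<^sub>R n)))) (at z)"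
      by (rule inner_chain_derivative) (auto intro!: derivative_eq_intros)
    moreover have "((\<lambda>z. K + (- 1) * (z \<bullet> v)) has_derivative (\<lambda>h. (- 1) * (h \<bullet> v))) (at z)"
      by (auto intro!: derivative_eq_intros)
    ultimately have "(\<psi> t has_derivative (\<lambda>h. (K + (- 1) * (z \<bullet> v)) * (- sin (z \<bullet> (\<kappa> *\<^sub>R n) + t) * (h \<bullet> (\<kappa> *\<^sub>R n))) + (- 1) * (h \<bullet> v) * c1 t z)) (at z)"
      unfolding \<psi>_def c1_def by (intro has_derivative_mult)
    then have "frechet_derivative (\<psi> t) (at z) = (\<lambda>h. (K + (- 1) * (z \<bullet> v)) * (- sin (z \<bullet> (\<kappa> *\<^sub>R n) + t) * (h \<bullet> (\<kappa> *\<^sub>R n))) + (- 1) * (h \<bullet> v) * c1 t z)"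
      by (rule frechet_derivative_at[symmetric])
    then show ?thesis using nv axes_inner(5)[OF ax] by (simp add: inner_commute[of v n])
  qed
  have I: "integrable M (\<lambda>z. c1 t z *\<^sub>R h z)" "integrable M (\<lambda>z. \<psi> t z *\<^sub>R h z)" if "integrable M h" for h :: "complex \<Rightarrow> complex" and t
    using ck by (auto intro!: integrable_mult_continuous[OF that] Ck_continuous)
  have eq: "(\<integral>z. \<psi> t z *\<^sub>R g z \<partial>M) = (\<integral>z. c1 t z *\<^sub>R u z \<partial>M)" for t
  proof -
    have "(\<integral>z. frechet_derivative (\<psi> t) (at z) v *\<^sub>R u z \<partial>M) = - (\<integral>z. \<psi> t z *\<^sub>R g z \<partial>M)"
      using d ck by (auto simp: boxder_def)
    then show ?thesis unfolding D by simp
  qed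
  have e: "e n z = of_real (c1 0 z) + \<i> * of_real (c1 (- pi / 2) z)" for z
    unfolding e_def c1_def by (simp add: cis.ctr complex_eq_iff inner_commute cos_diff)
  have "(\<integral>z. g z * ((K - z \<bullet> v) *\<^sub>R e n z) \<partial>M) = (\<integral>z. \<psi> 0 z *\<^sub>R g z + \<i> * (\<psi> (- pi / 2) z *\<^sub>R g z) \<partial>M)"
    by (intro Bochner_Integration.integral_cong refl) (simp add: e \<psi>_def scaleR_conv_of_real algebra_simps)
  also have "\<dots> = (\<integral>z. \<psi> 0 z *\<^sub>R g z \<partial>M) + \<i> * (\<integral>z. \<psi> (- pi / 2) z *\<^sub>R g z \<partial>M)"
    by (subst Bochner_Integration.integral_add[OF I(2)[OF g] integrable_mult_right[OF I(2)[OF g]]])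
      (simp only: integral_mult_right_zero)
  also have "\<dots> = (\<integral>z. c1 0 z *\<^sub>R u z \<partial>M) + \<i> * (\<integral>z. c1 (- pi / 2) z *\<^sub>R u z \<partial>M)"
    unfolding eq ..
  also have "\<dots> = (\<integral>z. c1 0 z *\<^sub>R u z + \<i> * (c1 (- pi / 2) z *\<^sub>R u z) \<partial>M)"
    by (subst Bochner_Integration.integral_add[OF I(1)[OF u] integrable_mult_right[OF I(1)[OF u]]])
      (simp only: integral_mult_right_zero)
  also have "\<dots> = (\<integral>z. u z * e n z \<partial>M)"
    by (intro Bochner_Integration.integral_cong refl) (simp add: e scaleR_conv_of_real algebra_simps)
  finally show ?thesis .
qed

text \<open>Both functions have the same Fourier coefficients. Transposing the primitive turns a character into
\<open>line_tail\<close> of it, which is again a smooth test function and has derivative \<open>- e n\<close> in the direction \<open>v\<close>.\<close>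

lemma boxder_primitive:
  assumes ax: "axes v w" and d: "boxder v u g"
    and g [measurable]: "g \<in> borel_measurable borel" and gQ: "\<And>z. z \<notin> Q \<Longrightarrow> g z = 0"
  shows "AE z in M. u z = line_prim v w g z"
proof -
  have u: "integrable M u" and gM: "integrable M g" using d by (auto simp: boxder_def)
  have gi: "integrable lborel g" using gM integral_M_vanish(2)[OF g gQ] by simp
  have e1: "norm (e n z) \<le> 1" for n z by simp
  have pi: "integrable M (line_prim v w g)"
    by (rule line_prim_pairing(1)[OF ax g gQ gi e_measurable[of 0] e1])
  have pp: "(\<integral>z. line_prim v w g z * e n z \<partial>M) = (\<integral>z. g z * line_tail v w (e n) z \<partial>M)" for n
    by (rule line_prim_pairing(2)[OF ax g gQ gi e_measurable e1])
  have pe: "(\<integral>z. line_prim v w g z * e n z \<partial>M) = (\<integral>z. u z * e n z \<partial>M)" if n: "n \<in> freqs" for n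
  proof (cases "n \<bullet> v = 0")
    case True
    have "(\<integral>z. line_prim v w g z * e n z \<partial>M) = (\<integral>z. g z * ((c \<bullet> v + l - z \<bullet> v) *\<^sub>R e n z) \<partial>M)"
      unfolding pp by (intro Bochner_Integration.integral_cong refl) (simp add: line_tail_e_constant[OF ax True])
    then show ?thesis by (simp only: boxder_affine_e[OF ax True d])
  next
    case False
    define n' where "n' = (n \<bullet> w) *\<^sub>R w"
    define k where "k = \<i> * complex_of_real (\<kappa> * (n \<bullet> v))"
    have k: "k \<noteq> 0" using False \<kappa>_pos by (simp add: k_def)
    define C where "C = cis (\<kappa> * ((n \<bullet> v) * (c \<bullet> v + l)))"
    have n'v: "n' \<bullet> v = 0" using ax by (simp add: n'_def axes_inner)
    have "(\<integral>z. line_prim v w g z * e n z \<partial>M) = (\<integral>z. (C / k) * (g z * e n' z) - (1 / k) * (g z * e n z) \<partial>M)"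
      unfolding pp
      by (intro Bochner_Integration.integral_cong refl)
        (simp add: line_tail_e_oscillating[OF ax False] C_def n'_def k_def diff_divide_distrib algebra_simps)
    also have "\<dots> = (C / k) * (\<integral>z. g z * e n' z \<partial>M) - (1 / k) * (\<integral>z. g z * e n z \<partial>M)"
      by (subst Bochner_Integration.integral_diff) (auto intro!: integrable_mult_right integrable_mult_e gM)
    also have "\<dots> = (\<integral>z. u z * e n z \<partial>M)"
      unfolding boxder_e[OF d] n'v using k by (simp add: k_def)
    finally show ?thesis .
  qed
  have "AE z in M. u z - line_prim v w g z = 0"
  proof (rule AE_zero_by_fourier)
    show "integrable M (\<lambda>z. u z - line_prim v w g z)" using u pi by simp
    fix n assume n: "n \<in> freqs"
    have "(\<integral>z. (u z - line_prim v w g z) * e n z \<partial>M) = (\<integral>z. u z * e n z - line_prim v w g z * e n z \<partial>M)"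
      by (simp add: left_diff_distrib)
    also have "\<dots> = 0"
      using pe[OF n] integrable_mult_e[OF u] integrable_mult_e[OF pi] by simp
    finally show "(\<integral>z. (u z - line_prim v w g z) * e n z \<partial>M) = 0" .
  qed
  then show ?thesis by eventually_elim simp
qed

text \<open>Jensen's inequality on each line, followed by integration over the lines.\<close>

lemma line_integral_Lp:
  assumes ax: "axes v w" and g [measurable]: "g \<in> borel_measurable borel" and gQ: "\<And>z. z \<notin> Q \<Longrightarrow> g z = 0"
    and gp: "Lp M p g" and p: "1 \<le> p"
  shows "integrable lborel (\<lambda>s. (\<integral>t. norm (g (t *\<^sub>R v + s *\<^sub>R w)) \<partial>lborel) powr p)"
    and "AE s in lborel. integrable lborel (\<lambda>t. g (t *\<^sub>R v + s *\<^sub>R w))"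
proof -
  have p0: "0 < p" using p by simp
  have "integrable M (\<lambda>z. norm (g z) powr p)" using gp by (simp add: Lp_def)
  then have pi: "integrable lborel (\<lambda>z. norm (g z) powr p)"
    using integral_M_vanish(2)[of "\<lambda>z. norm (g z) powr p"] gQ p0 by simp
  have "Lp M 1 g" by (rule Lp_mono[OF finite_M gp]) (use p in auto)
  then have gi: "integrable lborel g" using integral_M_vanish(2)[OF g gQ] by (simp add: Lp_1_iff)
  show A: "AE s in lborel. integrable lborel (\<lambda>t. g (t *\<^sub>R v + s *\<^sub>R w))"
    by (rule Fubini_axes(2)[OF ax gi])
  note B = Fubini_axes(2)[OF ax pi]
  have [measurable]: "(\<lambda>s. \<integral>t. norm (g (t *\<^sub>R v + s *\<^sub>R w)) \<partial>lborel) \<in> borel_measurable borel"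
    by (rule lborel.borel_measurable_lebesgue_integral) measurable
  define I where "I = {c \<bullet> v .. c \<bullet> v + l}"
  define L where "L = restrict_space lborel I"
  have IB [measurable]: "I \<in> sets lborel" by (simp add: I_def)
  have LI: "measure L (space L) = l" using l_pos by (simp add: L_def I_def measure_restrict_space)
  have Lfin: "finite_measure L" by (intro finite_measureI) (simp add: L_def I_def emeasure_restrict_space emeasure_lborel_Icc_eq)
  show "integrable lborel (\<lambda>s. (\<integral>t. norm (g (t *\<^sub>R v + s *\<^sub>R w)) \<partial>lborel) powr p)"
  proof (rule Bochner_Integration.integrable_bound)
    show "integrable lborel (\<lambda>s. l powr (p - 1) * (\<integral>t. norm (g (t *\<^sub>R v + s *\<^sub>R w)) powr p \<partial>lborel))"
      by (rule integrable_mult_right[OF Fubini_axes(3)[OF ax pi]])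
    show "AE s in lborel. norm ((\<integral>t. norm (g (t *\<^sub>R v + s *\<^sub>R w)) \<partial>lborel) powr p) \<le> norm (l powr (p - 1) * (\<integral>t. norm (g (t *\<^sub>R v + s *\<^sub>R w)) powr p \<partial>lborel))"
      using B
    proof eventually_elim
      case (elim s)
      have out: "g (t *\<^sub>R v + s *\<^sub>R w) = 0" if "t \<notin> I" for t
        using that ax by (intro gQ) (auto simp: mem_Q_axes axes_inner I_def)
      have r: "(\<integral>t. f t \<partial>L) = (\<integral>t. f t \<partial>lborel)" and ri: "integrable lborel f \<Longrightarrow> integrable L f"
        if "\<And>t. t \<notin> I \<Longrightarrow> f t = 0" and "f \<in> borel_measurable borel" for f :: "real \<Rightarrow> real"
      proof -
        have eq: "(\<lambda>t. indicator I t *\<^sub>R f t) = f" 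
        proof
          fix t show "indicator I t *\<^sub>R f t = f t" by (cases "t \<in> I") (auto simp: that(1))
        qed
        show "(\<integral>t. f t \<partial>L) = (\<integral>t. f t \<partial>lborel)"
          unfolding L_def by (subst integral_restrict_space) (use IB in \<open>simp_all only: eq, simp\<close>)
        show "integrable lborel f \<Longrightarrow> integrable L f"
          unfolding L_def by (subst integrable_restrict_space) (use IB in \<open>simp_all only: eq, simp\<close>)
      qed
      have meas: "(\<lambda>t. g (t *\<^sub>R v + s *\<^sub>R w)) \<in> borel_measurable L"
        unfolding L_def by (intro measurable_restrict_space1) measurable
      have i: "integrable L (\<lambda>t. norm (g (t *\<^sub>R v + s *\<^sub>R w)) powr p)"
        using elim out by (intro ri) auto
      have "(\<integral>t. norm (g (t *\<^sub>R v + s *\<^sub>R w)) \<partial>L) powr p \<le> l powr (p - 1) * (\<integral>t. norm (g (t *\<^sub>R v + s *\<^sub>R w)) powr p \<partial>L)"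
        using Jensen_powr[OF Lfin, of p "\<lambda>t. g (t *\<^sub>R v + s *\<^sub>R w)"] p l_pos meas i unfolding LI by (simp add: Lp_def)
      also have "(\<integral>t. norm (g (t *\<^sub>R v + s *\<^sub>R w)) powr p \<partial>L) = (\<integral>t. norm (g (t *\<^sub>R v + s *\<^sub>R w)) powr p \<partial>lborel)"
        using out by (intro r) auto
      also have "(\<integral>t. norm (g (t *\<^sub>R v + s *\<^sub>R w)) \<partial>L) = (\<integral>t. norm (g (t *\<^sub>R v + s *\<^sub>R w)) \<partial>lborel)"
        using out by (intro r) auto
      finally show ?case by simp
    qed
  qed measurable
qed

text \<open>The value of a function is at most the integral of its derivative along the line through the point, a
quantity that depends on the other coordinate only.\<close>

lemma boxder_bound_by_line:
  assumes ax: "axes v w" and d: "boxder v u g" and g: "Lp M p g" and p: "1 \<le> p"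
  obtains h :: "real \<Rightarrow> real" where "integrable lborel (\<lambda>s. h s powr p)" "\<And>s. 0 \<le> h s" "AE z in M. norm (u z) \<le> h (z \<bullet> w)"
proof -
  have gm: "g \<in> borel_measurable M" using g by (simp add: Lp_def)
  obtain g0 where g0: "g0 \<in> borel_measurable borel" "AE z in M. g z = g0 z" "\<And>z. z \<notin> Q \<Longrightarrow> g0 z = 0"
    by (rule borel_representative[OF gm]) (rule that)
  note [measurable] = g0(1)
  have g0M: "g0 \<in> borel_measurable M" by (rule borel_measurable_M) simp
  have d0: "boxder v u g0" by (rule boxder_cong_AE[OF d g0(2) g0M])
  have L0: "Lp M p g0" by (rule Lp_dominated[OF g g0M, where C=1]) (use p g0(2) in \<open>auto elim: eventually_mono\<close>)
  define h where "h s = (\<integral>t. norm (g0 (t *\<^sub>R v + s *\<^sub>R w)) \<partial>lborel)" for s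
  have "AE s in lborel. integrable lborel (\<lambda>t. g0 (t *\<^sub>R v + s *\<^sub>R w))"
    by (rule line_integral_Lp(2)[OF ax g0(1,3) L0 p])
  then obtain N where N: "N \<in> null_sets lborel" "{s. \<not> integrable lborel (\<lambda>t. g0 (t *\<^sub>R v + s *\<^sub>R w))} \<subseteq> N"
    by (auto elim: AE_E3 simp: eventually_ae_filter)
  have "AE z in lborel. z \<bullet> w \<notin> N"
  proof -
    have [measurable]: "N \<in> sets borel" using N by auto
    have "(\<lambda>z. z \<bullet> w) -` N \<in> sets borel" using measurable_sets[of "\<lambda>z::complex. z \<bullet> w" borel borel N] by simp
    have "emeasure lborel {z::complex. z \<bullet> w \<in> N} = emeasure (lborel \<Otimes>\<^sub>M lborel) {x \<in> space (lborel \<Otimes>\<^sub>M lborel). (fst x *\<^sub>R v + snd x *\<^sub>R w) \<bullet> w \<in> N}"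
      by (subst lborel_axes[OF ax], subst emeasure_distr) (auto simp: space_pair_measure vimage_def)
    also have "{x \<in> space (lborel \<Otimes>\<^sub>M lborel). (fst x *\<^sub>R v + snd x *\<^sub>R w) \<bullet> w \<in> N} = UNIV \<times> N"
      using ax by (auto simp: space_pair_measure axes_inner)
    also have "emeasure (lborel \<Otimes>\<^sub>M lborel) (UNIV \<times> N) = 0"
      using N(1) by (subst lborel.emeasure_pair_measure_Times) auto
    finally have "{z::complex. z \<bullet> w \<in> N} \<in> null_sets lborel" by (intro null_setsI) auto
    from AE_not_in[OF this] show ?thesis by simp
  qed
  then have "AE z in lebesgue. z \<bullet> w \<notin> N" by (rule AE_completion)
  then have "AE z in M. z \<bullet> w \<notin> N" by (rule AE_M_lebesgue)
  moreover have "AE z in M. u z = line_prim v w g0 z" by (rule boxder_primitive[OF ax d0 g0(1,3)])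
  ultimately have "AE z in M. norm (u z) \<le> h (z \<bullet> w)"
  proof eventually_elim
    case (elim z)
    then show ?case unfolding h_def elim using N(2) by (intro norm_line_prim_le) auto
  qed
  moreover have "integrable lborel (\<lambda>s. h s powr p)"
    unfolding h_def by (rule line_integral_Lp(1)[OF ax g0(1,3) L0 p])
  ultimately show thesis using that[of h] by (simp add: h_def)
qed

text \<open>The product argument of Gagliardo and Nirenberg: \<open>|u|\<close> is bounded by a function of \<open>y\<close> and by
a function of \<open>x\<close>, both in \<open>L\<^sup>p\<close>; so \<open>|u| powr (2 p)\<close> is bounded by an integrable product. Applying
Jensen's inequality on lines beforehand avoids a chain rule for \<open>|u| powr p\<close>.\<close>

lemma sobolev:
  assumes dx: "boxder 1 u ux" and dy: "boxder \<i> u uy" and p: "1 \<le> p" and ux: "Lp M p ux" and uy: "Lp M p uy"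
  shows "Lp M (2 * p) u"
proof -
  have ax: "axes 1 \<i>" "axes \<i> 1" by (auto simp: axes_def)
  obtain h where h: "integrable lborel (\<lambda>s. h s powr p)" "\<And>s. 0 \<le> h s" "AE z in M. norm (u z) \<le> h (z \<bullet> \<i>)"
    using boxder_bound_by_line[OF ax(1) dx ux p] by blast
  obtain k where k: "integrable lborel (\<lambda>s. k s powr p)" "\<And>s. 0 \<le> k s" "AE z in M. norm (u z) \<le> k (z \<bullet> 1)"
    using boxder_bound_by_line[OF ax(2) dy uy p] by blast
  have hk [measurable]: "(\<lambda>s. h s powr p) \<in> borel_measurable borel" "(\<lambda>s. k s powr p) \<in> borel_measurable borel"
    using h(1) k(1) by (auto dest: borel_measurable_integrable)
  define H where "H z = h (z \<bullet> \<i>) powr p * k (z \<bullet> 1) powr p" for z :: complex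
  have Hm: "H \<in> borel_measurable borel" unfolding H_def[abs_def] by measurable
  have "integrable lborel (\<lambda>s. complex_of_real (h s powr p))" "integrable lborel (\<lambda>s. complex_of_real (k s powr p))"
    using h(1) k(1) by auto
  from integrable_Re[OF pair_integral_prod(1)[OF this(2) this(1)]]
  have "integrable (lborel \<Otimes>\<^sub>M lborel) (\<lambda>x. k (fst x) powr p * h (snd x) powr p)" by simp
  then have Hi: "integrable lborel H"
    by (subst integrable_axes_iff[OF ax(1) Hm]) (simp add: H_def axes_inner[OF ax(1)] mult.commute)
  have "integrable M H"
    unfolding integral_M_borel(2)[OF Hm]
    by (rule Bochner_Integration.integrable_bound[OF Hi]) (use Hm in \<open>auto simp: indicator_def\<close>)
  then show ?thesis
  proof (rule Lp_dominated_by)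
    show "u \<in> borel_measurable M" using dx by (auto simp: boxder_def)
    show "AE z in M. norm (u z) powr (2 * p) \<le> H z"
      using h(3) k(3)
    proof eventually_elim
      case (elim z)
      have "norm (u z) powr (2 * p) = norm (u z) powr p * norm (u z) powr p"
        by (simp add: powr_add[symmetric])
      also have "\<dots> \<le> H z" unfolding H_def using elim p by (intro mult_mono powr_mono2) auto
      finally show ?case .
    qed
  qed
qed

end

section \<open>Continuous representatives\<close>

text \<open>Averages are taken with a continuous kernel, so that they depend continuously on the centre.\<close>

definition tent :: "real \<Rightarrow> real \<Rightarrow> real" where "tent r x = max 0 (1 - \<bar>x / r\<bar>) / r"

lemma tent_nonneg: "0 < r \<Longrightarrow> 0 \<le> tent r x" by (simp add: tent_def)
lemma tent_le: "0 < r \<Longrightarrow> tent r x \<le> 1 / r" by (simp add: tent_def divide_right_mono)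
lemma tent_zero: "0 < r \<Longrightarrow> r \<le> \<bar>x\<bar> \<Longrightarrow> tent r x = 0"
  by (simp add: tent_def max_def field_simps)
lemma tent_even: "tent r (- x) = tent r x" by (simp add: tent_def)
lemma continuous_tent: "continuous_on UNIV (tent r)"
  unfolding tent_def divide_inverse by (intro continuous_intros)
lemma tent_measurable [measurable]: "tent r \<in> borel_measurable borel"
  by (rule borel_measurable_continuous_onI[OF continuous_tent])

lemma tent_one: "has_bochner_integral lborel (tent 1) 1"
proof -
  have 1: "has_bochner_integral lborel (\<lambda>x. indicator {-1..0} x *\<^sub>R (1 + x)) ((0 + 0\<^sup>2/2) - (- 1 + (-1)\<^sup>2/2) :: real)"
    by (rule has_bochner_integral_FTC_Icc)
      (auto intro!: continuous_intros derivative_eq_intros simp: has_real_derivative_iff_has_vector_derivative[symmetric])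
  have 2: "has_bochner_integral lborel (\<lambda>x. indicator {0..1} x *\<^sub>R (1 - x)) ((1 - 1\<^sup>2/2) - (0 - 0\<^sup>2/2) :: real)"
    by (rule has_bochner_integral_FTC_Icc)
      (auto intro!: continuous_intros derivative_eq_intros simp: has_real_derivative_iff_has_vector_derivative[symmetric])
  have s: "has_bochner_integral lborel (\<lambda>x. indicator {-1..0} x *\<^sub>R (1 + x) + indicator {0..1} x *\<^sub>R (1 - x)) (1::real)"
    using has_bochner_integral_add[OF 1 2] by simp
  have "AE x in lborel. x \<notin> {0::real}" by (intro AE_not_in countable_imp_null_set_lborel) auto
  then have "AE x in lborel. indicator {-1..0} x *\<^sub>R (1 + x) + indicator {0..1} x *\<^sub>R (1 - x) = tent 1 x"
    by eventually_elim (auto simp: tent_def indicator_def)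
  then show ?thesis using s by (subst (asm) has_bochner_integral_cong_AE) auto
qed

lemma tent_integral:
  assumes "0 < r"
  shows "integrable lborel (\<lambda>x. tent r (x - y))" "(\<integral>x. tent r (x - y) \<partial>lborel) = 1"
proof -
  have eq: "tent r (y + r * x - y) = tent 1 x / r" for x using assms by (simp add: tent_def)
  show "integrable lborel (\<lambda>x. tent r (x - y))"
  proof -
    have "integrable lborel (\<lambda>x. tent r (y + r * x - y))"
      unfolding eq using tent_one by (auto simp: has_bochner_integral_iff)
    then show ?thesis using lborel_integrable_real_affine_iff[of r "\<lambda>x. tent r (x - y)" y] assms by simp
  qed
  have "(\<integral>x. tent r (x - y) \<partial>lborel) = r * (\<integral>x. tent 1 x / r \<partial>lborel)"
    using lborel_integral_real_affine[of r "\<lambda>x. tent r (x - y)" y] assms unfolding eq by simp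
  then show "(\<integral>x. tent r (x - y) \<partial>lborel) = 1"
    using tent_one assms by (simp add: has_bochner_integral_iff)
qed

text \<open>The difference of two kernels of total mass one has a primitive that is supported in the
larger interval.\<close>

lemma tent_tail:
  fixes p b r :: real
  assumes r: "0 < r" and b: "p + r \<le> b"
  defines "k \<equiv> \<lambda>x. tent r (x - p) - tent (r / 2) (x - p)"
  shows "\<bar>\<integral>x. (if y \<le> x \<and> x \<le> b then k x else 0) \<partial>lborel\<bar> \<le> 2"
    and "r < \<bar>y - p\<bar> \<Longrightarrow> (\<integral>x. (if y \<le> x \<and> x \<le> b then k x else 0) \<partial>lborel) = 0"
proof -
  have r2: "0 < r / 2" using r by simp
  have [measurable]: "k \<in> borel_measurable borel" unfolding k_def by measurable
  have k0: "k x = 0" if "r \<le> \<bar>x - p\<bar>" for x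
    unfolding k_def using that r tent_zero[OF r] tent_zero[OF r2] by simp
  have "\<bar>\<integral>x. (if y \<le> x \<and> x \<le> b then k x else 0) \<partial>lborel\<bar> \<le> (\<integral>x. \<bar>if y \<le> x \<and> x \<le> b then k x else 0\<bar> \<partial>lborel)"
    using integral_norm_bound[of lborel "\<lambda>x. if y \<le> x \<and> x \<le> b then k x else 0"] by simp
  also have "\<dots> \<le> (\<integral>x. tent r (x - p) + tent (r / 2) (x - p) \<partial>lborel)"
  proof (rule integral_mono')
    show "integrable lborel (\<lambda>x. tent r (x - p) + tent (r / 2) (x - p))"
      using tent_integral(1)[OF r] tent_integral(1)[OF r2] by simp
    fix x
    show "\<bar>if y \<le> x \<and> x \<le> b then k x else 0\<bar> \<le> tent r (x - p) + tent (r / 2) (x - p)"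
      using tent_nonneg[OF r, of "x - p"] tent_nonneg[OF r2, of "x - p"] by (auto simp: k_def)
    show "0 \<le> tent r (x - p) + tent (r / 2) (x - p)"
      using tent_nonneg[OF r, of "x - p"] tent_nonneg[OF r2, of "x - p"] by simp
  qed
  also have "\<dots> = 2" using tent_integral[OF r] tent_integral[OF r2] by simp
  finally show "\<bar>\<integral>x. (if y \<le> x \<and> x \<le> b then k x else 0) \<partial>lborel\<bar> \<le> 2" .
  assume y: "r < \<bar>y - p\<bar>"
  show "(\<integral>x. (if y \<le> x \<and> x \<le> b then k x else 0) \<partial>lborel) = 0"
  proof (cases "p < y")
    case True
    then have "(if y \<le> x \<and> x \<le> b then k x else 0) = 0" for x using y by (auto intro!: k0)
    then show ?thesis by simp
  next
    case False
    then have "(if y \<le> x \<and> x \<le> b then k x else 0) = k x" for x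
      using y b by (cases "y \<le> x \<and> x \<le> b") (auto intro!: k0)
    then have "(\<integral>x. (if y \<le> x \<and> x \<le> b then k x else 0) \<partial>lborel) = (\<integral>x. k x \<partial>lborel)" by simp
    also have "\<dots> = 0" unfolding k_def using tent_integral[OF r] tent_integral[OF r2] by simp
    finally show ?thesis .
  qed
qed

context square begin

definition tent_avg :: "(complex \<Rightarrow> complex) \<Rightarrow> real \<Rightarrow> complex \<Rightarrow> complex" where
  "tent_avg u r z = (\<integral>\<zeta>. u \<zeta> * of_real (tent r (\<zeta> \<bullet> 1 - z \<bullet> 1) * tent r (\<zeta> \<bullet> \<i> - z \<bullet> \<i>)) \<partial>M)"

text \<open>Integration by parts moves the derivative from the primitive of the kernel difference to \<open>u\<close>: the
pairing is at most \<open>4 / r\<close> times the integral of \<open>|g|\<close> over a square of side \<open>2 r\<close>. Hoelder's inequality with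
exponent \<open>4\<close> bounds that integral by a multiple of \<open>r powr (3/2)\<close>.\<close>

lemma tent_difference_pairing:
  assumes ax: "axes v w" and d: "boxder v u g" and g4: "Lp M 4 g"
    and r: "0 < r" and p: "c \<bullet> v \<le> p \<bullet> v - r" "p \<bullet> v + r \<le> c \<bullet> v + l"
    and k2 [measurable]: "k2 \<in> borel_measurable borel" and k2b: "\<And>y. \<bar>k2 y\<bar> \<le> 2 / r"
    and k20: "\<And>y. r < \<bar>y - p \<bullet> w\<bar> \<Longrightarrow> k2 y = 0"
  shows "norm (\<integral>\<zeta>. u \<zeta> * of_real ((tent r (\<zeta> \<bullet> v - p \<bullet> v) - tent (r/2) (\<zeta> \<bullet> v - p \<bullet> v)) * k2 (\<zeta> \<bullet> w)) \<partial>M)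
    \<le> 16 * sqrt r * (\<integral>z. norm (g z) powr 4 \<partial>M) powr (1/4)"
proof -
  have gm: "g \<in> borel_measurable M" using g4 by (simp add: Lp_def)
  obtain g0 where g0: "g0 \<in> borel_measurable borel" "AE z in M. g z = g0 z" "\<And>z. z \<notin> Q \<Longrightarrow> g0 z = 0"
    by (rule borel_representative[OF gm]) (rule that)
  note [measurable] = g0(1)
  have g0M [measurable]: "g0 \<in> borel_measurable M" by (rule borel_measurable_M) simp
  have d0: "boxder v u g0" by (rule boxder_cong_AE[OF d g0(2) g0M])
  have L0: "Lp M 4 g0" by (rule Lp_dominated[OF g4 g0M, where C=1]) (use g0(2) in \<open>auto elim: eventually_mono\<close>)
  have "integrable M g0" using d0 by (simp add: boxder_def)
  then have gi: "integrable lborel g0" using integral_M_vanish(2)[OF g0(1,3)] by simp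
  define k where "k x = tent r (x - p \<bullet> v) - tent (r / 2) (x - p \<bullet> v)" for x
  have [measurable]: "k \<in> borel_measurable borel" unfolding k_def by measurable
  have r2: "0 < r / 2" using r by simp
  have kb: "\<bar>k x\<bar> \<le> 3 / r" for x
  proof -
    have "tent (r / 2) (x - p \<bullet> v) \<le> 2 / r" "0 < 1 / r" "0 < 2 / r"
      using tent_le[OF r2, of "x - p \<bullet> v"] r by auto
    then have "\<bar>k x\<bar> \<le> 1 / r + 2 / r" unfolding k_def
      using tent_nonneg[OF r, of "x - p \<bullet> v"] tent_nonneg[OF r2, of "x - p \<bullet> v"]
        tent_le[OF r, of "x - p \<bullet> v"] by linarith
    then show ?thesis by (simp add: add_divide_distrib[symmetric])
  qed
  define m where "m z = complex_of_real (k (z \<bullet> v) * k2 (z \<bullet> w))" for z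
  have m [measurable]: "m \<in> borel_measurable borel" unfolding m_def by measurable
  have mb: "norm (m z) \<le> 3 / r * (2 / r)" for z
    unfolding m_def norm_of_real abs_mult using r by (intro mult_mono kb k2b) auto
  define Box where "Box = cbox (p - Complex r r) (p + Complex r r)"
  have Box: "z \<in> Box \<longleftrightarrow> \<bar>z \<bullet> v - p \<bullet> v\<bar> \<le> r \<and> \<bar>z \<bullet> w - p \<bullet> w\<bar> \<le> r" for z
    using ax by (auto simp: Box_def in_cbox_complex_iff axes_def inner_complex_def abs_le_iff)
  have LB: "Lp M (4/3) (\<lambda>z. indicator Box z)"
  proof (rule Lp_bounded[OF finite_M, where B=1])
    show "indicator Box \<in> borel_measurable M" by (intro borel_measurable_M) (simp add: Box_def)
    show "AE z in M. norm (indicator Box z :: complex) \<le> 1" by (rule AE_I2) (simp add: indicator_def)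
  qed simp
  have cop: "norm (line_tail v w m z) \<le> 4 / r * indicator Box z" for z
  proof -
    have "line_tail v w m z = (\<integral>x. of_real (k2 (z \<bullet> w) * (if z \<bullet> v \<le> x \<and> x \<le> c \<bullet> v + l then k x else 0)) \<partial>lborel)"
      unfolding line_tail_def m_def axes_inner[OF ax]
      by (intro Bochner_Integration.integral_cong refl) (simp add: mult.commute)
    also have "\<dots> = of_real (k2 (z \<bullet> w) * (\<integral>x. (if z \<bullet> v \<le> x \<and> x \<le> c \<bullet> v + l then k x else 0) \<partial>lborel))"
      by (simp only: integral_complex_of_real integral_mult_right_zero)
    finally have eq: "norm (line_tail v w m z) = \<bar>k2 (z \<bullet> w)\<bar> * \<bar>\<integral>x. (if z \<bullet> v \<le> x \<and> x \<le> c \<bullet> v + l then k x else 0) \<partial>lborel\<bar>"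
      by (simp only: norm_of_real abs_mult)
    note tail = tent_tail[OF r p(2), of "z \<bullet> v", folded k_def]
    show ?thesis
    proof (cases "z \<in> Box")
      case True
      have "norm (line_tail v w m z) \<le> 2 / r * 2" unfolding eq using r by (intro mult_mono k2b tail) auto
      then show ?thesis using True by simp
    next
      case False
      then have "r < \<bar>z \<bullet> v - p \<bullet> v\<bar> \<or> r < \<bar>z \<bullet> w - p \<bullet> w\<bar>" by (auto simp: Box)
      then have "norm (line_tail v w m z) = 0" unfolding eq using tail(2) k20 by auto
      then show ?thesis using r by simp
    qed
  qed
  have pr: "AE z in M. u z = line_prim v w g0 z" by (rule boxder_primitive[OF ax d0 g0(1,3)])
  have "(\<integral>\<zeta>. u \<zeta> * m \<zeta> \<partial>M) = (\<integral>\<zeta>. line_prim v w g0 \<zeta> * m \<zeta> \<partial>M)"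
  proof (rule integral_cong_AE)
    have mM: "m \<in> borel_measurable M" by (rule borel_measurable_M) simp
    show "(\<lambda>\<zeta>. u \<zeta> * m \<zeta>) \<in> borel_measurable M" using d mM by (auto simp: boxder_def)
    show "(\<lambda>\<zeta>. line_prim v w g0 \<zeta> * m \<zeta>) \<in> borel_measurable M" by (rule borel_measurable_M) measurable
    show "AE \<zeta> in M. u \<zeta> * m \<zeta> = line_prim v w g0 \<zeta> * m \<zeta>"
      using pr by eventually_elim simp
  qed
  also have "\<dots> = (\<integral>z. g0 z * line_tail v w m z \<partial>M)"
    by (rule line_prim_pairing(2)[OF ax g0(1) g0(3) gi m mb])
  finally have "norm (\<integral>\<zeta>. u \<zeta> * m \<zeta> \<partial>M) \<le> (\<integral>z. norm (g0 z * line_tail v w m z) \<partial>M)"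
    by (simp only: integral_norm_bound)
  also have "\<dots> \<le> (\<integral>z. 4 / r * norm (g0 z * indicator Box z) \<partial>M)"
  proof (rule integral_mono')
    from Hoelder(1)[OF _ _ _ L0 LB]
    show "integrable M (\<lambda>z. 4 / r * norm (g0 z * indicator Box z))" by simp
    fix z
    have "norm (g0 z) * norm (line_tail v w m z) \<le> norm (g0 z) * (4 / r * indicator Box z)"
      by (intro mult_left_mono cop) auto
    then show "norm (g0 z * line_tail v w m z) \<le> 4 / r * norm (g0 z * indicator Box z)"
      by (cases "z \<in> Box") (simp_all add: norm_mult mult.commute)
  qed (use r in simp)
  also have "\<dots> = 4 / r * (\<integral>z. norm (g0 z * indicator Box z) \<partial>M)" by simp
  also have "\<dots> \<le> 4 / r * ((\<integral>z. norm (g0 z) powr 4 \<partial>M) powr (1/4) * (4 * r\<^sup>2) powr (3/4))"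
  proof (intro mult_left_mono)
    have BI: "(\<integral>z. norm (indicator Box z :: complex) powr (4/3) \<partial>M) \<le> 4 * r\<^sup>2"
    proof -
      have "(\<integral>z. norm (indicator Box z :: complex) powr (4/3) \<partial>M) = (\<integral>z. indicator Box z \<partial>M)"
        by (intro Bochner_Integration.integral_cong refl) (simp add: indicator_def)
      also have "\<dots> = (\<integral>z. indicator Q z *\<^sub>R indicator Box z \<partial>lborel)"
        by (rule integral_M_borel(1)) (simp add: Box_def)
      also have "\<dots> \<le> (\<integral>z. indicator Box z \<partial>lborel)"
      proof (rule integral_mono')
        show "integrable lborel (indicator Box :: complex \<Rightarrow> real)"
        proof (rule integrable_real_indicator)
          show "emeasure lborel Box < \<infinity>" unfolding Box_def by (rule emeasure_lborel_cbox_finite)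
        qed (simp add: Box_def)
      qed (auto simp: indicator_def)
      also have "\<dots> = measure lborel Box" by simp
      also have "\<dots> = 4 * r\<^sup>2" unfolding Box_def using r
        by (subst measure_lborel_cbox) (auto simp: Basis_complex_def inner_complex_def power2_eq_square)
      finally show ?thesis .
    qed
    have "(\<integral>z. norm (g0 z * indicator Box z) \<partial>M) \<le> (\<integral>z. norm (g0 z) powr 4 \<partial>M) powr (1/4) *
       (\<integral>z. norm (indicator Box z :: complex) powr (4/3) \<partial>M) powr (1/(4/3))"
      by (rule Hoelder(2)[OF _ _ _ L0 LB]) auto
    also have "\<dots> \<le> (\<integral>z. norm (g0 z) powr 4 \<partial>M) powr (1/4) * (4 * r\<^sup>2) powr (1/(4/3))"
      by (intro mult_left_mono powr_mono2 BI) auto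
    finally show "(\<integral>z. norm (g0 z * indicator Box z) \<partial>M) \<le> (\<integral>z. norm (g0 z) powr 4 \<partial>M) powr (1/4) * (4 * r\<^sup>2) powr (3/4)"
      by simp
  qed (use r in auto)
  also have "\<dots> = (4 / r * (4 * r\<^sup>2) powr (3/4)) * (\<integral>z. norm (g0 z) powr 4 \<partial>M) powr (1/4)" by simp
  also have "\<dots> \<le> (16 * sqrt r) * (\<integral>z. norm (g0 z) powr 4 \<partial>M) powr (1/4)"
  proof (rule mult_right_mono)
    have "(r\<^sup>2) powr (3/4) = (r powr 2) powr (3/4)" using r by simp
    also have "\<dots> = r powr (3/2)" using r by (simp only: powr_powr) simp
    finally have r34: "(r\<^sup>2) powr (3/4) = r powr (3/2)" .
    have "(4 * r\<^sup>2) powr (3/4) = 4 powr (3/4) * r powr (3/2)" using r by (simp add: powr_mult r34)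
    also have "\<dots> \<le> 4 powr 1 * r powr (3/2)" by (intro mult_right_mono powr_mono) auto
    finally have "4 / r * (4 * r\<^sup>2) powr (3/4) \<le> 4 / r * (4 * r powr (3/2))" using r by (intro mult_left_mono) auto
    also have "\<dots> = 16 * (r powr (3/2) / r powr 1)" using r by simp
    also have "r powr (3/2) / r powr 1 = r powr (1/2)" using r by (simp only: powr_diff[symmetric]) simp
    finally show "4 / r * (4 * r\<^sup>2) powr (3/4) \<le> 16 * sqrt r" using r by (simp add: powr_half_sqrt)
  qed simp
  also have "(\<integral>z. norm (g0 z) powr 4 \<partial>M) = (\<integral>z. norm (g z) powr 4 \<partial>M)"
    using g0(2) gm by (intro integral_cong_AE) (auto elim: eventually_mono)
  finally show ?thesis by (simp only: m_def k_def)
qed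

lemma integrable_times_bounded:
  fixes u b :: "complex \<Rightarrow> complex"
  assumes u: "integrable M u" and b: "b \<in> borel_measurable M" "\<And>z. norm (b z) \<le> B"
  shows "integrable M (\<lambda>z. u z * b z)"
proof (rule Bochner_Integration.integrable_bound[of _ "\<lambda>z. B * norm (u z)"])
  have B0: "0 \<le> B" using order_trans[OF norm_ge_zero b(2)] .
  show "AE z in M. norm (u z * b z) \<le> norm (B * norm (u z))"
    using b(2) B0 by (intro AE_I2) (simp add: norm_mult mult.commute mult_right_mono)
qed (use u b in auto)

text \<open>The kernel of the average is a product, so its scale is halved in one variable at a time.\<close>

lemma tent_avg_halving:
  assumes dx: "boxder 1 u ux" and dy: "boxder \<i> u uy" and ux: "Lp M 4 ux" and uy: "Lp M 4 uy"
    and r: "0 < r" and z: "c \<bullet> 1 \<le> z \<bullet> 1 - r" "z \<bullet> 1 + r \<le> c \<bullet> 1 + l" "c \<bullet> \<i> \<le> z \<bullet> \<i> - r" "z \<bullet> \<i> + r \<le> c \<bullet> \<i> + l"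
  shows "norm (tent_avg u (r/2) z - tent_avg u r z) \<le>
    16 * sqrt r * ((\<integral>z. norm (ux z) powr 4 \<partial>M) powr (1/4) + (\<integral>z. norm (uy z) powr 4 \<partial>M) powr (1/4))"
proof -
  have ax: "axes 1 \<i>" "axes \<i> 1" by (auto simp: axes_def)
  have r2: "0 < r / 2" using r by simp
  have u: "integrable M u" using dx by (simp add: boxder_def)
  define X Y where "X s \<zeta> = tent s (\<zeta> \<bullet> 1 - z \<bullet> 1)" and "Y s \<zeta> = tent s (\<zeta> \<bullet> \<i> - z \<bullet> \<i>)" for s and \<zeta> :: complex
  have [measurable]: "X s \<in> borel_measurable borel" "Y s \<in> borel_measurable borel" for s
    unfolding X_def Y_def by measurable
  have bd: "\<bar>X s \<zeta>\<bar> \<le> 2 / r" "\<bar>Y s \<zeta>\<bar> \<le> 2 / r" if "s = r \<or> s = r / 2" for s \<zeta>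
    using that r tent_nonneg[of s "\<zeta> \<bullet> 1 - z \<bullet> 1"] tent_nonneg[of s "\<zeta> \<bullet> \<i> - z \<bullet> \<i>"]
      tent_le[of s "\<zeta> \<bullet> 1 - z \<bullet> 1"] tent_le[of s "\<zeta> \<bullet> \<i> - z \<bullet> \<i>"]
    by (auto simp: X_def Y_def intro: order_trans simp: field_simps)
  have int: "integrable M (\<lambda>\<zeta>. u \<zeta> * of_real (X s \<zeta> * Y t \<zeta>))" if "s = r \<or> s = r / 2" "t = r \<or> t = r / 2" for s t
  proof (rule integrable_times_bounded[OF u, where B="2 / r * (2 / r)"])
    show "(\<lambda>z. complex_of_real (X s z * Y t z)) \<in> borel_measurable M" by (rule borel_measurable_M) measurable
    show "norm (complex_of_real (X s \<zeta> * Y t \<zeta>)) \<le> 2 / r * (2 / r)" for \<zeta>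
      unfolding norm_of_real abs_mult using that r by (intro mult_mono bd) auto
  qed
  have T: "tent_avg u s z = (\<integral>\<zeta>. u \<zeta> * of_real (X s \<zeta> * Y s \<zeta>) \<partial>M)" for s
    by (simp only: tent_avg_def X_def Y_def)
  have "(\<integral>\<zeta>. u \<zeta> * of_real ((X r \<zeta> - X (r/2) \<zeta>) * Y r \<zeta>) \<partial>M) = (\<integral>\<zeta>. u \<zeta> * of_real (X r \<zeta> * Y r \<zeta>) - u \<zeta> * of_real (X (r/2) \<zeta> * Y r \<zeta>) \<partial>M)"
    by (simp only: left_diff_distrib right_diff_distrib of_real_diff)
  also have "\<dots> = tent_avg u r z - (\<integral>\<zeta>. u \<zeta> * of_real (X (r/2) \<zeta> * Y r \<zeta>) \<partial>M)"
    unfolding T by (intro Bochner_Integration.integral_diff int) auto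
  finally have 1: "tent_avg u r z - (\<integral>\<zeta>. u \<zeta> * of_real (X (r/2) \<zeta> * Y r \<zeta>) \<partial>M) = (\<integral>\<zeta>. u \<zeta> * of_real ((X r \<zeta> - X (r/2) \<zeta>) * Y r \<zeta>) \<partial>M)"
    by simp
  have "(\<integral>\<zeta>. u \<zeta> * of_real ((Y r \<zeta> - Y (r/2) \<zeta>) * X (r/2) \<zeta>) \<partial>M) = (\<integral>\<zeta>. u \<zeta> * of_real (X (r/2) \<zeta> * Y r \<zeta>) - u \<zeta> * of_real (X (r/2) \<zeta> * Y (r/2) \<zeta>) \<partial>M)"
    by (simp only: left_diff_distrib right_diff_distrib of_real_diff mult.commute[of _ "X (r/2) _"])
  also have "\<dots> = (\<integral>\<zeta>. u \<zeta> * of_real (X (r/2) \<zeta> * Y r \<zeta>) \<partial>M) - tent_avg u (r/2) z"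
    unfolding T by (intro Bochner_Integration.integral_diff int) auto
  finally have 2: "(\<integral>\<zeta>. u \<zeta> * of_real (X (r/2) \<zeta> * Y r \<zeta>) \<partial>M) - tent_avg u (r/2) z = (\<integral>\<zeta>. u \<zeta> * of_real ((Y r \<zeta> - Y (r/2) \<zeta>) * X (r/2) \<zeta>) \<partial>M)"
    by simp
  have n1: "norm (\<integral>\<zeta>. u \<zeta> * of_real ((X r \<zeta> - X (r/2) \<zeta>) * Y r \<zeta>) \<partial>M) \<le> 16 * sqrt r * (\<integral>z. norm (ux z) powr 4 \<partial>M) powr (1/4)"
    unfolding X_def Y_def
  proof (rule tent_difference_pairing[OF ax(1) dx ux r z(1,2), where ?k2.0="\<lambda>y. tent r (y - z \<bullet> \<i>)"])
    show "\<bar>tent r (y - z \<bullet> \<i>)\<bar> \<le> 2 / r" for y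
      using tent_nonneg[OF r, of "y - z \<bullet> \<i>"] tent_le[OF r, of "y - z \<bullet> \<i>"] r by (simp add: field_simps)
  qed (use tent_zero[OF r] in auto)
  have n2: "norm (\<integral>\<zeta>. u \<zeta> * of_real ((Y r \<zeta> - Y (r/2) \<zeta>) * X (r/2) \<zeta>) \<partial>M) \<le> 16 * sqrt r * (\<integral>z. norm (uy z) powr 4 \<partial>M) powr (1/4)"
    unfolding X_def Y_def
  proof (rule tent_difference_pairing[OF ax(2) dy uy r z(3,4), where ?k2.0="\<lambda>y. tent (r/2) (y - z \<bullet> 1)"])
    show "\<bar>tent (r/2) (y - z \<bullet> 1)\<bar> \<le> 2 / r" for y
      using tent_nonneg[OF r2, of "y - z \<bullet> 1"] tent_le[OF r2, of "y - z \<bullet> 1"] r by (simp add: field_simps)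
  qed (use tent_zero[OF r2] r in auto)
  have "norm (tent_avg u (r/2) z - tent_avg u r z) = norm (tent_avg u r z - tent_avg u (r/2) z)" by (rule norm_minus_commute)
  also have "\<dots> = norm ((tent_avg u r z - (\<integral>\<zeta>. u \<zeta> * of_real (X (r/2) \<zeta> * Y r \<zeta>) \<partial>M)) + ((\<integral>\<zeta>. u \<zeta> * of_real (X (r/2) \<zeta> * Y r \<zeta>) \<partial>M) - tent_avg u (r/2) z))"
    by simp
  also have "\<dots> \<le> 16 * sqrt r * (\<integral>z. norm (ux z) powr 4 \<partial>M) powr (1/4) + 16 * sqrt r * (\<integral>z. norm (uy z) powr 4 \<partial>M) powr (1/4)"
    unfolding 1 2 by (rule norm_triangle_le[OF add_mono[OF n1 n2]])
  finally show ?thesis by (simp only: distrib_left)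
qed

lemma continuous_tent_avg:
  assumes u: "integrable M u" and r: "0 < r"
  shows "continuous_on UNIV (tent_avg u r)"
proof (rule continuous_at_imp_continuous_on, intro ballI continuous_within_sequentiallyI)
  fix z :: complex and x :: "nat \<Rightarrow> complex" assume x: "x \<longlonglongrightarrow> z"
  have [measurable]: "u \<in> borel_measurable M" using u by auto
  have T: "continuous_on UNIV (\<lambda>\<zeta>. complex_of_real (tent r (\<zeta> \<bullet> 1 - y \<bullet> 1) * tent r (\<zeta> \<bullet> \<i> - y \<bullet> \<i>)))" for y
    by (intro continuous_intros continuous_on_compose2[OF continuous_tent]) auto
  have beurling_symbol [measurable]: "(\<lambda>\<zeta>. complex_of_real (tent r (\<zeta> \<bullet> 1 - y \<bullet> 1) * tent r (\<zeta> \<bullet> \<i> - y \<bullet> \<i>))) \<in> borel_measurable M" for y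
    by (rule continuous_measurable_M[OF T])
  show "(\<lambda>j. tent_avg u r (x j)) \<longlonglongrightarrow> tent_avg u r z"
    unfolding tent_avg_def
  proof (rule integral_dominated_convergence[where w="\<lambda>\<zeta>. norm (u \<zeta>) * (1 / r * (1 / r))"])
    show "AE \<zeta> in M. (\<lambda>j. u \<zeta> * of_real (tent r (\<zeta> \<bullet> 1 - x j \<bullet> 1) * tent r (\<zeta> \<bullet> \<i> - x j \<bullet> \<i>)))
      \<longlonglongrightarrow> u \<zeta> * of_real (tent r (\<zeta> \<bullet> 1 - z \<bullet> 1) * tent r (\<zeta> \<bullet> \<i> - z \<bullet> \<i>))"
      using continuous_tent[of r] x
      by (intro AE_I2 tendsto_intros isCont_tendsto_compose[of _ "tent r"]) (auto simp: continuous_on_eq_continuous_at)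
    show "AE \<zeta> in M. norm (u \<zeta> * of_real (tent r (\<zeta> \<bullet> 1 - x j \<bullet> 1) * tent r (\<zeta> \<bullet> \<i> - x j \<bullet> \<i>))) \<le> norm (u \<zeta>) * (1 / r * (1 / r))" for j
      unfolding norm_mult norm_of_real abs_mult using r tent_nonneg[OF r] tent_le[OF r]
      by (intro AE_I2 mult_left_mono mult_mono) (auto simp: abs_of_nonneg)
    show "(\<lambda>\<zeta>. u \<zeta> * of_real (tent r (\<zeta> \<bullet> 1 - z \<bullet> 1) * tent r (\<zeta> \<bullet> \<i> - z \<bullet> \<i>))) \<in> borel_measurable M"
      by (rule borel_measurable_times[OF _ beurling_symbol]) simp
    show "(\<lambda>\<zeta>. u \<zeta> * of_real (tent r (\<zeta> \<bullet> 1 - x j \<bullet> 1) * tent r (\<zeta> \<bullet> \<i> - x j \<bullet> \<i>))) \<in> borel_measurable M" for j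
      by (rule borel_measurable_times[OF _ beurling_symbol]) simp
  qed (use u in auto)
qed

lemma tent_product_integral:
  assumes r: "0 < r"
  shows "integrable lborel (\<lambda>z::complex. tent r (\<zeta> \<bullet> 1 - z \<bullet> 1) * tent r (\<zeta> \<bullet> \<i> - z \<bullet> \<i>))"
    and "(\<integral>z. tent r (\<zeta> \<bullet> 1 - z \<bullet> 1) * tent r (\<zeta> \<bullet> \<i> - z \<bullet> \<i>) \<partial>lborel) = 1"
proof -
  have ax: "axes 1 \<i>" by (simp add: axes_def)
  have sym: "tent r (a - b) = tent r (b - a)" for a b using tent_even[of r "a - b"] by simp
  define f where "f z = complex_of_real (tent r (\<zeta> \<bullet> 1 - z \<bullet> 1) * tent r (\<zeta> \<bullet> \<i> - z \<bullet> \<i>))" for z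
  have fm: "f \<in> borel_measurable borel" unfolding f_def by measurable
  have i: "integrable lborel (\<lambda>t. complex_of_real (tent r (a - t)))" "(\<integral>t. complex_of_real (tent r (a - t)) \<partial>lborel) = 1" for a
    using tent_integral[OF r, of a] by (auto simp: sym[of a])
  have eq: "f (fst x *\<^sub>R 1 + snd x *\<^sub>R \<i>) = complex_of_real (tent r (\<zeta> \<bullet> 1 - fst x)) * complex_of_real (tent r (\<zeta> \<bullet> \<i> - snd x))" for x
    unfolding f_def axes_inner[OF ax] by simp
  have fi: "integrable lborel f"
    unfolding integrable_axes_iff[OF ax fm] eq by (rule pair_integral_prod(1)[OF i(1) i(1)])
  have "(\<integral>z. f z \<partial>lborel) = (\<integral>x. f (fst x *\<^sub>R 1 + snd x *\<^sub>R \<i>) \<partial>(lborel \<Otimes>\<^sub>M lborel))"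
    by (subst lborel_axes[OF ax], subst integral_distr) (use fm in auto)
  also have "\<dots> = 1" unfolding eq pair_integral_prod(2)[OF i(1) i(1)] i(2) by simp
  finally have "(\<integral>z. f z \<partial>lborel) = 1" .
  then have "complex_of_real (\<integral>z. tent r (\<zeta> \<bullet> 1 - z \<bullet> 1) * tent r (\<zeta> \<bullet> \<i> - z \<bullet> \<i>) \<partial>lborel) = of_real 1"
    unfolding f_def integral_complex_of_real by simp
  then show "(\<integral>z. tent r (\<zeta> \<bullet> 1 - z \<bullet> 1) * tent r (\<zeta> \<bullet> \<i> - z \<bullet> \<i>) \<partial>lborel) = 1" by (simp only: of_real_eq_iff)
  show "integrable lborel (\<lambda>z::complex. tent r (\<zeta> \<bullet> 1 - z \<bullet> 1) * tent r (\<zeta> \<bullet> \<i> - z \<bullet> \<i>))"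
    using integrable_Re[OF fi] by (simp add: f_def)
qed

text \<open>By symmetry of the kernel the average can be moved to the continuous function \<open>\<psi>\<close>, where it
converges pointwise.\<close>

lemma tent_avg_weak_limit:
  assumes u: "integrable M u" and \<psi>: "continuous_on UNIV \<psi>" "\<And>z. z \<notin> Q \<Longrightarrow> \<psi> z = 0" "\<And>z. norm (\<psi> z) \<le> B"
    and r: "\<And>j. 0 < r j" "r \<longlonglongrightarrow> 0"
  shows "(\<lambda>j. \<integral>z. tent_avg u (r j) z * \<psi> z \<partial>M) \<longlonglongrightarrow> (\<integral>z. u z * \<psi> z \<partial>M)"
proof -
  define T where "T s \<zeta> z = tent s (\<zeta> \<bullet> 1 - z \<bullet> 1) * tent s (\<zeta> \<bullet> \<i> - z \<bullet> \<i>)" for s and \<zeta> z :: complex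
  have um [measurable]: "u \<in> borel_measurable M" using u by auto
  have \<psi>b [measurable]: "\<psi> \<in> borel_measurable borel" using \<psi>(1) by (rule borel_measurable_continuous_onI)
  have \<psi>m [measurable]: "\<psi> \<in> borel_measurable M" by (rule borel_measurable_M) simp
  have in1 [measurable]: "(\<lambda>z. z \<bullet> 1) \<in> borel_measurable M" "(\<lambda>z. z \<bullet> \<i>) \<in> borel_measurable M"
    by (auto intro!: continuous_measurable_M continuous_intros)
  have B0: "0 \<le> B" using order_trans[OF norm_ge_zero \<psi>(3)] .
  interpret MM: pair_sigma_finite M M by unfold_locales
  define \<Psi> where "\<Psi> s \<zeta> = (\<integral>z. of_real (T s \<zeta> z) * \<psi> z \<partial>M)" for s \<zeta>
  have T0: "0 \<le> T s \<zeta> z" if "0 < s" for s \<zeta> z using tent_nonneg[OF that] by (simp add: T_def)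
  have Tle: "T s \<zeta> z \<le> 1 / s * (1 / s)" if "0 < s" for s \<zeta> z
    unfolding T_def using tent_nonneg[OF that] tent_le[OF that] that by (intro mult_mono) auto
  have Tb [measurable]: "(\<lambda>z. T s \<zeta> z) \<in> borel_measurable borel" for s \<zeta> unfolding T_def by measurable
  have Ti: "integrable lborel (\<lambda>z. T s \<zeta> z)" "(\<integral>z. T s \<zeta> z \<partial>lborel) = 1" if "0 < s" for s \<zeta>
    unfolding T_def by (rule tent_product_integral[OF that])+
  have T\<psi>i: "integrable lborel (\<lambda>z. of_real (T s \<zeta> z) * f z)" if "0 < s" "f \<in> borel_measurable borel" "\<And>z. norm (f z) \<le> C" for s \<zeta> C and f :: "complex \<Rightarrow> complex"
  proof (rule Bochner_Integration.integrable_bound)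
    show "integrable lborel (\<lambda>z. C * T s \<zeta> z)" using Ti(1)[OF that(1)] by simp
    show "AE z in lborel. norm (of_real (T s \<zeta> z) * f z) \<le> norm (C * T s \<zeta> z)"
    proof (rule AE_I2)
      fix z
      have "T s \<zeta> z * norm (f z) \<le> T s \<zeta> z * C" using T0[OF that(1)] that(3) by (intro mult_left_mono)
      also have "\<dots> \<le> norm (C * T s \<zeta> z)" by (simp add: mult.commute)
      finally show "norm (of_real (T s \<zeta> z) * f z) \<le> norm (C * T s \<zeta> z)" using T0[OF that(1)] by (simp add: norm_mult)
    qed
  qed (use that in measurable)
  have \<Psi>l: "\<Psi> s \<zeta> = (\<integral>z. of_real (T s \<zeta> z) * \<psi> z \<partial>lborel)" for s \<zeta>
    unfolding \<Psi>_def by (rule integral_M_vanish) (auto simp: \<psi>(2))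
  have \<Psi>B: "norm (\<Psi> s \<zeta>) \<le> B" if s: "0 < s" for s \<zeta>
  proof -
    have "norm (\<Psi> s \<zeta>) \<le> (\<integral>z. norm (of_real (T s \<zeta> z) * \<psi> z) \<partial>lborel)" unfolding \<Psi>l by (rule integral_norm_bound)
    also have "\<dots> \<le> (\<integral>z. T s \<zeta> z * B \<partial>lborel)"
    proof (rule integral_mono')
      show "integrable lborel (\<lambda>z. T s \<zeta> z * B)" using Ti(1)[OF s] by simp
      show "norm (of_real (T s \<zeta> z) * \<psi> z) \<le> T s \<zeta> z * B" for z
        using T0[OF s, of \<zeta> z] \<psi>(3)[of z] by (simp add: norm_mult mult_left_mono)
    qed (use T0[OF s] B0 in auto)
    also have "\<dots> = B" using Ti[OF s] by simp
    finally show ?thesis .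
  qed
  have swap: "(\<integral>z. tent_avg u s z * \<psi> z \<partial>M) = (\<integral>\<zeta>. u \<zeta> * \<Psi> s \<zeta> \<partial>M)" if s: "0 < s" for s
  proof -
    define F where "F z \<zeta> = (u \<zeta> * of_real (T s \<zeta> z)) * \<psi> z" for z \<zeta>
    have Fm [measurable]: "case_prod F \<in> borel_measurable (M \<Otimes>\<^sub>M M)"
      unfolding F_def T_def by measurable
    have Fn: "norm (F z \<zeta>) \<le> (1 / s * (1 / s) * B) * norm (u \<zeta>)" for z \<zeta>
    proof -
      have "norm (F z \<zeta>) = (T s \<zeta> z * norm (\<psi> z)) * norm (u \<zeta>)"
        using T0[OF s] by (simp add: F_def norm_mult)
      also have "\<dots> \<le> (1 / s * (1 / s) * B) * norm (u \<zeta>)"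
        using s T0[OF s] Tle[OF s] \<psi>(3) by (intro mult_right_mono mult_mono[of "T s \<zeta> z"]) auto
      finally show ?thesis .
    qed
    have Fi1: "integrable M (F z)" for z
    proof (rule Bochner_Integration.integrable_bound)
      show "integrable M (\<lambda>\<zeta>. (1 / s * (1 / s) * B) * norm (u \<zeta>))" using u by simp
      show "F z \<in> borel_measurable M" unfolding F_def T_def by measurable
      show "AE \<zeta> in M. norm (F z \<zeta>) \<le> norm ((1 / s * (1 / s) * B) * norm (u \<zeta>))"
        using Fn order_trans[OF Fn abs_ge_self] by (intro AE_I2) (simp only: real_norm_def)
    qed
    have Fi: "integrable (M \<Otimes>\<^sub>M M) (case_prod F)"
    proof (rule MM.Fubini_integrable[OF Fm])
      show "integrable M (\<lambda>z. \<integral>\<zeta>. norm (case_prod F (z, \<zeta>)) \<partial>M)"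
      proof (rule integrable_M_bounded)
        show "(\<lambda>z. \<integral>\<zeta>. norm (case_prod F (z, \<zeta>)) \<partial>M) \<in> borel_measurable M"
          by (rule M.borel_measurable_lebesgue_integral) measurable
        fix z
        have "(\<integral>\<zeta>. norm (F z \<zeta>) \<partial>M) \<le> (\<integral>\<zeta>. (1 / s * (1 / s) * B) * norm (u \<zeta>) \<partial>M)"
          by (rule integral_mono') (use u Fn B0 in auto)
        then show "norm (\<integral>\<zeta>. norm (case_prod F (z, \<zeta>)) \<partial>M) \<le> (\<integral>\<zeta>. (1 / s * (1 / s) * B) * norm (u \<zeta>) \<partial>M)"
          by simp
      qed
      show "AE z in M. integrable M (\<lambda>\<zeta>. case_prod F (z, \<zeta>))" using Fi1 by simp
    qed
    have "(\<integral>z. tent_avg u s z * \<psi> z \<partial>M) = (\<integral>z. (\<integral>\<zeta>. F z \<zeta> \<partial>M) \<partial>M)"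
      unfolding F_def tent_avg_def T_def by (simp only: integral_mult_left_zero)
    also have "\<dots> = (\<integral>\<zeta>. (\<integral>z. F z \<zeta> \<partial>M) \<partial>M)" by (rule MM.Fubini_integral[OF Fi, symmetric])
    also have "\<dots> = (\<integral>\<zeta>. u \<zeta> * \<Psi> s \<zeta> \<partial>M)"
      unfolding F_def \<Psi>_def mult.assoc by (simp only: integral_mult_right_zero)
    finally show ?thesis .
  qed
  have lim: "(\<lambda>j. \<Psi> (r j) \<zeta>) \<longlonglongrightarrow> \<psi> \<zeta>" for \<zeta>
  proof (rule LIMSEQ_I)
    fix \<epsilon> :: real assume \<epsilon>: "0 < \<epsilon>"
    have "isCont \<psi> \<zeta>" using \<psi>(1) by (simp add: continuous_on_eq_continuous_at)
    then obtain \<delta> where \<delta>: "0 < \<delta>" "\<And>z. dist z \<zeta> < \<delta> \<Longrightarrow> dist (\<psi> z) (\<psi> \<zeta>) < \<epsilon> / 2"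
      using \<epsilon> unfolding continuous_at_eps_delta by (metis half_gt_zero)
    obtain j0 where j0: "\<And>j. j0 \<le> j \<Longrightarrow> norm (r j - 0) < \<delta> / 2"
      using LIMSEQ_D[OF r(2), of "\<delta> / 2"] \<delta>(1) by auto
    show "\<exists>j0. \<forall>j\<ge>j0. norm (\<Psi> (r j) \<zeta> - \<psi> \<zeta>) < \<epsilon>"
    proof (intro exI allI impI)
      fix j assume "j0 \<le> j"
      define s where "s = r j"
      have s: "0 < s" "s < \<delta> / 2" using j0[OF \<open>j0 \<le> j\<close>] r(1)[of j] by (auto simp: s_def)
      have ci: "integrable lborel (\<lambda>z. of_real (T s \<zeta> z) * \<psi> \<zeta>)"
        by (rule T\<psi>i[OF s(1), where C="norm (\<psi> \<zeta>)"]) auto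
      have "(\<integral>z. of_real (T s \<zeta> z) * \<psi> \<zeta> \<partial>lborel) = \<psi> \<zeta>"
        using Ti[OF s(1)] by (simp add: integral_complex_of_real)
      then have "\<Psi> s \<zeta> - \<psi> \<zeta> = (\<integral>z. of_real (T s \<zeta> z) * \<psi> z \<partial>lborel) - (\<integral>z. of_real (T s \<zeta> z) * \<psi> \<zeta> \<partial>lborel)"
        by (simp add: \<Psi>l)
      also have "\<dots> = (\<integral>z. of_real (T s \<zeta> z) * \<psi> z - of_real (T s \<zeta> z) * \<psi> \<zeta> \<partial>lborel)"
        by (rule Bochner_Integration.integral_diff[symmetric, OF T\<psi>i[OF s(1) \<psi>b \<psi>(3)] ci])
      finally have "norm (\<Psi> s \<zeta> - \<psi> \<zeta>) \<le> (\<integral>z. norm (of_real (T s \<zeta> z) * \<psi> z - of_real (T s \<zeta> z) * \<psi> \<zeta>) \<partial>lborel)"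
        by (simp only: integral_norm_bound)
      also have "\<dots> \<le> (\<integral>z. T s \<zeta> z * (\<epsilon> / 2) \<partial>lborel)"
      proof (rule integral_mono')
        show "integrable lborel (\<lambda>z. T s \<zeta> z * (\<epsilon> / 2))" using Ti(1)[OF s(1)] by simp
        fix z
        have eq: "norm (of_real (T s \<zeta> z) * \<psi> z - of_real (T s \<zeta> z) * \<psi> \<zeta>) = T s \<zeta> z * dist (\<psi> z) (\<psi> \<zeta>)"
          using T0[OF s(1), of \<zeta> z] by (simp add: right_diff_distrib[symmetric] norm_mult dist_norm)
        show "norm (of_real (T s \<zeta> z) * \<psi> z - of_real (T s \<zeta> z) * \<psi> \<zeta>) \<le> T s \<zeta> z * (\<epsilon> / 2)"
        proof (cases "T s \<zeta> z = 0")
          case True then show ?thesis unfolding eq by simp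
        next
          case False
          then have "\<bar>\<zeta> \<bullet> 1 - z \<bullet> 1\<bar> < s" "\<bar>\<zeta> \<bullet> \<i> - z \<bullet> \<i>\<bar> < s"
            using tent_zero[OF s(1)] unfolding T_def by (metis mult_eq_0_iff not_le)+
          then have "dist z \<zeta> < \<delta>"
            using s(2) cmod_le[of "\<zeta> - z"] by (simp add: inner_complex_def dist_norm norm_minus_commute)
          then show ?thesis unfolding eq using T0[OF s(1)] \<delta>(2) by (intro mult_left_mono) (auto simp: less_imp_le)
        qed
      qed (use T0[OF s(1)] \<epsilon> in auto)
      also have "\<dots> = \<epsilon> / 2" using Ti[OF s(1)] by simp
      finally show "norm (\<Psi> (r j) \<zeta> - \<psi> \<zeta>) < \<epsilon>" using \<epsilon> by (simp add: s_def)
    qed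
  qed
  have "(\<lambda>j. \<integral>\<zeta>. u \<zeta> * \<Psi> (r j) \<zeta> \<partial>M) \<longlonglongrightarrow> (\<integral>z. u z * \<psi> z \<partial>M)"
  proof (rule integral_dominated_convergence[where w="\<lambda>\<zeta>. norm (u \<zeta>) * B"])
    have \<Psi>m [measurable]: "\<Psi> s \<in> borel_measurable M" for s
      unfolding \<Psi>_def T_def by (rule M.borel_measurable_lebesgue_integral) measurable
    show "(\<lambda>\<zeta>. u \<zeta> * \<Psi> (r j) \<zeta>) \<in> borel_measurable M" for j by measurable
    show "AE \<zeta> in M. (\<lambda>j. u \<zeta> * \<Psi> (r j) \<zeta>) \<longlonglongrightarrow> u \<zeta> * \<psi> \<zeta>" by (intro AE_I2 tendsto_intros lim)
    show "AE \<zeta> in M. norm (u \<zeta> * \<Psi> (r j) \<zeta>) \<le> norm (u \<zeta>) * B" for j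
      unfolding norm_mult using \<Psi>B[OF r(1)] by (intro AE_I2 mult_left_mono) auto
  qed (use u in auto)
  then show ?thesis by (simp add: swap[OF r(1)])
qed

definition inner_cbox :: "complex set" where "inner_cbox = cbox (c + Complex (l/4) (l/4)) (c + Complex (3*l/4) (3*l/4))"
definition inner_box :: "complex set" where "inner_box = box (c + Complex (l/4) (l/4)) (c + Complex (3*l/4) (3*l/4))"

lemma inner_cbox_Q: "inner_cbox \<subseteq> Q" using l_pos by (auto simp: inner_cbox_def mem_Q in_cbox_complex_iff)
lemma inner_box_inner_cbox: "inner_box \<subseteq> inner_cbox" unfolding inner_box_def inner_cbox_def by (rule box_subset_cbox)
lemma open_inner_box: "open inner_box" by (simp add: inner_box_def open_box)

text \<open>The averages over the scales \<open>l / 4, l / 8, \<dots>\<close> form a telescoping series dominated by a geometric series, so they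
converge uniformly to a continuous function; and they converge weakly to \<open>u\<close>. Restricting to the inner square keeps the
supports of the kernels inside \<open>Q\<close>.\<close>

lemma morrey:
  assumes dx: "boxder 1 u ux" and dy: "boxder \<i> u uy" and ux: "Lp M 4 ux" and uy: "Lp M 4 uy"
  obtains g where "continuous_on inner_box g" "AE z in M. z \<in> inner_box \<longrightarrow> u z = g z"
proof -
  have u: "integrable M u" using dx by (simp add: boxder_def)
  define K where "K = 16 * ((\<integral>z. norm (ux z) powr 4 \<partial>M) powr (1/4) + (\<integral>z. norm (uy z) powr 4 \<partial>M) powr (1/4))"
  have K0: "0 \<le> K" by (simp add: K_def)
  \<comment> \<open>at the first scale \<open>l / 4\<close> the kernels centred in the inner square still fit into \<open>Q\<close>\<close>
  define r where "r j = l / 4 * (1/2) ^ j" for j :: nat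
  have r: "0 < r j" "r j \<le> l / 4" "r (Suc j) = r j / 2" for j
    using l_pos by (auto simp: r_def power_le_one)
  have rlim: "r \<longlonglongrightarrow> 0" unfolding r_def by (intro tendsto_mult_right_zero LIMSEQ_realpow_zero) auto
  define f where "f j z = tent_avg u (r (Suc j)) z - tent_avg u (r j) z" for j z
  define m where "m j = K * sqrt (l / 4) * sqrt (1/2) ^ j" for j :: nat
  have m0: "0 \<le> m j" for j using K0 l_pos by (simp add: m_def)
  have sm: "summable m" unfolding m_def by (intro summable_mult summable_geometric) (simp add: real_sqrt_divide)
  have fm: "norm (f j z) \<le> m j" if "z \<in> inner_cbox" for j z
  proof -
    have "norm (f j z) \<le> 16 * sqrt (r j) * ((\<integral>z. norm (ux z) powr 4 \<partial>M) powr (1/4) + (\<integral>z. norm (uy z) powr 4 \<partial>M) powr (1/4))"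
      unfolding f_def r(3) by (rule tent_avg_halving[OF dx dy ux uy r(1)])
        (use that r(2)[of j] l_pos in \<open>auto simp: inner_cbox_def in_cbox_complex_iff inner_complex_def\<close>)
    also have "\<dots> = K * sqrt (r j)" by (simp add: K_def)
    also have "sqrt (r j) = sqrt (l / 4) * sqrt (1/2) ^ j" by (simp only: r_def real_sqrt_mult real_sqrt_power)
    finally show ?thesis by (simp add: m_def mult.assoc)
  qed
  have "uniform_limit inner_cbox (\<lambda>n z. \<Sum>i<n. f i z) (\<lambda>z. suminf (\<lambda>i. f i z)) sequentially"
    by (rule Weierstrass_m_test[OF fm sm])
  moreover have tele: "(\<Sum>i<n. f i z) = tent_avg u (r n) z - tent_avg u (r 0) z" for n z
    unfolding f_def by (rule sum_lessThan_telescope)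
  ultimately have ul: "uniform_limit inner_cbox (\<lambda>n z. tent_avg u (r n) z - tent_avg u (r 0) z) (\<lambda>z. suminf (\<lambda>i. f i z)) sequentially"
    by simp
  define g where "g z = tent_avg u (r 0) z + suminf (\<lambda>i. f i z)" for z
  have tc: "continuous_on S (tent_avg u (r n))" for n S
    by (rule continuous_on_subset[OF continuous_tent_avg[OF u r(1)]]) simp
  have "continuous_on inner_cbox (\<lambda>z. suminf (\<lambda>i. f i z))"
    by (rule uniform_limit_theorem[OF _ ul]) (auto intro!: always_eventually continuous_intros tc)
  then have gc: "continuous_on inner_cbox g" unfolding g_def by (intro continuous_intros tc)
  have glim: "(\<lambda>n. tent_avg u (r n) z) \<longlonglongrightarrow> g z" if "z \<in> inner_cbox" for z
  proof -
    have "(\<lambda>n. tent_avg u (r n) z - tent_avg u (r 0) z) \<longlonglongrightarrow> suminf (\<lambda>i. f i z)"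
      by (rule tendsto_uniform_limitI[OF ul that])
    from tendsto_add[OF this tendsto_const[of "tent_avg u (r 0) z"]] show ?thesis by (simp add: g_def add.commute)
  qed
  define \<chi>0 where "\<chi>0 z = complex_of_real (min 1 (infdist z (- inner_box)))" for z
  have \<chi>c: "continuous_on UNIV \<chi>0" unfolding \<chi>0_def by (intro continuous_intros)
  have \<chi>out: "\<chi>0 z = 0" if "z \<notin> inner_box" for z using that by (simp add: \<chi>0_def)
  have \<chi>in: "\<chi>0 z \<noteq> 0" if "z \<in> inner_box" for z
  proof -
    have "inner_box \<noteq> UNIV" unfolding inner_box_def using bounded_box by (metis not_bounded_UNIV)
    then have "- inner_box \<noteq> {}" by auto
    moreover have "closed (- inner_box)" by (simp add: inner_box_def open_box closed_Compl)
    ultimately have "0 < infdist z (- inner_box)"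
      using that infdist_nonneg[of z "- inner_box"] in_closed_iff_infdist_zero[of "- inner_box" z] by force
    then show ?thesis by (simp add: \<chi>0_def)
  qed
  have \<chi>b: "norm (\<chi>0 z) \<le> 1" for z by (simp add: \<chi>0_def infdist_nonneg)
  define G where "G z = (if z \<in> inner_cbox then g z else 0)" for z
  have [measurable]: "inner_cbox \<in> sets borel" by (simp add: inner_cbox_def)
  have Gm: "G \<in> borel_measurable borel"
    unfolding G_def using gc by (intro borel_measurable_continuous_on_if) (auto simp: continuous_on_const)
  define C where "C = 1 / r 0 * (1 / r 0) * (\<integral>z. norm (u z) \<partial>M) + suminf m"
  have t0: "norm (tent_avg u (r 0) z) \<le> 1 / r 0 * (1 / r 0) * (\<integral>z. norm (u z) \<partial>M)" for z
  proof -
    have "norm (tent_avg u (r 0) z) \<le> (\<integral>\<zeta>. norm (u \<zeta> * of_real (tent (r 0) (\<zeta> \<bullet> 1 - z \<bullet> 1) * tent (r 0) (\<zeta> \<bullet> \<i> - z \<bullet> \<i>))) \<partial>M)"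
      unfolding tent_avg_def by (rule integral_norm_bound)
    also have "\<dots> \<le> (\<integral>\<zeta>. 1 / r 0 * (1 / r 0) * norm (u \<zeta>) \<partial>M)"
    proof (rule integral_mono')
      fix \<zeta>
      have "tent (r 0) (\<zeta> \<bullet> 1 - z \<bullet> 1) * tent (r 0) (\<zeta> \<bullet> \<i> - z \<bullet> \<i>) \<le> 1 / r 0 * (1 / r 0)"
        using tent_nonneg[OF r(1)] tent_le[OF r(1)] r(1)[of 0] by (intro mult_mono) auto
      then have "tent (r 0) (\<zeta> \<bullet> 1 - z \<bullet> 1) * tent (r 0) (\<zeta> \<bullet> \<i> - z \<bullet> \<i>) * norm (u \<zeta>) \<le> 1 / r 0 * (1 / r 0) * norm (u \<zeta>)"
        by (rule mult_right_mono) simp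
      then show "norm (u \<zeta> * of_real (tent (r 0) (\<zeta> \<bullet> 1 - z \<bullet> 1) * tent (r 0) (\<zeta> \<bullet> \<i> - z \<bullet> \<i>))) \<le> 1 / r 0 * (1 / r 0) * norm (u \<zeta>)"
        using tent_nonneg[OF r(1)] by (simp add: norm_mult abs_mult mult.commute)
    qed (use u in auto)
    finally show ?thesis by simp
  qed
  have tC: "norm (tent_avg u (r n) z) \<le> C" if "z \<in> inner_cbox" for n z
  proof -
    have "tent_avg u (r n) z = tent_avg u (r 0) z + (\<Sum>i<n. f i z)" by (simp add: tele)
    also have "norm \<dots> \<le> norm (tent_avg u (r 0) z) + (\<Sum>i<n. norm (f i z))"
      by (rule norm_triangle_le[OF add_left_mono[OF norm_sum]])
    also have "(\<Sum>i<n. norm (f i z)) \<le> (\<Sum>i<n. m i)" by (intro sum_mono fm that)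
    also have "\<dots> \<le> suminf m" by (rule sum_le_suminf[OF sm]) (auto simp: m0)
    finally show ?thesis using t0[of z] by (simp add: C_def)
  qed
  have C0: "0 \<le> C" unfolding C_def using r(1)[of 0] suminf_nonneg[OF sm m0] by simp
  have GC: "norm (G z) \<le> C" for z
  proof (cases "z \<in> inner_cbox")
    case True
    then show ?thesis unfolding G_def using LIMSEQ_le_const2[OF tendsto_norm[OF glim[OF True]], of C] tC[OF True] by auto
  qed (simp add: G_def C0)
  have Gi: "integrable M G" by (rule integrable_M_bounded[OF borel_measurable_M[OF Gm] GC])
  have \<chi>m: "\<chi>0 \<in> borel_measurable M" by (rule continuous_measurable_M[OF \<chi>c])
  have "AE z in M. G z * \<chi>0 z - u z * \<chi>0 z = 0"
  proof (rule AE_zero_by_fourier)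
    have i1: "integrable M (\<lambda>z. G z * \<chi>0 z)" "integrable M (\<lambda>z. u z * \<chi>0 z)"
      by (rule integrable_times_bounded[OF Gi \<chi>m \<chi>b] integrable_times_bounded[OF u \<chi>m \<chi>b])+
    then show "integrable M (\<lambda>z. G z * \<chi>0 z - u z * \<chi>0 z)" by simp
    fix n assume "n \<in> freqs"
    define \<psi> where "\<psi> z = \<chi>0 z * e n z" for z
    have \<psi>: "continuous_on UNIV \<psi>" "\<And>z. norm (\<psi> z) \<le> 1" "\<And>z. z \<notin> inner_box \<Longrightarrow> \<psi> z = 0"
      unfolding \<psi>_def by (auto intro!: continuous_intros \<chi>c continuous_e simp: norm_mult \<chi>b \<chi>out)
    have \<psi>m [measurable]: "\<psi> \<in> borel_measurable M" by (rule continuous_measurable_M[OF \<psi>(1)])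
    have l1: "(\<lambda>j. \<integral>z. tent_avg u (r j) z * \<psi> z \<partial>M) \<longlonglongrightarrow> (\<integral>z. u z * \<psi> z \<partial>M)"
      by (rule tent_avg_weak_limit[OF u \<psi>(1) _ \<psi>(2) r(1) rlim]) (use \<psi>(3) inner_box_inner_cbox inner_cbox_Q in auto)
    have l2: "(\<lambda>j. \<integral>z. tent_avg u (r j) z * \<psi> z \<partial>M) \<longlonglongrightarrow> (\<integral>z. G z * \<psi> z \<partial>M)"
    proof (rule integral_dominated_convergence[where w="\<lambda>_. C"])
      have "tent_avg u (r j) \<in> borel_measurable M" for j by (rule continuous_measurable_M[OF tc])
      then show "(\<lambda>z. tent_avg u (r j) z * \<psi> z) \<in> borel_measurable M" for j by simp
      show "(\<lambda>z. G z * \<psi> z) \<in> borel_measurable M" using borel_measurable_M[OF Gm] by simp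
      show "AE z in M. (\<lambda>j. tent_avg u (r j) z * \<psi> z) \<longlonglongrightarrow> G z * \<psi> z"
      proof (rule AE_I2)
        fix z show "(\<lambda>j. tent_avg u (r j) z * \<psi> z) \<longlonglongrightarrow> G z * \<psi> z"
        proof (cases "z \<in> inner_box")
          case True
          then have "z \<in> inner_cbox" using inner_box_inner_cbox by auto
          then show ?thesis unfolding G_def using glim by (auto intro!: tendsto_intros)
        qed (simp add: \<psi>(3))
      qed
      show "AE z in M. norm (tent_avg u (r j) z * \<psi> z) \<le> C" for j
      proof (rule AE_I2)
        fix z show "norm (tent_avg u (r j) z * \<psi> z) \<le> C"
        proof (cases "z \<in> inner_box")
          case True
          then have "norm (tent_avg u (r j) z) * norm (\<psi> z) \<le> C * 1"
            using inner_box_inner_cbox C0 by (intro mult_mono tC \<psi>(2)) auto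
          then show ?thesis by (simp add: norm_mult)
        qed (simp add: \<psi>(3) C0)
      qed
    qed simp
    have eq: "(\<integral>z. G z * \<psi> z \<partial>M) = (\<integral>z. u z * \<psi> z \<partial>M)" by (rule LIMSEQ_unique[OF l2 l1])
    have "(\<integral>z. (G z * \<chi>0 z - u z * \<chi>0 z) * e n z \<partial>M) = (\<integral>z. G z * \<psi> z - u z * \<psi> z \<partial>M)"
      by (simp add: \<psi>_def algebra_simps)
    also have "\<dots> = 0"
      using eq integrable_times_bounded[OF Gi \<psi>m \<psi>(2)] integrable_times_bounded[OF u \<psi>m \<psi>(2)] by simp
    finally show "(\<integral>z. (G z * \<chi>0 z - u z * \<chi>0 z) * e n z \<partial>M) = 0" .
  qed
  then have "AE z in M. z \<in> inner_box \<longrightarrow> u z = g z"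
    by eventually_elim (use \<chi>in inner_box_inner_cbox in \<open>auto simp: G_def\<close>)
  then show thesis using that[of g] continuous_on_subset[OF gc inner_box_inner_cbox] by blast
qed

end

section \<open>Smooth bumps and localisation\<close>

text \<open>The functions \<open>P (1/x) exp (- 1/x)\<close>, extended by zero to \<open>x \<le> 0\<close>, with \<open>P\<close> a polynomial. The class
is closed under differentiation, which gives all derivatives of \<open>exp (- 1/x)\<close> at once.\<close>

definition flat :: "real poly \<Rightarrow> real \<Rightarrow> real" where
  "flat P x = (if 0 < x then poly P (1 / x) * exp (- (1 / x)) else 0)"

definition flat_step :: "real poly \<Rightarrow> real poly" where
  "flat_step P = [:0, 0, 1:] * (P - pderiv P)"

lemma poly_times_exp_tendsto_0: "((\<lambda>t. poly P t * exp (- t)) \<longlongrightarrow> (0::real)) at_top"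
proof -
  have "((\<lambda>t. \<Sum>i\<le>degree P. coeff P i * (t ^ i / exp t)) \<longlongrightarrow> (\<Sum>i\<le>degree P. coeff P i * 0)) at_top"
    by (intro tendsto_sum tendsto_mult tendsto_const tendsto_power_div_exp_0)
  moreover have "(\<lambda>t. poly P t * exp (- t)) = (\<lambda>t. \<Sum>i\<le>degree P. coeff P i * (t ^ i / exp t))"
    by (simp add: fun_eq_iff poly_altdef sum_distrib_right exp_minus divide_inverse mult.assoc)
  ultimately show ?thesis by simp
qed

text \<open>At zero the difference quotient is again of this form, and exponential decay beats every polynomial.\<close>

lemma DERIV_flat: "DERIV (flat P) x :> flat (flat_step P) x"
proof -
  consider "0 < x" | "x < 0" | "x = 0" by linarith
  then show ?thesis
  proof cases
    case 1
    have "((\<lambda>x. poly P (1 / x) * exp (- (1 / x))) has_real_derivative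
       poly (pderiv P) (1 / x) * (- 1 / x\<^sup>2) * exp (- (1 / x)) + poly P (1 / x) * (exp (- (1 / x)) * (1 / x\<^sup>2))) (at x)"
      using 1 by (auto intro!: derivative_eq_intros DERIV_chain2[OF poly_DERIV] simp: power2_eq_square field_simps)
    also have "poly (pderiv P) (1 / x) * (- 1 / x\<^sup>2) * exp (- (1 / x)) + poly P (1 / x) * (exp (- (1 / x)) * (1 / x\<^sup>2)) = flat (flat_step P) x"
      using 1 by (simp add: flat_def flat_step_def power2_eq_square field_simps)
    finally have d: "((\<lambda>x. poly P (1 / x) * exp (- (1 / x))) has_real_derivative flat (flat_step P) x) (at x)" .
    show ?thesis
      by (rule has_field_derivative_transform_within_open[OF d, of "{0<..}"]) (use 1 in \<open>auto simp: flat_def\<close>)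
  next
    case 2
    have "((\<lambda>x. 0) has_real_derivative flat (flat_step P) x) (at x)" using 2 by (simp add: flat_def)
    then show ?thesis
      by (rule has_field_derivative_transform_within_open[of _ _ _ "{..<0}"]) (use 2 in \<open>auto simp: flat_def\<close>)
  next
    case 3
    have "((\<lambda>h. flat P h / h) \<longlongrightarrow> 0) (at 0)"
    proof (rule filterlim_split_at_real)
      have "eventually (\<lambda>h. 0 = flat P h / h) (at_left (0::real))"
        by (rule eventually_at_leftI[of "-1"]) (auto simp: flat_def)
      then show "((\<lambda>h. flat P h / h) \<longlongrightarrow> 0) (at_left 0)"
        by (rule Lim_transform_eventually[OF tendsto_const])
      have "((\<lambda>h. poly (pCons 0 P) (inverse h) * exp (- inverse h)) \<longlongrightarrow> 0) (at_right (0::real))"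
        by (rule filterlim_compose[OF poly_times_exp_tendsto_0 filterlim_inverse_at_top_right])
      moreover have "eventually (\<lambda>h. poly (pCons 0 P) (inverse h) * exp (- inverse h) = flat P h / h) (at_right (0::real))"
        by (rule eventually_at_rightI[of 0 1]) (auto simp: flat_def field_simps)
      ultimately show "((\<lambda>h. flat P h / h) \<longlongrightarrow> 0) (at_right 0)"
        by (rule Lim_transform_eventually)
    qed
    then show ?thesis using 3 by (simp add: DERIV_def flat_def)
  qed
qed

definition cutoff :: "real \<Rightarrow> real" where "cutoff x = flat 1 x"

lemma Ck_cutoff_ridge: "Ck n (\<lambda>z. cutoff (z \<bullet> w + t))"
proof -
  define g where "g j x = flat ((flat_step ^^ j) 1) (x + t)" for j x
  have "DERIV (g j) x :> g (Suc j) x" for j x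
    unfolding g_def using DERIV_flat[of "(flat_step ^^ j) 1" "x + t"] by (simp add: DERIV_shift)
  from Ck_ridge[of g, OF this, where n=n and j=0 and w=w] show ?thesis by (simp add: g_def cutoff_def)
qed

lemma cutoff_pos: "0 < cutoff x \<longleftrightarrow> 0 < x" by (simp add: cutoff_def flat_def)
lemma cutoff_zero: "x \<le> 0 \<Longrightarrow> cutoff x = 0" by (simp add: cutoff_def flat_def)
context square begin

text \<open>A product of four one-sided cutoffs, one for each side of the inner square. The bump is
positive on the whole open inner square, and not constant there; integrability is therefore transferred
from a product with the bump only on smaller sets, where the bump has a positive lower bound.\<close>

definition bump :: "complex \<Rightarrow> real" where
  "bump z = (cutoff (z \<bullet> 1 + (- (Re c + l/4))) * cutoff (z \<bullet> (- 1) + (Re c + 3*l/4))) *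
     (cutoff (z \<bullet> \<i> + (- (Im c + l/4))) * cutoff (z \<bullet> (- \<i>) + (Im c + 3*l/4)))"

lemma Ck_bump: "Ck n bump"
  unfolding bump_def[abs_def] by (intro Ck_mult Ck_cutoff_ridge)

lemma bump_pos: "z \<in> inner_box \<Longrightarrow> 0 < bump z"
  unfolding bump_def by (intro mult_pos_pos; simp add: cutoff_pos inner_box_def in_box_complex_iff inner_complex_def)

lemma bump_zero: "z \<notin> inner_box \<Longrightarrow> bump z = 0"
  unfolding bump_def by (auto simp: inner_box_def in_box_complex_iff inner_complex_def not_less intro!: cutoff_zero)

definition dbump :: "complex \<Rightarrow> complex \<Rightarrow> real" where "dbump v z = frechet_derivative bump (at z) v"

lemma continuous_bump: "continuous_on UNIV bump" by (rule Ck_continuous[OF Ck_bump])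

lemma continuous_dbump: "continuous_on UNIV (dbump v)"
  unfolding dbump_def using Ck_bump[of 1] by simp

lemma dbump_zero: "z \<notin> inner_cbox \<Longrightarrow> dbump v z = 0"
proof -
  assume z: "z \<notin> inner_cbox"
  have op: "open (- inner_cbox)" unfolding inner_cbox_def by (intro open_Compl closed_cbox)
  then have "(bump has_derivative (\<lambda>_. 0)) (at z)"
    using has_derivative_transform_within_open[of "\<lambda>_. 0" "\<lambda>_. 0" z UNIV "- inner_cbox" bump] op z inner_box_inner_cbox bump_zero by auto
  then have "frechet_derivative bump (at z) = (\<lambda>_. 0)" by (rule frechet_derivative_at[symmetric])
  then show ?thesis by (simp add: dbump_def)
qed

lemma measurable_on_square:
  assumes "f \<in> borel_measurable (lebesgue_on \<Omega>)" "Q \<subseteq> \<Omega>"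
  shows "f \<in> borel_measurable M"
  using assms by (rule measurable_restrict_mono)

lemma Lp_loc_square:
  assumes "Lp_loc p \<Omega> f" "Q \<subseteq> \<Omega>"
  shows "Lp M p f"
proof -
  have f: "f \<in> borel_measurable (lebesgue_on \<Omega>)"
    and K: "\<forall>K. compact K \<and> K \<subseteq> \<Omega> \<longrightarrow> integrable (lebesgue_on K) (\<lambda>z. norm (f z) powr p)"
    using assms(1) unfolding Lp_loc_def by blast+
  have "integrable M (\<lambda>z. norm (f z) powr p)"
    by (rule K[rule_format]) (intro conjI compact_Q assms(2))
  then show ?thesis unfolding Lp_def by (intro conjI measurable_on_square[OF f assms(2)])
qed

lemma integral_domain_square:
  fixes F :: "complex \<Rightarrow> complex"
  assumes "Q \<subseteq> \<Omega>" "\<Omega> \<in> sets lebesgue" "\<And>z. z \<notin> Q \<Longrightarrow> F z = 0"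
  shows "(\<integral>z. F z \<partial>lebesgue_on \<Omega>) = (\<integral>z. F z \<partial>M)"
proof -
  have eq: "indicator \<Omega> z *\<^sub>R F z = indicator Q z *\<^sub>R F z" for z
    using assms by (cases "z \<in> Q") (auto simp: indicator_def)
  have "(\<integral>z. F z \<partial>lebesgue_on \<Omega>) = (\<integral>z. indicator \<Omega> z *\<^sub>R F z \<partial>lebesgue)"
    by (rule integral_restrict_space) (use assms in simp)
  also have "\<dots> = (\<integral>z. indicator Q z *\<^sub>R F z \<partial>lebesgue)" unfolding eq ..
  also have "\<dots> = (\<integral>z. F z \<partial>M)"
    by (rule integral_restrict_space[symmetric]) simp
  finally show ?thesis .
qed

text \<open>If \<open>\<psi>\<close> is smooth, then the product of \<open>\<psi>\<close> with the bump is a test function in the domain. The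
product rule distributes its derivative.\<close>

lemma boxder_localize:
  assumes \<Omega>: "open \<Omega>" "Q \<subseteq> \<Omega>" and d: "has_weak_derivative \<Omega> v f g"
  shows "boxder v (\<lambda>z. of_real (bump z) * f z) (\<lambda>z. of_real (bump z) * g z + of_real (dbump v z) * f z)"
proof -
  have L: "Lp_loc 1 \<Omega> f" "Lp_loc 1 \<Omega> g" using d by (auto simp: has_weak_derivative_def)
  have f: "integrable M f" and g: "integrable M g"
    using Lp_loc_square[OF L(1) \<Omega>(2)] Lp_loc_square[OF L(2) \<Omega>(2)] by (auto simp: Lp_1_iff)
  have cont: "integrable M (\<lambda>z. b z *\<^sub>R h z)" if "integrable M h" "continuous_on UNIV b" for b and h :: "complex \<Rightarrow> complex"
    using that by (rule integrable_mult_continuous)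
  have \<Omega>s: "\<Omega> \<in> sets lebesgue" using \<Omega>(1) by auto
  show ?thesis unfolding boxder_def
  proof (intro conjI allI impI)
    show "integrable M (\<lambda>z. of_real (bump z) * f z)"
      using cont[OF f continuous_bump] by (simp add: scaleR_conv_of_real)
    show "integrable M (\<lambda>z. of_real (bump z) * g z + of_real (dbump v z) * f z)"
      using Bochner_Integration.integrable_add[OF cont[OF g continuous_bump] cont[OF f continuous_dbump]] by (simp add: scaleR_conv_of_real)
    fix \<psi> assume \<psi>: "\<forall>n. Ck n \<psi>"
    define \<phi> where "\<phi> z = bump z * \<psi> z" for z
    have \<psi>c: "continuous_on UNIV \<psi>" using \<psi> by (intro Ck_continuous) auto
    have "Ck 1 \<psi>" using \<psi> by blast
    then have d\<psi>: "\<psi> differentiable (at z)" and d\<psi>c: "continuous_on UNIV (\<lambda>z. frechet_derivative \<psi> (at z) v)" for z by auto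
    have dbump: "bump differentiable (at z)" for z using Ck_bump[of 1] by simp
    have supp: "{z. \<phi> z \<noteq> 0} \<subseteq> inner_cbox" using bump_zero inner_box_inner_cbox by (auto simp: \<phi>_def)
    have cl: "closure {z. \<phi> z \<noteq> 0} \<subseteq> inner_cbox" unfolding inner_cbox_def by (rule closure_minimal[OF supp[unfolded inner_cbox_def] closed_cbox])
    have "test_function \<Omega> \<phi>" unfolding test_function_def
    proof (intro conjI allI)
      show "Ck n \<phi>" for n unfolding \<phi>_def[abs_def] using \<psi> by (intro Ck_mult Ck_bump) auto
      have "compact inner_cbox" by (simp add: inner_cbox_def)
      then show "compact (closure {z. \<phi> z \<noteq> 0})"
        by (metis bounded_subset cl closed_closure compact_eq_bounded_closed)
      show "closure {z. \<phi> z \<noteq> 0} \<subseteq> \<Omega>" using cl inner_cbox_Q \<Omega>(2) by blast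
    qed
    then have w: "(\<integral>z. frechet_derivative \<phi> (at z) v *\<^sub>R f z \<partial>lebesgue_on \<Omega>) = - (\<integral>z. \<phi> z *\<^sub>R g z \<partial>lebesgue_on \<Omega>)"
      using d by (simp add: has_weak_derivative_def)
    have D: "frechet_derivative \<phi> (at z) v = bump z * frechet_derivative \<psi> (at z) v + dbump v z * \<psi> z" for z
    proof -
      have "(\<phi> has_derivative (\<lambda>h. bump z * frechet_derivative \<psi> (at z) h + frechet_derivative bump (at z) h * \<psi> z)) (at z)"
        unfolding \<phi>_def using d\<psi> dbump by (intro has_derivative_mult) (auto simp: frechet_derivative_works[symmetric])
      then have "frechet_derivative \<phi> (at z) = (\<lambda>h. bump z * frechet_derivative \<psi> (at z) h + frechet_derivative bump (at z) h * \<psi> z)"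
        by (rule frechet_derivative_at[symmetric])
      then show ?thesis by (simp add: dbump_def)
    qed
    have out: "bump z = 0" "dbump v z = 0" if "z \<notin> Q" for z
      using that inner_cbox_Q inner_box_inner_cbox bump_zero dbump_zero by blast+
    have w': "(\<integral>z. frechet_derivative \<phi> (at z) v *\<^sub>R f z \<partial>M) = - (\<integral>z. \<phi> z *\<^sub>R g z \<partial>M)"
      using w integral_domain_square[OF \<Omega>(2) \<Omega>s, of "\<lambda>z. frechet_derivative \<phi> (at z) v *\<^sub>R f z"]
        integral_domain_square[OF \<Omega>(2) \<Omega>s, of "\<lambda>z. \<phi> z *\<^sub>R g z"] out
      by (simp add: D \<phi>_def)
    have i1: "integrable M (\<lambda>z. (frechet_derivative \<psi> (at z) v * bump z) *\<^sub>R f z)"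
      by (intro cont f continuous_intros d\<psi>c continuous_bump)
    have i2: "integrable M (\<lambda>z. (\<psi> z * dbump v z) *\<^sub>R f z)"
      by (intro cont f continuous_intros \<psi>c continuous_dbump)
    have i3: "integrable M (\<lambda>z. (\<psi> z * bump z) *\<^sub>R g z)"
      by (intro cont g continuous_intros \<psi>c continuous_bump)
    have "(\<integral>z. frechet_derivative \<phi> (at z) v *\<^sub>R f z \<partial>M) =
       (\<integral>z. (frechet_derivative \<psi> (at z) v * bump z) *\<^sub>R f z + (\<psi> z * dbump v z) *\<^sub>R f z \<partial>M)"
      by (simp add: D scaleR_left_distrib mult.commute)
    also have "\<dots> = (\<integral>z. (frechet_derivative \<psi> (at z) v * bump z) *\<^sub>R f z \<partial>M) + (\<integral>z. (\<psi> z * dbump v z) *\<^sub>R f z \<partial>M)"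
      by (rule Bochner_Integration.integral_add[OF i1 i2])
    finally have e1: "(\<integral>z. (frechet_derivative \<psi> (at z) v * bump z) *\<^sub>R f z \<partial>M) =
        - (\<integral>z. \<phi> z *\<^sub>R g z \<partial>M) - (\<integral>z. (\<psi> z * dbump v z) *\<^sub>R f z \<partial>M)"
      unfolding w' by (simp add: algebra_simps)
    have "(\<integral>z. \<psi> z *\<^sub>R (of_real (bump z) * g z + of_real (dbump v z) * f z) \<partial>M) = (\<integral>z. (\<psi> z * bump z) *\<^sub>R g z + (\<psi> z * dbump v z) *\<^sub>R f z \<partial>M)"
      by (simp add: scaleR_conv_of_real distrib_left mult.assoc)
    also have "\<dots> = (\<integral>z. (\<psi> z * bump z) *\<^sub>R g z \<partial>M) + (\<integral>z. (\<psi> z * dbump v z) *\<^sub>R f z \<partial>M)"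
      by (rule Bochner_Integration.integral_add[OF i3 i2])
    finally have e2: "(\<integral>z. \<psi> z *\<^sub>R (of_real (bump z) * g z + of_real (dbump v z) * f z) \<partial>M) =
        (\<integral>z. \<phi> z *\<^sub>R g z \<partial>M) + (\<integral>z. (\<psi> z * dbump v z) *\<^sub>R f z \<partial>M)"
      by (simp add: \<phi>_def mult.commute)
    have "(\<integral>z. frechet_derivative \<psi> (at z) v *\<^sub>R (of_real (bump z) * f z) \<partial>M) = (\<integral>z. (frechet_derivative \<psi> (at z) v * bump z) *\<^sub>R f z \<partial>M)"
      by (simp add: scaleR_conv_of_real mult.assoc)
    then show "(\<integral>z. frechet_derivative \<psi> (at z) v *\<^sub>R (of_real (bump z) * f z) \<partial>M) =
       - (\<integral>z. \<psi> z *\<^sub>R (of_real (bump z) * g z + of_real (dbump v z) * f z) \<partial>M)"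
      unfolding e1 e2 by simp
  qed
qed

lemma Lp_continuous_mult:
  fixes b :: "complex \<Rightarrow> real"
  assumes "Lp M p f" "continuous_on UNIV b" "0 \<le> p"
  shows "Lp M p (\<lambda>z. of_real (b z) * f z)"
proof -
  have "bounded (b ` Q)"
    by (intro compact_imp_bounded compact_continuous_image compact_Q continuous_on_subset[OF assms(2)]) auto
  then obtain B where B: "\<And>z. z \<in> Q \<Longrightarrow> norm (b z) \<le> B" by (auto simp: bounded_iff)
  show ?thesis
  proof (rule Lp_bounded_mult[OF assms(1) _ assms(3), where C=B])
    show "(\<lambda>z. complex_of_real (b z)) \<in> borel_measurable M"
      by (intro continuous_measurable_M continuous_intros assms)
    show "AE z in M. norm (complex_of_real (b z)) \<le> B" by (rule AE_I2) (use B in auto)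
  qed
qed

end

lemma square_around:
  assumes "open \<Omega>" "z0 \<in> \<Omega>"
  obtains c l where "square l" "square.Q c l \<subseteq> \<Omega>" "z0 \<in> square.inner_box c l"
proof -
  obtain e where e: "0 < e" "ball z0 e \<subseteq> \<Omega>" using assms openE by blast
  define l where "l = e / 2"
  define c where "c = z0 - Complex (l/2) (l/2)"
  interpret square c l by unfold_locales (use e in \<open>simp add: l_def\<close>)
  have cc: "Re c = Re z0 - l / 2" "Im c = Im z0 - l / 2" by (simp_all add: c_def)
  have "z \<in> ball z0 e" if "z \<in> Q" for z
  proof -
    have "Re c \<le> Re z \<and> Re z \<le> Re c + l \<and> Im c \<le> Im z \<and> Im z \<le> Im c + l"
      using that by (simp only: mem_Q)
    then have "\<bar>Re (z - z0)\<bar> \<le> l / 2" "\<bar>Im (z - z0)\<bar> \<le> l / 2"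
      unfolding minus_complex.sel using cc by linarith+
    then have "norm (z - z0) \<le> l" using cmod_le[of "z - z0"] by linarith
    then show ?thesis using e by (simp add: l_def dist_norm norm_minus_commute)
  qed
  then have "Q \<subseteq> \<Omega>" using e by blast
  moreover have "z0 \<in> inner_box" unfolding inner_box_def in_box_complex_iff using e by (simp add: c_def l_def)
  ultimately show thesis using that square_axioms by blast
qed

lemma Lp_loc_of_nbhds:
  assumes f: "f \<in> borel_measurable (lebesgue_on \<Omega>)" and \<Omega>: "open \<Omega>"
    and loc: "\<And>z. z \<in> \<Omega> \<Longrightarrow> \<exists>U. open U \<and> z \<in> U \<and> integrable (lebesgue_on U) (\<lambda>z. norm (f z) powr p)"
  shows "Lp_loc p \<Omega> f"
  unfolding Lp_loc_def
proof (intro conjI f allI impI)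
  fix K assume K: "compact K \<and> K \<subseteq> \<Omega>"
  obtain U where U: "\<And>z. z \<in> \<Omega> \<Longrightarrow> open (U z) \<and> z \<in> U z \<and> integrable (lebesgue_on (U z)) (\<lambda>z. norm (f z) powr p)"
    using loc by metis
  obtain C where C: "C \<subseteq> K" "finite C" "K \<subseteq> (\<Union>z\<in>C. U z)"
    by (rule compactE_image[of K K U]) (use K U in blast)+
  have "set_integrable lebesgue (\<Union>z\<in>C. U z) (\<lambda>z. norm (f z) powr p)"
  proof (rule set_integrable_UN[OF C(2)])
    fix z assume "z \<in> C"
    then have "open (U z)" "integrable (lebesgue_on (U z)) (\<lambda>z. norm (f z) powr p)" using U C K by blast+
    then show "U z \<in> sets lebesgue" "set_integrable lebesgue (U z) (\<lambda>z. norm (f z) powr p)"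
      by (auto simp: set_integrable_def integrable_restrict_space)
  qed
  moreover have Ks: "K \<in> sets lebesgue" using K by (simp add: lmeasurable_compact fmeasurableD)
  ultimately have "set_integrable lebesgue K (\<lambda>z. norm (f z) powr p)"
    by (rule set_integrable_subset[OF _ _ C(3)])
  then show "integrable (lebesgue_on K) (\<lambda>z. norm (f z) powr p)"
    using Ks by (simp add: set_integrable_def integrable_restrict_space)
qed

text \<open>Near a point \<open>z0\<close> of the inner square the bump exceeds half its value at \<open>z0\<close>, so integrability of the
product gives integrability of \<open>f\<close> there; compact sets are covered by finitely many such
neighbourhoods.\<close>

lemma Lp_loc_by_bumps:
  assumes f: "f \<in> borel_measurable (lebesgue_on \<Omega>)" and \<Omega>: "open \<Omega>" and p: "0 < p"
    and loc: "\<And>c l. square l \<Longrightarrow> square.Q c l \<subseteq> \<Omega> \<Longrightarrow>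
      Lp (lebesgue_on (square.Q c l)) p (\<lambda>z. of_real (square.bump c l z) * f z)"
  shows "Lp_loc p \<Omega> f"
proof (rule Lp_loc_of_nbhds[OF f \<Omega>])
  fix z0 assume "z0 \<in> \<Omega>"
  then obtain c l where cl: "square l" "square.Q c l \<subseteq> \<Omega>" "z0 \<in> square.inner_box c l"
    using square_around[OF \<Omega>] by metis
  interpret square c l by (rule cl(1))
  define d where "d = bump z0 / 2"
  have d: "0 < d" using bump_pos[OF cl(3)] by (simp add: d_def)
  define U where "U = inner_box \<inter> {z. d < bump z}"
  have U: "open U" unfolding U_def
    by (intro open_Int open_inner_box open_Collect_less continuous_on_const continuous_bump)
  have UQ: "U \<subseteq> Q" using inner_box_inner_cbox inner_cbox_Q by (auto simp: U_def)
  have Us: "U \<in> sets lebesgue" using U by auto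
  have L: "Lp M p (\<lambda>z. of_real (bump z) * f z)" by (rule loc[OF cl(1,2)])
  have fU: "f \<in> borel_measurable (lebesgue_on U)"
    by (rule measurable_restrict_mono[OF f]) (use UQ cl in blast)
  have "integrable (lebesgue_on U) (\<lambda>z. norm (f z) powr p)"
  proof (rule Bochner_Integration.integrable_bound)
    have "set_integrable lebesgue Q (\<lambda>z. norm (of_real (bump z) * f z) powr p)"
      using L by (simp add: Lp_def set_integrable_def integrable_restrict_space)
    then have "set_integrable lebesgue U (\<lambda>z. norm (of_real (bump z) * f z) powr p)"
      by (rule set_integrable_subset[OF _ Us UQ])
    then show "integrable (lebesgue_on U) (\<lambda>z. (1 / d) powr p * norm (of_real (bump z) * f z) powr p)"
      using Us by (intro integrable_mult_right) (simp add: set_integrable_def integrable_restrict_space)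
    show "(\<lambda>z. norm (f z) powr p) \<in> borel_measurable (lebesgue_on U)" using fU by measurable
    show "AE z in lebesgue_on U. norm (norm (f z) powr p) \<le> norm ((1 / d) powr p * norm (of_real (bump z) * f z) powr p)"
    proof (rule AE_I2)
      fix z assume "z \<in> space (lebesgue_on U)"
      then have "d < bump z" by (simp add: U_def)
      then have "d * norm (f z) \<le> bump z * norm (f z)" by (intro mult_right_mono) auto
      then have "norm (f z) \<le> 1 / d * norm (of_real (bump z) * f z)"
        using d \<open>d < bump z\<close> by (simp add: norm_mult field_simps)
      then have "norm (f z) powr p \<le> (1 / d * norm (of_real (bump z) * f z)) powr p"
        using p by (intro powr_mono2) auto
      also have "\<dots> = (1 / d) powr p * norm (of_real (bump z) * f z) powr p" by (rule powr_mult)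
      finally show "norm (norm (f z) powr p) \<le> norm ((1 / d) powr p * norm (of_real (bump z) * f z) powr p)" by simp
    qed
  qed
  then show "\<exists>U. open U \<and> z0 \<in> U \<and> integrable (lebesgue_on U) (\<lambda>z. norm (f z) powr p)"
    using U d cl(3) by (intro exI[of _ U]) (auto simp: U_def d_def)
qed

section \<open>Raising the exponent\<close>

lemma Lp_loc_mono:
  assumes "Lp_loc p \<Omega> f" "0 \<le> q" "q \<le> p"
  shows "Lp_loc q \<Omega> f"
  unfolding Lp_loc_def
proof (intro conjI allI impI)
  show f: "f \<in> borel_measurable (lebesgue_on \<Omega>)" using assms(1) unfolding Lp_loc_def by blast
  fix K assume K: "compact K \<and> K \<subseteq> \<Omega>"
  have Lpp: "Lp (lebesgue_on K) p f"
    unfolding Lp_def using assms(1) K measurable_restrict_mono[OF f, of K] unfolding Lp_loc_def by blast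
  have fin: "finite_measure (lebesgue_on K)"
    using K by (intro finite_measure_lebesgue_on lmeasurable_compact) auto
  have "Lp (lebesgue_on K) q f" by (rule Lp_mono[OF fin Lpp assms(2,3)])
  then show "integrable (lebesgue_on K) (\<lambda>z. norm (f z) powr q)" by (simp add: Lp_def)
qed

lemma sobolev_loc:
  assumes \<Omega>: "open \<Omega>" and x: "has_weak_derivative \<Omega> 1 f gx" and y: "has_weak_derivative \<Omega> \<i> f gy"
    and p: "1 \<le> p" and L: "Lp_loc p \<Omega> f" "Lp_loc p \<Omega> gx" "Lp_loc p \<Omega> gy"
  shows "Lp_loc (2 * p) \<Omega> f"
proof (rule Lp_loc_by_bumps[OF _ \<Omega>])
  show "f \<in> borel_measurable (lebesgue_on \<Omega>)" using L(1) unfolding Lp_loc_def by blast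
  fix c l assume "square l" and Q: "square.Q c l \<subseteq> \<Omega>"
  interpret square c l by fact
  have f: "Lp M p f" and gx: "Lp M p gx" and gy: "Lp M p gy"
    using L by (auto intro: Lp_loc_square[OF _ Q])
  show "Lp M (2 * p) (\<lambda>z. of_real (bump z) * f z)"
  proof (rule sobolev[OF boxder_localize[OF \<Omega> Q x] boxder_localize[OF \<Omega> Q y] p])
    show "Lp M p (\<lambda>z. of_real (bump z) * gx z + of_real (dbump 1 z) * f z)"
      "Lp M p (\<lambda>z. of_real (bump z) * gy z + of_real (dbump \<i> z) * f z)"
      using p f gx gy by (auto intro!: Lp_add Lp_continuous_mult continuous_bump continuous_dbump)
  qed
qed (use p in simp)

text \<open>One step of the iteration. The localised function satisfies the linear equation with right-hand
side \<open>bump h\<close> plus terms containing \<open>f\<close> and derivatives of the bump. All of these lie in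
\<open>L\<^sup>q\<close> with \<open>q = p / \<alpha>\<close>: the first because \<open>|h| powr q\<close> is at most a multiple of \<open>1 + |f\<^bsub>z\<^esub>| powr p\<close>, the others because
\<open>f\<close> itself already has the better exponent.\<close>

lemma gradient_loc:
  fixes a b :: complex and C \<alpha> p :: real
  assumes \<Omega>: "open \<Omega>" and x: "has_weak_derivative \<Omega> 1 f gx" and y: "has_weak_derivative \<Omega> \<i> f gy"
    and ab: "norm a + norm b < 1" and \<alpha>: "0 < \<alpha>" "\<alpha> < 1" and p: "1 \<le> p"
    and L: "Lp_loc (p / \<alpha>) \<Omega> f" "Lp_loc p \<Omega> gx" "Lp_loc p \<Omega> gy"
    and eq: "AE z in lebesgue_on \<Omega>. norm ((gx z + \<i> * gy z) / 2 - a * ((gx z - \<i> * gy z) / 2) - b * cnj ((gx z - \<i> * gy z) / 2))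
      \<le> C * (1 + norm ((gx z - \<i> * gy z) / 2) powr \<alpha>)"
  shows "Lp_loc (p / \<alpha>) \<Omega> gx" "Lp_loc (p / \<alpha>) \<Omega> gy"
proof -
  define q where "q = p / \<alpha>"
  have q: "1 < q" "\<alpha> * q = p" using \<alpha> p by (auto simp: q_def field_simps)
  have main: "Lp (lebesgue_on (square.Q c l)) q (\<lambda>z. of_real (square.bump c l z) * gx z) \<and>
       Lp (lebesgue_on (square.Q c l)) q (\<lambda>z. of_real (square.bump c l z) * gy z)"
    if "square l" and Q: "square.Q c l \<subseteq> \<Omega>" for c l
  proof -
    interpret square c l by fact
    have f: "Lp M q f" and gx: "Lp M p gx" and gy: "Lp M p gy"
      using L unfolding q_def by (auto intro: Lp_loc_square[OF _ Q])
    define h where "h z = (gx z + \<i> * gy z) / 2 - a * ((gx z - \<i> * gy z) / 2) - b * cnj ((gx z - \<i> * gy z) / 2)" for z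
    have [measurable]: "gx \<in> borel_measurable M" "gy \<in> borel_measurable M" using gx gy by (auto simp: Lp_def)
    have dzL: "Lp M p (\<lambda>z. (1/2) * (gx z - \<i> * gy z))"
      using p gx gy by (intro Lp_cmult Lp_diff) auto
    have hL: "Lp M p (\<lambda>z. (1/2) * (gx z + \<i> * gy z) - a * ((1/2) * (gx z - \<i> * gy z)) - b * cnj ((1/2) * (gx z - \<i> * gy z)))"
      using p gx gy by (intro Lp_diff Lp_add Lp_cmult Lp_cnj) auto
    have hm: "h \<in> borel_measurable M"
      using hL by (simp add: Lp_def h_def[abs_def])
    have AEM: "AE z in M. norm (h z) \<le> C * (1 + norm ((gx z - \<i> * gy z) / 2) powr \<alpha>)"
    proof -
      have "AE z in lebesgue. z \<in> \<Omega> \<longrightarrow> norm (h z) \<le> C * (1 + norm ((gx z - \<i> * gy z) / 2) powr \<alpha>)"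
        using eq \<Omega> unfolding h_def by (subst (asm) AE_restrict_space_iff) auto
      then have "AE z in M. z \<in> \<Omega> \<longrightarrow> norm (h z) \<le> C * (1 + norm ((gx z - \<i> * gy z) / 2) powr \<alpha>)"
        by (rule AE_M_lebesgue)
      moreover have "AE z in M. z \<in> \<Omega>" by (rule AE_I2) (use Q in auto)
      ultimately show ?thesis by eventually_elim blast
    qed
    have h: "Lp M q h"
    proof (rule Lp_dominated_by[OF _ hm])
      show "integrable M (\<lambda>z. \<bar>C\<bar> powr q * (2 powr q * (1 + norm ((1/2) * (gx z - \<i> * gy z)) powr p)))"
        using dzL by (auto simp: Lp_def)
      show "AE z in M. norm (h z) powr q \<le> \<bar>C\<bar> powr q * (2 powr q * (1 + norm ((1/2) * (gx z - \<i> * gy z)) powr p))"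
        using AEM
      proof eventually_elim
        case (elim z)
        define t where "t = norm ((1/2) * (gx z - \<i> * gy z))"
        have t: "0 \<le> t" "norm ((gx z - \<i> * gy z) / 2) = t" by (simp_all add: t_def)
        have "norm (h z) \<le> \<bar>C\<bar> * (1 + t powr \<alpha>)"
          using elim unfolding t(2) by (rule order_trans) (intro mult_right_mono, auto)
        then have "norm (h z) powr q \<le> (\<bar>C\<bar> * (1 + t powr \<alpha>)) powr q"
          using q by (intro powr_mono2) auto
        also have "\<dots> = \<bar>C\<bar> powr q * (1 + t powr \<alpha>) powr q" by (rule powr_mult)
        also have "\<dots> \<le> \<bar>C\<bar> powr q * (2 powr q * (1 powr q + (t powr \<alpha>) powr q))"
          using q by (intro mult_left_mono add_powr_le) auto
        also have "\<dots> = \<bar>C\<bar> powr q * (2 powr q * (1 + t powr p))" by (simp add: powr_powr q)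
        finally show ?case by (simp only: t_def)
      qed
    qed
    define ux where "ux z = of_real (bump z) * gx z + of_real (dbump 1 z) * f z" for z
    define uy where "uy z = of_real (bump z) * gy z + of_real (dbump \<i> z) * f z" for z
    have dux: "boxder 1 (\<lambda>z. of_real (bump z) * f z) ux" and duy: "boxder \<i> (\<lambda>z. of_real (bump z) * f z) uy"
      unfolding ux_def uy_def by (rule boxder_localize[OF \<Omega> Q x] boxder_localize[OF \<Omega> Q y])+
    define F1 F2 where "F1 z = of_real (dbump 1 z) * f z" and "F2 z = of_real (dbump \<i> z) * f z" for z
    have F: "Lp M q F1" "Lp M q F2"
      unfolding F1_def F2_def using q f by (auto intro!: Lp_continuous_mult continuous_dbump)
    have k: "Lp M q (\<lambda>z. of_real (bump z) * h z + ((1/2) * (F1 z + \<i> * F2 z) - a * ((1/2) * (F1 z - \<i> * F2 z)) - b * cnj ((1/2) * (F1 z - \<i> * F2 z))))"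
      using q F h by (intro Lp_add Lp_diff Lp_cmult Lp_cnj Lp_continuous_mult continuous_bump) auto
    have keq: "of_real (bump z) * h z + ((1/2) * (F1 z + \<i> * F2 z) - a * ((1/2) * (F1 z - \<i> * F2 z)) - b * cnj ((1/2) * (F1 z - \<i> * F2 z)))
       = (ux z + \<i> * uy z) / 2 - a * ((ux z - \<i> * uy z) / 2) - b * cnj ((ux z - \<i> * uy z) / 2)" for z
      by (simp add: h_def ux_def uy_def F1_def F2_def field_simps)
    note reg = boxder_regularity[OF ab q(1) dux duy k[unfolded keq]]
    have "of_real (bump z) * gx z = ux z - F1 z" "of_real (bump z) * gy z = uy z - F2 z" for z
      by (simp_all add: ux_def uy_def F1_def F2_def)
    then show ?thesis using Lp_diff[OF reg(1) F(1)] Lp_diff[OF reg(2) F(2)] q by simp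
  qed
  have m: "gx \<in> borel_measurable (lebesgue_on \<Omega>)" "gy \<in> borel_measurable (lebesgue_on \<Omega>)"
    using L unfolding Lp_loc_def by blast+
  show "Lp_loc (p / \<alpha>) \<Omega> gx" "Lp_loc (p / \<alpha>) \<Omega> gy"
    unfolding q_def[symmetric] using main q by (auto intro!: Lp_loc_by_bumps m \<Omega>)
qed

lemma continuous_representative_loc:
  assumes \<Omega>: "open \<Omega>" and x: "has_weak_derivative \<Omega> 1 f gx" and y: "has_weak_derivative \<Omega> \<i> f gy"
    and L: "Lp_loc 4 \<Omega> f" "Lp_loc 4 \<Omega> gx" "Lp_loc 4 \<Omega> gy" and z0: "z0 \<in> \<Omega>"
  shows "\<exists>U G. open U \<and> z0 \<in> U \<and> U \<subseteq> \<Omega> \<and> continuous_on U G \<and> (AE z in lebesgue. z \<in> U \<longrightarrow> f z = G z)"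
proof -
  obtain c l where cl: "square l" "square.Q c l \<subseteq> \<Omega>" "z0 \<in> square.inner_box c l"
    using square_around[OF \<Omega> z0] by metis
  interpret square c l by (rule cl(1))
  have f: "Lp M 4 f" and gx: "Lp M 4 gx" and gy: "Lp M 4 gy"
    using L by (auto intro: Lp_loc_square[OF _ cl(2)])
  obtain g where g: "continuous_on inner_box g" "AE z in M. z \<in> inner_box \<longrightarrow> of_real (bump z) * f z = g z"
  proof (rule morrey[OF boxder_localize[OF \<Omega> cl(2) x] boxder_localize[OF \<Omega> cl(2) y]])
    show "Lp M 4 (\<lambda>z. of_real (bump z) * gx z + of_real (dbump 1 z) * f z)"
      "Lp M 4 (\<lambda>z. of_real (bump z) * gy z + of_real (dbump \<i> z) * f z)"
      using f gx gy by (auto intro!: Lp_add Lp_continuous_mult continuous_bump continuous_dbump)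
  qed (rule that)
  have "continuous_on inner_box (\<lambda>z. g z / of_real (bump z))"
    using bump_pos by (intro continuous_intros g(1) continuous_on_subset[OF continuous_bump]) (auto simp: less_imp_neq[symmetric])
  moreover have "AE z in lebesgue. z \<in> inner_box \<longrightarrow> f z = g z / of_real (bump z)"
  proof -
    have "AE z in lebesgue. z \<in> Q \<longrightarrow> z \<in> inner_box \<longrightarrow> of_real (bump z) * f z = g z"
      using g(2) by (subst (asm) AE_restrict_space_iff) auto
    then show ?thesis
    proof eventually_elim
      case (elim z)
      show ?case
      proof
        assume z: "z \<in> inner_box"
        then have "of_real (bump z) * f z = g z" using elim inner_box_inner_cbox inner_cbox_Q by blast
        then show "f z = g z / of_real (bump z)" using bump_pos[OF z] by (simp add: field_simps)
      qed
    qed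
  qed
  moreover have "inner_box \<subseteq> \<Omega>" using inner_box_inner_cbox inner_cbox_Q cl(2) by blast
  ultimately show ?thesis using open_inner_box cl(3) by blast
qed

text \<open>The set where two continuous functions differ is open, and a nonempty open set is not null.\<close>

lemma continuous_eq_of_AE_eq:
  fixes F G :: "complex \<Rightarrow> complex"
  assumes U: "open U" and c: "continuous_on U F" "continuous_on U G" and ae: "AE z in lebesgue. z \<in> U \<longrightarrow> F z = G z"
    and z: "z \<in> U"
  shows "F z = G z"
proof (rule ccontr)
  assume ne: "F z \<noteq> G z"
  have "continuous_on U (\<lambda>z. F z - G z)" by (intro continuous_intros c)
  then have op: "open (U \<inter> (\<lambda>z. F z - G z) -` (- {0}))"
    by (rule continuous_open_preimage[OF _ U]) (simp add: open_Compl)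
  define V where "V = U \<inter> (\<lambda>z. F z - G z) -` (- {0})"
  have "AE z in lebesgue. z \<notin> V" using ae by eventually_elim (auto simp: V_def)
  moreover have "V \<in> sets lebesgue" using op unfolding V_def by auto
  ultimately have "V \<in> null_sets lebesgue" by (simp only: AE_iff_null_sets)
  then have "negligible V" by (simp add: negligible_iff_null_sets)
  moreover have "\<not> negligible V" using op ne z by (intro open_not_negligible) (auto simp: V_def)
  ultimately show False by blast
qed

text \<open>Local continuous representatives agree on overlaps, so evaluating the one attached to \<open>z\<close> at \<open>z\<close>
defines a continuous function; by the theorem of Lindeloef countably many neighbourhoods suffice for
equality almost everywhere.\<close>

lemma glue_continuous_representatives:
  fixes f :: "complex \<Rightarrow> complex"
  assumes \<Omega>: "open \<Omega>" and loc: "\<And>z0. z0 \<in> \<Omega> \<Longrightarrow>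
    \<exists>U G. open U \<and> z0 \<in> U \<and> U \<subseteq> \<Omega> \<and> continuous_on U G \<and> (AE z in lebesgue. z \<in> U \<longrightarrow> f z = G z)"
  shows "\<exists>g. continuous_on \<Omega> g \<and> (AE z in lebesgue_on \<Omega>. f z = g z)"
proof -
  define \<Phi> where "\<Phi> w V H \<longleftrightarrow> open V \<and> w \<in> V \<and> V \<subseteq> \<Omega> \<and> continuous_on V H \<and>
     (AE z in lebesgue. z \<in> V \<longrightarrow> f z = H z)" for w V H
  have "\<forall>w\<in>\<Omega>. \<exists>V H. \<Phi> w V H" unfolding \<Phi>_def using loc by blast
  then obtain U G where "\<And>w. w \<in> \<Omega> \<Longrightarrow> \<Phi> w (U w) (G w)" by metis
  then have UG: "open (U w) \<and> w \<in> U w \<and> U w \<subseteq> \<Omega> \<and> continuous_on (U w) (G w) \<and>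
     (AE z in lebesgue. z \<in> U w \<longrightarrow> f z = G w z)" if "w \<in> \<Omega>" for w
    using that unfolding \<Phi>_def .
  define g where "g z = G z z" for z
  have same: "g z = G w z" if w: "w \<in> \<Omega>" and z: "z \<in> U w" for w z
  proof -
    have z\<Omega>: "z \<in> \<Omega>" using UG[OF w] z by blast
    show ?thesis unfolding g_def
    proof (rule continuous_eq_of_AE_eq[where U="U z \<inter> U w" and F="G z" and G="G w"])
      show "open (U z \<inter> U w)" using UG[OF w] UG[OF z\<Omega>] by blast
      show "continuous_on (U z \<inter> U w) (G z)" "continuous_on (U z \<inter> U w) (G w)"
        using UG[OF w] UG[OF z\<Omega>] by (auto intro: continuous_on_subset)
      have "AE x in lebesgue. x \<in> U w \<longrightarrow> f x = G w x" "AE x in lebesgue. x \<in> U z \<longrightarrow> f x = G z x"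
        using UG[OF w] UG[OF z\<Omega>] by blast+
      then show "AE x in lebesgue. x \<in> U z \<inter> U w \<longrightarrow> G z x = G w x"
        by eventually_elim auto
      show "z \<in> U z \<inter> U w" using UG[OF z\<Omega>] z by blast
    qed
  qed
  have "continuous_on \<Omega> g"
  proof (rule continuous_at_imp_continuous_on, rule ballI)
    fix w assume w: "w \<in> \<Omega>"
    have "continuous_on (U w) (G w)" using UG[OF w] by blast
    then have "continuous_on (U w) g" by (rule continuous_on_eq) (simp add: same[OF w])
    then show "isCont g w" using UG[OF w] by (simp add: continuous_on_eq_continuous_at)
  qed
  moreover have "AE z in lebesgue_on \<Omega>. f z = g z"
  proof -
    obtain F where F: "F \<subseteq> U ` \<Omega>" "countable F" "\<Union>F = \<Union>(U ` \<Omega>)"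
      by (rule Lindelof[of "U ` \<Omega>"]) (use UG in blast)+
    have AEF: "AE z in lebesgue. \<forall>V\<in>F. z \<in> V \<longrightarrow> f z = g z"
      unfolding AE_ball_countable[OF F(2)]
    proof
      fix V assume "V \<in> F"
      then obtain w where w: "w \<in> \<Omega>" "V = U w" using F(1) by blast
      have "AE z in lebesgue. z \<in> U w \<longrightarrow> f z = G w z" using UG[OF w(1)] by blast
      then show "AE z in lebesgue. z \<in> V \<longrightarrow> f z = g z"
        unfolding w(2) by eventually_elim (use same[OF w(1)] in auto)
    qed
    have cover: "\<Omega> \<subseteq> \<Union>F" unfolding F(3) using UG by blast
    from AEF have "AE z in lebesgue. z \<in> \<Omega> \<longrightarrow> f z = g z"
      by eventually_elim (use cover in blast)
    then show ?thesis using \<Omega> by (subst AE_restrict_space_iff) auto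
  qed
  ultimately show ?thesis by blast
qed

text \<open>The exponent \<open>\<gamma> = max \<alpha> (1/2)\<close> replaces \<open>\<alpha>\<close>: it is positive, so the step \<open>s / \<gamma>\<close> makes
sense, and the step does not exceed the gain \<open>2 s\<close> provided by the Sobolev inequality. For
quasiregularity the constant \<open>k\<close> may be negative, so it is replaced by \<open>max k 0\<close> before it is converted to \<open>K\<close>.\<close>

theorem theorem1:
  fixes \<Omega> :: "complex set" and A f :: "complex \<Rightarrow> complex"
  assumes "open \<Omega>" and "connected \<Omega>" and "\<Omega> \<noteq> {}"
    and "linear_at_infinity A"
    and "W1p_loc 1 \<Omega> f"
    and "AE z in lebesgue_on \<Omega>. weak_dzbar \<Omega> f z = A (weak_dz \<Omega> f z)"
  shows "(\<forall>p\<ge>1. W1p_loc p \<Omega> f) \<and>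
         ((\<exists>k<1. \<forall>\<zeta>. cmod (A \<zeta>) \<le> k * cmod \<zeta>) \<longrightarrow> quasiregular \<Omega> f)"
proof -
  define gx where "gx = weak_derivative \<Omega> 1 f"
  define gy where "gy = weak_derivative \<Omega> \<i> f"
  have ex: "\<exists>g. has_weak_derivative \<Omega> v f g" if "v \<in> {1, \<i>}" for v
    using assms(5) that unfolding W1p_loc_def by blast
  have x: "has_weak_derivative \<Omega> 1 f gx" unfolding gx_def weak_derivative_def
    by (rule someI_ex[OF ex]) simp
  have y: "has_weak_derivative \<Omega> \<i> f gy" unfolding gy_def weak_derivative_def
    by (rule someI_ex[OF ex]) simp
  obtain a b \<alpha> C where ab: "cmod a + cmod b < 1" and \<alpha>: "0 \<le> \<alpha>" "\<alpha> < 1"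
    and A: "\<And>\<zeta>. cmod (A \<zeta> - a * \<zeta> - b * cnj \<zeta>) \<le> C * (1 + cmod \<zeta> powr \<alpha>)"
    using assms(4) unfolding linear_at_infinity_def by metis
  define \<gamma> where "\<gamma> = max \<alpha> (1/2)"
  have \<gamma>: "1/2 \<le> \<gamma>" "\<gamma> < 1" "\<alpha> \<le> \<gamma>" "0 < \<gamma>" using \<alpha> by (auto simp: \<gamma>_def)
  have C0: "0 \<le> C" using order_trans[OF norm_ge_zero A[of 1]] by simp
  have A': "cmod (A \<zeta> - a * \<zeta> - b * cnj \<zeta>) \<le> (2 * C) * (1 + cmod \<zeta> powr \<gamma>)" for \<zeta>
  proof -
    define y where "y = cmod \<zeta> powr \<gamma>"
    have y: "0 \<le> y" by (simp add: y_def)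
    have "cmod \<zeta> powr \<alpha> \<le> 1 + y" unfolding y_def using \<alpha> \<gamma> by (intro powr_le_one_add_powr) auto
    then have "1 + cmod \<zeta> powr \<alpha> \<le> 2 * (1 + y)" using y unfolding mult_2 by linarith
    from order_trans[OF A mult_left_mono[OF this C0]] show ?thesis by (simp add: y_def algebra_simps)
  qed
  have eq: "AE z in lebesgue_on \<Omega>. norm ((gx z + \<i> * gy z) / 2 - a * ((gx z - \<i> * gy z) / 2) - b * cnj ((gx z - \<i> * gy z) / 2))
      \<le> (2 * C) * (1 + norm ((gx z - \<i> * gy z) / 2) powr \<gamma>)"
    using assms(6)
  proof eventually_elim
    case (elim z)
    then have "(gx z + \<i> * gy z) / 2 = A ((gx z - \<i> * gy z) / 2)"
      by (simp only: weak_dz_def weak_dzbar_def gx_def gy_def)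
    then show ?case using A'[of "(gx z - \<i> * gy z) / 2"] by simp
  qed
  define P where "P s \<longleftrightarrow> Lp_loc s \<Omega> f \<and> Lp_loc s \<Omega> gx \<and> Lp_loc s \<Omega> gy" for s
  have P1: "P 1" using x y unfolding P_def has_weak_derivative_def by blast
  have step: "P (s / \<gamma>)" if s: "1 \<le> s" and P: "P s" for s
  proof -
    have Lf: "Lp_loc s \<Omega> f" and Lx: "Lp_loc s \<Omega> gx" and Ly: "Lp_loc s \<Omega> gy"
      using P unfolding P_def by blast+
    have "s * 1 \<le> s * (2 * \<gamma>)" using \<gamma>(1) s by (intro mult_left_mono) auto
    then have le: "s / \<gamma> \<le> 2 * s" using \<gamma>(4) by (simp add: field_simps)
    have ge: "0 \<le> s / \<gamma>" using s \<gamma>(4) by simp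
    have "Lp_loc (2 * s) \<Omega> f" by (rule sobolev_loc[OF assms(1) x y s Lf Lx Ly])
    then have f: "Lp_loc (s / \<gamma>) \<Omega> f" by (rule Lp_loc_mono[OF _ ge le])
    show ?thesis unfolding P_def
      by (intro conjI f gradient_loc(1)[OF assms(1) x y ab \<gamma>(4,2) s f Lx Ly eq]
        gradient_loc(2)[OF assms(1) x y ab \<gamma>(4,2) s f Lx Ly eq])
  qed
  have Pn: "P ((1 / \<gamma>) ^ n)" for n
  proof (induction n)
    case 0 then show ?case using P1 by simp
  next
    case (Suc n)
    have "1 \<le> (1 / \<gamma>) ^ n" using \<gamma> by (intro one_le_power) (simp add: field_simps)
    from step[OF this Suc] show ?case by simp
  qed
  have Pp: "P p" if "1 \<le> p" for p
  proof -
    have "1 < 1 / \<gamma>" using \<gamma> by simp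
    then obtain n where "p < (1 / \<gamma>) ^ n" using real_arch_pow by blast
    then have "0 \<le> p" "p \<le> (1 / \<gamma>) ^ n" using that by auto
    then show ?thesis using Pn[of n] unfolding P_def by (blast intro: Lp_loc_mono)
  qed
  have W: "W1p_loc p \<Omega> f" if "1 \<le> p" for p
    using Pp[OF that] x y unfolding W1p_loc_def P_def by blast
  moreover have "quasiregular \<Omega> f" if k: "k < 1" "\<And>\<zeta>. cmod (A \<zeta>) \<le> k * cmod \<zeta>" for k
  proof -
    define k0 where "k0 = max k 0"
    have k0: "0 \<le> k0" "k0 < 1" using k by (auto simp: k0_def)
    define K where "K = (1 + k0) / (1 - k0)"
    have K1: "1 \<le> K" using k0 by (simp add: K_def field_simps)
    have Kk: "(K - 1) / (K + 1) = k0"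
    proof -
      have "K - 1 = 2 * k0 / (1 - k0)" "K + 1 = 2 / (1 - k0)" using k0 by (simp_all add: K_def field_simps)
      then show ?thesis using k0 by simp
    qed
    have "AE z in lebesgue_on \<Omega>. cmod (weak_dzbar \<Omega> f z) \<le> (K - 1) / (K + 1) * cmod (weak_dz \<Omega> f z)"
      using assms(6)
    proof eventually_elim
      case (elim z)
      have "cmod (A (weak_dz \<Omega> f z)) \<le> k * cmod (weak_dz \<Omega> f z)" by (rule k)
      also have "\<dots> \<le> k0 * cmod (weak_dz \<Omega> f z)" by (intro mult_right_mono) (auto simp: k0_def)
      finally show ?case by (simp only: elim Kk)
    qed
    moreover have "\<exists>g. continuous_on \<Omega> g \<and> (AE z in lebesgue_on \<Omega>. f z = g z)"
      using Pp[of 4] by (intro glue_continuous_representatives continuous_representative_loc[OF assms(1) x y] assms(1)) (auto simp: P_def)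
    ultimately have "K_quasiregular K \<Omega> f" using K1 W[of 2] by (simp add: K_quasiregular_def)
    then show ?thesis unfolding quasiregular_def by blast
  qed
  ultimately show ?thesis by blast
qed

end
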